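(* For every integer $h\ge 3$, the norm of the integral signature class $\tau^{\mathbf{Z}}_{2h}\in H^2(\mathrm{Sp}_{2h}(\mathbf{Z});\mathbf{R})$ satisfies $$\frac{h-2}{24}\le\lVert\tau^{\mathbf{Z}}_{2h}\rVert\le h.$$
   Context: $\mathrm{Sp}_{2h}(\mathbf{Z})$ is the group of automorphisms of $\mathbf{Z}^{2h}$ preserving the standard symplectic form. Its signature class $\tau^{\mathbf{Z}}_{2h}$ is the element of $H^2(\mathrm{Sp}_{2h}(\mathbf{Z});\mathbf{R})=\operatorname{Hom}(H_2(\mathrm{Sp}_{2h}(\mathbf{Z});\mathbf{Z}),\mathbf{R})$ defined as follows. Every class in $H_2(\mathrm{Sp}_{2h}(\mathbf{Z});\mathbf{Z})$ is of the form $f_*[\Sigma_g]$ for a map $f\colon\Sigma_g\to B\mathrm{Sp}_{2h}(\mathbf{Z})$ from a closed oriented surface; $f$ corresponds to a local coefficient system on $\Sigma_g$ with fiber $\mathbf{Z}^{2h}$ and a parallel symplectic form; let $E$ be the associated real local system with fiber $\mathbf{R}^{2h}$. Cup product combined with the symplectic form gives a symmetric bilinear pairing $H^1(\Sigma_g;E)\times H^1(\Sigma_g;E)\to H^2(\Sigma_g;\mathbf{R})\cong\mathbf{R}$, and $\tau^{\mathbf{Z}}_{2h}(f_*[\Sigma_g])$ is the signature of this form. For a discrete group $\Gamma$ and $\alpha\in H^2(\Gamma;\mathbf{R})$, the (Gromov) norm $\lVert\alpha\rVert\in[0,\infty]$ is the infimum of the sup-norms of real-valued group cocycles (in the standard bar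 resolution) representing $\alpha$. *)

theory Defs
  imports
    "Jordan_Normal_Form.VS_Connect"
    "HOL-Algebra.AbelCoset"
    "HOL-Library.Extended_Nonnegative_Real"
    "HOL-Library.Poly_Mapping"
begin

section \<open>Second real cohomology of a discrete group\<close>

text \<open>
  Inhomogeneous cochains of the (unnormalised) bar resolution with trivial real coefficients.
  The bar \<open>2\<close>-simplex \<open>[g|h]\<close> has the faces \<open>[h]\<close>, \<open>[gh]\<close>, \<open>[g]\<close>, in this order.  Cochains are
  \<open>undefined\<close> outside the carrier, so that they are determined by their values on group elements.
\<close>

definition bar_cocycles2 :: "('g, 'm) monoid_scheme \<Rightarrow> ('g \<times> 'g \<Rightarrow> real) set" where
  "bar_cocycles2 G =
    {c \<in> carrier G \<times> carrier G \<rightarrow>\<^sub>E UNIV.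
      \<forall>g\<in>carrier G. \<forall>h\<in>carrier G. \<forall>k\<in>carrier G.
        c (h, k) - c (g \<otimes>\<^bsub>G\<^esub> h, k) + c (g, h \<otimes>\<^bsub>G\<^esub> k) - c (g, h) = 0}"

definition bar_delta1 ::
  "('g, 'm) monoid_scheme \<Rightarrow> ('g \<Rightarrow> real) \<Rightarrow> ('g \<times> 'g \<Rightarrow> real)" where
  "bar_delta1 G b = (\<lambda>(g, h)\<in>carrier G \<times> carrier G. b h - b (g \<otimes>\<^bsub>G\<^esub> h) + b g)"

definition cohomologous2 ::
  "('g, 'm) monoid_scheme \<Rightarrow> (('g \<times> 'g \<Rightarrow> real) \<times> ('g \<times> 'g \<Rightarrow> real)) set" where
  "cohomologous2 G =
    {(c, c'). c \<in> bar_cocycles2 G \<and> c' \<in> bar_cocycles2 G \<and>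
      (\<exists>b. \<forall>p\<in>carrier G \<times> carrier G. c' p - c p = bar_delta1 G b p)}"

definition group_H2 :: "('g, 'm) monoid_scheme \<Rightarrow> ('g \<times> 'g \<Rightarrow> real) set set" where
  "group_H2 G = bar_cocycles2 G // cohomologous2 G"

definition gromov_norm :: "('g, 'm) monoid_scheme \<Rightarrow> ('g \<times> 'g \<Rightarrow> real) set \<Rightarrow> ennreal" where
  "gromov_norm G \<alpha> = (INF c\<in>\<alpha>. SUP p\<in>carrier G \<times> carrier G. ennreal \<bar>c p\<bar>)"

text \<open>Kronecker pairing with integral bar \<open>2\<close>-chains (free abelian group on pairs).\<close>

definition bar_eval :: "('g \<times> 'g \<Rightarrow> real) \<Rightarrow> ('g \<times> 'g \<Rightarrow>\<^sub>0 int) \<Rightarrow> real" where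
  "bar_eval c z = (\<Sum>p\<in>Poly_Mapping.keys z. of_int (Poly_Mapping.lookup z p) * c p)"


section \<open>The integral symplectic group\<close>

definition symp_form :: "nat \<Rightarrow> 'a::comm_ring_1 vec \<Rightarrow> 'a vec \<Rightarrow> 'a" where
  "symp_form h x y = (\<Sum>i<h. x $ i * y $ (h + i) - x $ (h + i) * y $ i)"

definition Sp_Z :: "nat \<Rightarrow> int mat monoid" where
  "Sp_Z h =
    \<lparr>carrier = {A \<in> carrier_mat (2 * h) (2 * h). invertible_mat A \<and>
        (\<forall>x\<in>carrier_vec (2 * h). \<forall>y\<in>carrier_vec (2 * h).
          symp_form h (A *\<^sub>v x) (A *\<^sub>v y) = symp_form h x y)},
     monoid.mult = (*), one = 1\<^sub>m (2 * h)\<rparr>"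


section \<open>Closed oriented surfaces\<close>

text \<open>
  A connected closed oriented surface is given by a finite \<open>\<Delta>\<close>-complex structure (distinct
  faces of a simplex may be identified).  The edge \<open>e\<close> runs from \<open>source e\<close> to \<open>target e\<close>; a
  triangle \<open>t\<close> has ordered vertices \<open>0, 1, 2\<close> and \<open>face i t\<close> is the edge opposite to vertex \<open>i\<close>.
  The fundamental cycle is the sum of the triangles with the signs \<open>orient t\<close>.
\<close>

record surface =
  vertices :: "nat set"
  edges :: "nat set"
  triangles :: "nat set"
  source :: "nat \<Rightarrow> nat"
  target :: "nat \<Rightarrow> nat"
  face :: "nat \<Rightarrow> nat \<Rightarrow> nat"
  orient :: "nat \<Rightarrow> int"

definition delta_complex :: "surface \<Rightarrow> bool" where
  "delta_complex K \<longleftrightarrow>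
    finite (vertices K) \<and> finite (edges K) \<and> finite (triangles K) \<and>
    (\<forall>e\<in>edges K. source K e \<in> vertices K \<and> target K e \<in> vertices K) \<and>
    (\<forall>t\<in>triangles K. (\<forall>i<3. face K i t \<in> edges K) \<and>
      source K (face K 2 t) = source K (face K 1 t) \<and>
      target K (face K 2 t) = source K (face K 0 t) \<and>
      target K (face K 1 t) = target K (face K 0 t))"

definition sides :: "surface \<Rightarrow> nat \<Rightarrow> (nat \<times> nat) set" where
  "sides K e = {(t, i). t \<in> triangles K \<and> i < 3 \<and> face K i t = e}"

text \<open>
  The points of the link of a vertex are the edge ends there, \<open>(e, False)\<close> being the initial and
  \<open>(e, True)\<close> the terminal end of \<open>e\<close>; the corners of the triangles join them.
\<close>

definition edge_end :: "surface \<Rightarrow> nat \<times> bool \<Rightarrow> nat" where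
  "edge_end K = (\<lambda>(e, b). if b then target K e else source K e)"

definition link_graph :: "surface \<Rightarrow> ((nat \<times> bool) \<times> (nat \<times> bool)) set" where
  "link_graph K = (\<Union>t\<in>triangles K.
    {((face K 2 t, False), (face K 1 t, False)),
     ((face K 2 t, True), (face K 0 t, False)),
     ((face K 1 t, True), (face K 0 t, True))})"

definition edge_graph :: "surface \<Rightarrow> (nat \<times> nat) set" where
  "edge_graph K = (\<lambda>e. (source K e, target K e)) ` edges K"

text \<open>
  Since every edge has exactly two sides, links of vertices are disjoint unions of circles, and the
  realisation is a surface if and only if they are connected.
\<close>

definition closed_oriented_surface :: "surface \<Rightarrow> bool" where
  "closed_oriented_surface K \<longleftrightarrow>
    delta_complex K \<and> triangles K \<noteq> {} \<and>
    (\<forall>v\<in>vertices K. \<forall>w\<in>vertices K. (v, w) \<in> (edge_graph K \<union> (edge_graph K)\<inverse>)\<^sup>*) \<and>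
    (\<forall>e\<in>edges K. card (sides K e) = 2) \<and>
    (\<forall>p\<in>edges K \<times> UNIV. \<forall>q\<in>edges K \<times> UNIV. edge_end K p = edge_end K q \<longrightarrow>
      (p, q) \<in> (link_graph K \<union> (link_graph K)\<inverse>)\<^sup>*) \<and>
    (\<forall>t\<in>triangles K. orient K t = 1 \<or> orient K t = -1) \<and>
    (\<forall>e\<in>edges K. (\<Sum>(t, i)\<in>sides K e. (-1) ^ i * orient K t) = 0)"

text \<open>
  Simplicial maps from the surface to the bar construction of the classifying space.  Every map
  from the surface to the classifying space is homotopic to one of these: trivialise the
  corresponding flat bundle at the vertices.
\<close>

definition bar_maps :: "surface \<Rightarrow> ('g, 'm) monoid_scheme \<Rightarrow> (nat \<Rightarrow> 'g) set" where
  "bar_maps K G = {f \<in> edges K \<rightarrow>\<^sub>E carrier G.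
    \<forall>t\<in>triangles K. f (face K 1 t) = f (face K 2 t) \<otimes>\<^bsub>G\<^esub> f (face K 0 t)}"

definition push_fundamental :: "surface \<Rightarrow> (nat \<Rightarrow> 'g) \<Rightarrow> ('g \<times> 'g \<Rightarrow>\<^sub>0 int)" where
  "push_fundamental K f =
    (\<Sum>t\<in>triangles K. frag_cmul (orient K t) (frag_of (f (face K 2 t), f (face K 0 t))))"


section \<open>Signature of a symmetric bilinear form on a real vector space\<close>

definition positive_index :: "(real, 'v) module \<Rightarrow> ('v \<Rightarrow> 'v \<Rightarrow> real) \<Rightarrow> nat" where
  "positive_index V Q = Max {vectorspace.dim class_ring (V\<lparr>carrier := W\<rparr>) | W.
    VectorSpace.subspace class_ring W V \<and> (\<forall>x\<in>W. x \<noteq> \<zero>\<^bsub>V\<^esub> \<longrightarrow> 0 < Q x x)}"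

definition form_signature :: "(real, 'v) module \<Rightarrow> ('v \<Rightarrow> 'v \<Rightarrow> real) \<Rightarrow> int" where
  "form_signature V Q = int (positive_index V Q) - int (positive_index V (\<lambda>x y. - Q x y))"

definition quotient_module :: "(real, 'v) module \<Rightarrow> 'v set \<Rightarrow> (real, 'v set) module" where
  "quotient_module V B =
    \<lparr>carrier = a_rcosets\<^bsub>V\<^esub> B, mult = undefined, one = undefined,
     zero = B, add = set_add V,
     smult = (\<lambda>r X. \<Union>x\<in>X. B +>\<^bsub>V\<^esub> (r \<odot>\<^bsub>V\<^esub> x))\<rparr>"


section \<open>Cohomology of a surface with local coefficients\<close>

text \<open>
  A simplicial map \<open>f\<close> to the bar construction gives the local system \<open>E\<close> with fibre \<open>\<real>\<^sup>2\<^sup>h\<close> at each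
  vertex, where \<open>f e\<close> carries the fibre at \<open>target e\<close> to the fibre at \<open>source e\<close>.  The value of a
  cochain on a simplex lies in the fibre at the initial vertex of the simplex.
\<close>

definition vec_cochains :: "nat \<Rightarrow> nat set \<Rightarrow> (real, nat \<Rightarrow> real vec) module" where
  "vec_cochains n S =
    \<lparr>carrier = S \<rightarrow>\<^sub>E carrier_vec n, mult = undefined, one = undefined,
     zero = (\<lambda>s\<in>S. 0\<^sub>v n), add = (\<lambda>\<phi> \<psi>. \<lambda>s\<in>S. \<phi> s + \<psi> s),
     smult = (\<lambda>r \<phi>. \<lambda>s\<in>S. r \<cdot>\<^sub>v \<phi> s)\<rparr>"

definition transport :: "(nat \<Rightarrow> int mat) \<Rightarrow> nat \<Rightarrow> real vec \<Rightarrow> real vec" where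
  "transport f e v = map_mat of_int (f e) *\<^sub>v v"

definition local_delta0 ::
  "surface \<Rightarrow> (nat \<Rightarrow> int mat) \<Rightarrow> (nat \<Rightarrow> real vec) \<Rightarrow> (nat \<Rightarrow> real vec)" where
  "local_delta0 K f s = (\<lambda>e\<in>edges K. transport f e (s (target K e)) - s (source K e))"

definition local_delta1 ::
  "surface \<Rightarrow> (nat \<Rightarrow> int mat) \<Rightarrow> (nat \<Rightarrow> real vec) \<Rightarrow> (nat \<Rightarrow> real vec)" where
  "local_delta1 K f \<phi> = (\<lambda>t\<in>triangles K.
    transport f (face K 2 t) (\<phi> (face K 0 t)) - \<phi> (face K 1 t) + \<phi> (face K 2 t))"

definition local_Z1 ::
  "nat \<Rightarrow> surface \<Rightarrow> (nat \<Rightarrow> int mat) \<Rightarrow> (nat \<Rightarrow> real vec) set" where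
  "local_Z1 h K f = {\<phi> \<in> carrier (vec_cochains (2 * h) (edges K)).
    local_delta1 K f \<phi> = \<zero>\<^bsub>vec_cochains (2 * h) (triangles K)\<^esub>}"

definition local_B1 ::
  "nat \<Rightarrow> surface \<Rightarrow> (nat \<Rightarrow> int mat) \<Rightarrow> (nat \<Rightarrow> real vec) set" where
  "local_B1 h K f = local_delta0 K f ` carrier (vec_cochains (2 * h) (vertices K))"

definition local_H1 ::
  "nat \<Rightarrow> surface \<Rightarrow> (nat \<Rightarrow> int mat) \<Rightarrow> (real, (nat \<Rightarrow> real vec) set) module" where
  "local_H1 h K f =
    quotient_module (vec_cochains (2 * h) (edges K)\<lparr>carrier := local_Z1 h K f\<rparr>) (local_B1 h K f)"

text \<open>
  Alexander--Whitney cup product, combined with the symplectic form and evaluated on the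
  fundamental cycle.
\<close>

definition cochain_cup ::
  "nat \<Rightarrow> surface \<Rightarrow> (nat \<Rightarrow> int mat) \<Rightarrow> (nat \<Rightarrow> real vec) \<Rightarrow> (nat \<Rightarrow> real vec) \<Rightarrow> real" where
  "cochain_cup h K f \<phi> \<psi> = (\<Sum>t\<in>triangles K. of_int (orient K t) *
    symp_form h (\<phi> (face K 2 t)) (transport f (face K 2 t) (\<psi> (face K 0 t))))"

definition cup_form ::
  "nat \<Rightarrow> surface \<Rightarrow> (nat \<Rightarrow> int mat) \<Rightarrow>
    (nat \<Rightarrow> real vec) set \<Rightarrow> (nat \<Rightarrow> real vec) set \<Rightarrow> real" where
  "cup_form h K f X Y = (THE r. \<forall>\<phi>\<in>X. \<forall>\<psi>\<in>Y. cochain_cup h K f \<phi> \<psi> = r)"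

definition local_signature :: "nat \<Rightarrow> surface \<Rightarrow> (nat \<Rightarrow> int mat) \<Rightarrow> int" where
  "local_signature h K f = form_signature (local_H1 h K f) (cup_form h K f)"


section \<open>The integral signature class\<close>

definition signature_class :: "nat \<Rightarrow> (int mat \<times> int mat \<Rightarrow> real) set" where
  "signature_class h = (THE \<alpha>. \<alpha> \<in> group_H2 (Sp_Z h) \<and>
    (\<forall>K f. closed_oriented_surface K \<longrightarrow> f \<in> bar_maps K (Sp_Z h) \<longrightarrow>
      (\<forall>c\<in>\<alpha>. bar_eval c (push_fundamental K f) = of_int (local_signature h K f))))"

end

theory Submission
  imports Defs "HOL-Library.Function_Algebras"
begin

text \<open>
  Fix the standard Lagrangian \<open>L\<close> in \<open>\<real>\<^sup>2\<^sup>h\<close>.  The signature class is represented by the Maslov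
  cocycle \<open>(g, k) \<mapsto> \<mu>(L, g L, g k L)\<close>, whose absolute value is at most \<open>h\<close>.  To compare it with the
  signature of the cup product on \<open>H\<^sup>1(\<Sigma>; E)\<close>, cut off the corners of the triangles and consider
  cochains whose values on the new arcs lie in \<open>L\<close>.  Inside the space \<open>Y\<close> of such cocycles, both the
  cocycles vanishing on the arcs (which compute \<open>H\<^sup>1(\<Sigma>; E)\<close>) and the cocycles vanishing on the
  edges (an orthogonal sum over the triangles of the spaces defining \<open>\<mu>\<close>) have isotropic orthogonal
  complement, so restricting the form to either of them does not change its signature.

  The class is determined by its values on surfaces because every integral \<open>2\<close>-cycle is a sum of
  surfaces glued from its simplices.  For the lower bound, let \<open>c = \<mu> + \<delta>b\<close> be bounded by \<open>C\<close>.
  Homogeneity bounds \<open>b\<close> by \<open>C\<close> on a unipotent element \<open>U\<close> fixing \<open>L\<close>; the relations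
  \<open>W = J U\<close>, \<open>J\<^sup>4 = 1\<close>, \<open>W\<^sup>3 = 1\<close> and \<open>\<mu>(L, W L, W\<^sup>2 L) = h\<close> then give \<open>h \<le> 12 C\<close>.
\<close>

section \<open>Inertia of symmetric bilinear forms\<close>

text \<open>No duality theorem for surfaces enters. That the complements are isotropic is shown by
  least squares: the linear map \<open>J\<close> of the representation makes
  \<open>\<omega> (J x) y\<close> a positive definite inner product, and the residue of an
  orthogonal projection is fed back, through \<open>J\<close>, as a test vector. A subspace is only
  asked that the vectors orthogonal to it are null, so all forms may be degenerate and coboundaries
  need not be divided out before signatures are compared.

  A real cocycle that vanishes on surfaces is a coboundary because bar simplices have integral
  boundaries: the extension problem is linear over the rationals, with the reals as a rational
  vector space, and rational relations become integral cycles once denominators are cleared.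

  Homogeneity bounds \<open>b\<close> on \<open>U\<close> only once \<open>b\<close> is bounded
  along powers of \<open>U\<close>. This is where \<open>2 \<le> h\<close> enters: with a second
  coordinate, conjugation by an elementary matrix changes a symmetric matrix by an even diagonal
  entry, which bounds \<open>b\<close> on all even powers of \<open>U\<close> at once. The argument
  gives \<open>h / 12\<close>, which is at least \<open>(h - 2) / 24\<close>.\<close>

instantiation "fun" :: (type, real_vector) real_vector
begin

definition "r *\<^sub>R f = (\<lambda>x. r *\<^sub>R f x)"

instance
  by standard (auto simp: scaleR_fun_def fun_eq_iff scaleR_add_right scaleR_add_left)

end

lemma scaleR_fun_apply [simp]: "(r *\<^sub>R f) x = r *\<^sub>R f x"
  by (simp add: scaleR_fun_def)

lemma sum_fun_apply: "(\<Sum>i\<in>A. f i) x = (\<Sum>i\<in>A. f i x)"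
  by (induction A rule: infinite_finite_induct) auto

abbreviation "lsubspace \<equiv> real_vector.subspace"
abbreviation "lspan \<equiv> real_vector.span"
abbreviation "ldim \<equiv> real_vector.dim"

text \<open>Cochains live in function types of infinite dimension, where \<open>ldim\<close> alone
  does not tell whether a subspace is finite-dimensional; finiteness is therefore a separate
  predicate.\<close>

definition finite_dim :: "'v::real_vector set \<Rightarrow> bool" where
  "finite_dim Y \<longleftrightarrow> (\<exists>B. finite B \<and> Y \<subseteq> lspan B)"

definition pos_on :: "('v::real_vector \<Rightarrow> 'v \<Rightarrow> real) \<Rightarrow> 'v set \<Rightarrow> bool" where
  "pos_on Q W \<longleftrightarrow> (\<forall>x\<in>W. x \<noteq> 0 \<longrightarrow> 0 < Q x x)"

definition radical_on :: "('v::real_vector \<Rightarrow> 'v \<Rightarrow> real) \<Rightarrow> 'v set \<Rightarrow> 'v set" where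
  "radical_on Q Y = {r \<in> Y. \<forall>w\<in>Y. Q r w = 0 \<and> Q w r = 0}"

text \<open>A Sylvester decomposition. The radical is one of its summands because the forms to come
  are degenerate, and orthogonality is asked in both orders because they are symmetric only on the
  subspaces considered.\<close>

definition inertia :: "('v::real_vector \<Rightarrow> 'v \<Rightarrow> real) \<Rightarrow> 'v set \<Rightarrow> nat \<Rightarrow> nat \<Rightarrow> bool" where
  "inertia Q Y p n \<longleftrightarrow> (\<exists>P M. lsubspace P \<and> lsubspace M \<and> P \<subseteq> Y \<and> M \<subseteq> Y \<and>
     pos_on Q P \<and> pos_on (\<lambda>x y. - Q x y) M \<and> (\<forall>x\<in>P. \<forall>y\<in>M. Q x y = 0 \<and> Q y x = 0) \<and>
     (\<forall>y\<in>Y. \<exists>x\<in>P. \<exists>z\<in>M. \<exists>r\<in>radical_on Q Y. y = x + z + r) \<and> ldim P = p \<and> ldim M = n)"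

lemma ldim_zero: "ldim {0::'v::real_vector} = 0"
  by (rule real_vector.dim_unique[of "{}"]) (auto simp: real_vector.independent_empty)

lemma finite_dim_subset: "finite_dim Y \<Longrightarrow> X \<subseteq> Y \<Longrightarrow> finite_dim X"
  by (auto simp: finite_dim_def)

lemma finite_dim_basis:
  assumes "finite_dim X" "lsubspace X"
  obtains B where "finite B" "independent B" "X = lspan B" "card B = ldim X"
proof -
  obtain C where C: "finite C" "X \<subseteq> lspan C" using assms by (auto simp: finite_dim_def)
  obtain B where B: "B \<subseteq> X" "independent B" "X \<subseteq> lspan B" "card B = ldim X"
    by (rule real_vector.basis_exists)
  have "finite B"
    using real_vector.independent_span_bound[OF C(1) B(2)] B(1) C(2) by auto
  moreover have "X = lspan B"
    using B assms(2) real_vector.span_minimal by blast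
  ultimately show ?thesis using that B by blast
qed

lemma finite_dim_independent_card:
  assumes "finite_dim X" "lsubspace X" "independent B" "B \<subseteq> X"
  shows "finite B" "card B \<le> ldim X"
proof -
  obtain C where C: "finite C" "X = lspan C" "card C = ldim X"
    using finite_dim_basis[OF assms(1,2)] by metis
  then show "finite B" "card B \<le> ldim X"
    using real_vector.independent_span_bound[OF C(1) assms(3)] assms(4) by auto
qed

lemma independent_all_scalars:
  assumes "independent A" "S \<subseteq> A" "finite S" "(\<Sum>v\<in>S. u v *\<^sub>R v) = (0::'v::real_vector)"
  shows "\<forall>v\<in>S. u v = 0"
  using assms real_vector.independent_explicit_finite_subsets by blast

text \<open>A linear relation that is total on \<open>X\<close> and relates only \<open>0\<close> to \<open>0\<close> serves as an
  injection, without having to construct a linear map first.\<close>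
lemma dim_le_by_relation:
  assumes X: "finite_dim X" "lsubspace X" and Z: "finite_dim Z" "lsubspace Z"
    and total: "\<And>x. x \<in> X \<Longrightarrow> \<exists>z\<in>Z. R x z"
    and add: "\<And>x z x' z'. R x z \<Longrightarrow> R x' z' \<Longrightarrow> R (x + x') (z + z')"
    and scale: "\<And>r x z. R x z \<Longrightarrow> R (r *\<^sub>R x) (r *\<^sub>R z)"
    and inj: "\<And>x. x \<in> X \<Longrightarrow> R x 0 \<Longrightarrow> x = 0"
  shows "ldim X \<le> ldim Z"
proof -
  obtain B where B: "finite B" "independent B" "X = lspan B" "card B = ldim X"
    using finite_dim_basis[OF X] .
  have "\<forall>b\<in>B. \<exists>z\<in>Z. R b z"
    using total B(3) real_vector.span_base by blast
  then obtain g where g: "\<And>b. b \<in> B \<Longrightarrow> g b \<in> Z \<and> R b (g b)" by metis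
  obtain f where f: "linear f" "\<And>b. b \<in> B \<Longrightarrow> f b = g b"
    using linear_independent_extend[OF B(2)] by metis
  interpret f: linear f by fact
  have R0: "R 0 0"
  proof -
    obtain z where "R 0 z" using total[of 0] X(2) real_vector.subspace_0 by blast
    from scale[OF this, of 0] show ?thesis by simp
  qed
  have Rf: "R x (f x) \<and> f x \<in> Z" if "x \<in> lspan B" for x
    using that
  proof (induction rule: real_vector.span_induct_alt)
    case base
    show ?case using R0 Z(2) real_vector.subspace_0 by (simp add: f.zero) 
  next
    case (step c x y)
    have "R (c *\<^sub>R x + y) (c *\<^sub>R f x + f y)"
      using step g f(2) by (intro add scale) auto
    moreover have "c *\<^sub>R f x + f y \<in> Z"
      using step g f(2) Z(2) by (intro real_vector.subspace_add real_vector.subspace_scale) auto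
    ultimately show ?case by (simp add: f.add f.scaleR)
  qed
  have injf: "inj_on f (lspan B)"
  proof (rule inj_onI)
    fix x y assume xy: "x \<in> lspan B" "y \<in> lspan B" "f x = f y"
    then have "R (x - y) (f (x - y))" "x - y \<in> X"
      using Rf B(3) real_vector.span_diff by blast+
    then show "x = y" using xy(3) inj[of "x - y"] by (simp add: f.diff)
  qed
  have "independent (f ` B)"
  proof (rule real_vector.independent_if_scalars_zero)
    show "finite (f ` B)" using B by simp
    fix c y assume s: "(\<Sum>y\<in>f ` B. c y *\<^sub>R y) = 0" and y: "y \<in> f ` B"
    have "inj_on f B" using inj_on_subset[OF injf] real_vector.span_superset by blast
    then have "f (\<Sum>b\<in>B. c (f b) *\<^sub>R b) = 0"
      using s by (simp add: sum.reindex f.sum f.scaleR)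
    moreover have "(\<Sum>b\<in>B. c (f b) *\<^sub>R b) \<in> lspan B"
      by (intro real_vector.span_sum real_vector.span_scale real_vector.span_base)
    ultimately have "(\<Sum>b\<in>B. c (f b) *\<^sub>R b) = 0"
      using injf f.zero by (metis inj_onD real_vector.span_zero)
    then show "c y = 0"
      using y B(1) independent_all_scalars[OF B(2) subset_refl B(1), of "\<lambda>b. c (f b)"] by blast
  qed
  moreover have "f ` B \<subseteq> Z" using g f by auto
  ultimately have "card (f ` B) \<le> ldim Z"
    using finite_dim_independent_card[OF Z] by blast
  moreover have "card (f ` B) = card B"
    using injf by (intro card_image inj_on_subset[OF injf]) (auto simp: real_vector.span_base)
  ultimately show ?thesis using B by simp
qed

lemma dim_mono_finite:
  assumes "finite_dim Y" "lsubspace Y" "lsubspace X" "X \<subseteq> Y"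
  shows "ldim X \<le> ldim Y"
  by (rule dim_le_by_relation[where R = "(=)", OF finite_dim_subset[OF assms(1,4)] assms(3,1,2)])
     (use assms(4) in auto)

lemma lsubspace_sum: "lsubspace S \<Longrightarrow> lsubspace T \<Longrightarrow> lsubspace {x + y |x y. x \<in> S \<and> y \<in> T}"
  by (rule real_vector.subspace_sums)

lemma finite_dim_sums:
  assumes "finite_dim S" "finite_dim T"
  shows "finite_dim {x + y |x y. x \<in> S \<and> y \<in> T}"
proof -
  obtain B C where "finite B" "S \<subseteq> lspan B" "finite C" "T \<subseteq> lspan C"
    using assms by (auto simp: finite_dim_def)
  then have "finite (B \<union> C)" "{x + y |x y. x \<in> S \<and> y \<in> T} \<subseteq> lspan (B \<union> C)"
    unfolding real_vector.span_Un by blast+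
  then show ?thesis unfolding finite_dim_def by blast
qed

lemma dim_direct_sum:
  assumes "finite_dim S" "lsubspace S" "finite_dim T" "lsubspace T" "S \<inter> T \<subseteq> {0}"
  shows "ldim {x + y |x y. x \<in> S \<and> y \<in> T} = ldim S + ldim T"
proof -
  obtain B where B: "finite B" "independent B" "S = lspan B" "card B = ldim S"
    using finite_dim_basis[OF assms(1,2)] .
  obtain C where C: "finite C" "independent C" "T = lspan C" "card C = ldim T"
    using finite_dim_basis[OF assms(3,4)] .
  have disj: "B \<inter> C = {}"
  proof -
    have "b \<notin> B \<inter> C" for b
    proof
      assume "b \<in> B \<inter> C"
      then have "b \<in> S" "b \<in> T" unfolding B(3) C(3) by (auto intro: real_vector.span_base)
      then have "b = 0" using assms(5) by blast
      then show False using \<open>b \<in> B \<inter> C\<close> B(2) real_vector.dependent_zero by (metis IntD1)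
    qed
    then show ?thesis by blast
  qed
  have "independent (B \<union> C)"
  proof (rule real_vector.independent_if_scalars_zero)
    show "finite (B \<union> C)" using B C by simp
    fix f x assume s: "(\<Sum>x\<in>B \<union> C. f x *\<^sub>R x) = 0" and x: "x \<in> B \<union> C"
    let ?b = "\<Sum>x\<in>B. f x *\<^sub>R x" and ?c = "\<Sum>x\<in>C. f x *\<^sub>R x"
    have bc: "?b + ?c = 0" using s B C disj by (simp add: sum.union_disjoint)
    have b: "?b \<in> S" unfolding B(3)
      by (intro real_vector.span_sum real_vector.span_scale real_vector.span_base)
    have c: "?c \<in> T" unfolding C(3)
      by (intro real_vector.span_sum real_vector.span_scale real_vector.span_base)
    have "?b = - ?c" using bc by (simp add: eq_neg_iff_add_eq_0)
    then have "?b \<in> T" using c assms(4) real_vector.subspace_neg by metis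
    then have "?b = 0" using b assms(5) by blast
    moreover then have "?c = 0" using bc by simp
    ultimately show "f x = 0"
      using x B(1,2) C(1,2) real_vector.independent_explicit_finite_subsets by (metis UnE subset_refl)
  qed
  then have "ldim (lspan (B \<union> C)) = card (B \<union> C)"
    by (rule real_vector.dim_span_eq_card_independent)
  moreover have "lspan (B \<union> C) = {x + y |x y. x \<in> S \<and> y \<in> T}"
    unfolding real_vector.span_Un B C by simp
  ultimately show ?thesis using B C disj by (simp add: card_Un_disjoint)
qed

locale bilinear_form =
  fixes Q :: "'v::real_vector \<Rightarrow> 'v \<Rightarrow> real"
  assumes add_left: "Q (x + y) z = Q x z + Q y z"
    and add_right: "Q x (y + z) = Q x y + Q x z"
    and scale_left: "Q (r *\<^sub>R x) z = r * Q x z"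
    and scale_right: "Q x (r *\<^sub>R z) = r * Q x z"
begin

lemma zero_left [simp]: "Q 0 z = 0" and zero_right [simp]: "Q x 0 = 0"
  using scale_left[of 0 0 z] scale_right[of x 0 0] by simp_all

lemma minus_left: "Q (- x) z = - Q x z" and minus_right: "Q x (- z) = - Q x z"
  using scale_left[of "-1" x z] scale_right[of x "-1" z] by simp_all

lemma diff_left: "Q (x - y) z = Q x z - Q y z" and diff_right: "Q x (y - z) = Q x y - Q x z"
  using add_left[of x "-y" z] add_right[of x y "-z"] by (simp_all add: minus_left minus_right)

lemma sum_left: "Q (\<Sum>i\<in>A. f i) z = (\<Sum>i\<in>A. Q (f i) z)"
  and sum_right: "Q x (\<Sum>i\<in>A. f i) = (\<Sum>i\<in>A. Q x (f i))"
  by (induction A rule: infinite_finite_induct) (auto simp: add_left add_right)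

lemma bilinear_form_uminus: "bilinear_form (\<lambda>x y. - Q x y)"
  by unfold_locales (simp_all add: add_left add_right scale_left scale_right)

lemma subspace_orthogonal:
  assumes "lsubspace Y"
  shows "lsubspace {y \<in> Y. \<forall>w\<in>W. Q w y = 0}"
  using assms unfolding real_vector.subspace_def by (auto simp: add_right scale_right)

lemma subspace_radical:
  assumes "lsubspace Y"
  shows "lsubspace (radical_on Q Y)"
  using assms unfolding real_vector.subspace_def radical_on_def
  by (auto simp: add_right scale_right add_left scale_left)

text \<open>Gram--Schmidt along a spanning set. Anisotropy in place of positivity covers definite
  forms of either sign, and \<open>y\<close> may be any vector of the type.\<close>

lemma orthogonal_projection:
  assumes fin: "finite_dim W" and sub: "lsubspace W" and aniso: "\<And>w. w \<in> W \<Longrightarrow> Q w w = 0 \<Longrightarrow> w = 0"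
    and sym: "\<And>x y. x \<in> W \<Longrightarrow> y \<in> W \<Longrightarrow> Q x y = Q y x"
  obtains w where "w \<in> W" "\<And>u. u \<in> W \<Longrightarrow> Q u (y - w) = 0"
proof -
  have "\<exists>w\<in>lspan B. \<forall>u\<in>lspan B. Q u (y - w) = 0" if "finite B" "lspan B \<subseteq> W" for B y
    using that
  proof (induction B arbitrary: y rule: finite_induct)
    case empty
    then show ?case by simp
  next
    case (insert b B)
    have sB: "lspan B \<subseteq> W"
      using insert.prems real_vector.span_mono[of B "insert b B"] by auto
    obtain v where v: "v \<in> lspan B" "\<And>u. u \<in> lspan B \<Longrightarrow> Q u (b - v) = 0"
      using insert.IH[OF sB, of b] by blast
    obtain w where w: "w \<in> lspan B" "\<And>u. u \<in> lspan B \<Longrightarrow> Q u (y - w) = 0"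
      using insert.IH[OF sB, of y] by blast
    define b' where "b' = b - v"
    have vB: "v \<in> lspan (insert b B)" "w \<in> lspan (insert b B)"
      using v w real_vector.span_mono[of B "insert b B"] by auto
    have b': "b' \<in> lspan (insert b B)"
      unfolding b'_def using vB by (intro real_vector.span_diff) (auto simp: real_vector.span_base)
    define c where "c = Q b' (y - w) / Q b' b'"
    have decomp: "\<exists>k. u - k *\<^sub>R b' \<in> lspan B" if uB: "u \<in> lspan (insert b B)" for u
    proof -
      obtain k where "u - k *\<^sub>R b \<in> lspan B"
        using uB real_vector.span_breakdown_eq[of u b B] by blast
      then have "(u - k *\<^sub>R b) + k *\<^sub>R v \<in> lspan B"
        using v by (intro real_vector.span_add real_vector.span_scale)
      then show ?thesis unfolding b'_def by (intro exI[of _ k]) (simp add: algebra_simps)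
    qed
    have ortho: "Q u b' = 0" if "u \<in> lspan B" for u using v that b'_def by simp
    show ?case
    proof (intro bexI[of _ "w + c *\<^sub>R b'"] ballI)
      show "w + c *\<^sub>R b' \<in> lspan (insert b B)"
        using vB b' by (intro real_vector.span_add real_vector.span_scale)
      fix u assume "u \<in> lspan (insert b B)"
      then obtain k where k: "u - k *\<^sub>R b' \<in> lspan B" using decomp by blast
      have 1: "Q (u - k *\<^sub>R b') (y - (w + c *\<^sub>R b')) = 0"
        using w(2)[OF k] ortho[OF k] by (simp add: diff_right add_right scale_right)
      have 2: "Q b' (y - (w + c *\<^sub>R b')) = 0"
      \<comment> \<open>\<open>b'\<close> is isotropic only when \<open>b\<close> already lies in
        the span of \<open>B\<close>; the default value of the division in \<open>c\<close> is then
        harmless.\<close>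
      proof (cases "Q b' b' = 0")
        case True
        then have "b' = 0" using aniso b' insert.prems by blast
        then show ?thesis by simp
      next
        case False
        have "Q b' (y - (w + c *\<^sub>R b')) = Q b' (y - w) - c * Q b' b'"
          by (simp add: diff_right add_right scale_right)
        then show ?thesis using False by (simp add: c_def)
      qed
      from 1 2 show "Q u (y - (w + c *\<^sub>R b')) = 0"
        by (simp add: diff_left scale_left)
    qed
  qed
  moreover obtain B where "finite B" "W = lspan B" using finite_dim_basis[OF fin sub] by metis
  ultimately show ?thesis using that by blast
qed

lemma pos_on_projection:
  assumes "finite_dim Y" "lsubspace Y" "\<And>x y. x \<in> Y \<Longrightarrow> y \<in> Y \<Longrightarrow> Q x y = Q y x"
    and "lsubspace P" "P \<subseteq> Y" "pos_on Q P" "y \<in> Y"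
  obtains p z where "p \<in> P" "z \<in> Y" "y = p + z" "\<And>u. u \<in> P \<Longrightarrow> Q u z = 0"
proof -
  have fP: "finite_dim P" using assms finite_dim_subset by blast
  have sP: "Q u v = Q v u" if "u \<in> P" "v \<in> P" for u v using assms that by blast
  have aP: "w = 0" if "w \<in> P" "Q w w = 0" for w using assms(6) that by (force simp: pos_on_def)
  obtain p where p: "p \<in> P" "\<And>u. u \<in> P \<Longrightarrow> Q u (y - p) = 0"
    using orthogonal_projection[OF fP assms(4) aP sP] by metis
  show ?thesis
    by (rule that[of p "y - p"]) (use p assms in \<open>auto intro: real_vector.subspace_diff\<close>)
qed

text \<open>A positive subspace of largest dimension has this property: a vector orthogonal to it
  with positive square could be adjoined.\<close>

lemma maximal_pos_subspace:
  assumes Y: "finite_dim Y" "lsubspace Y" and sym: "\<And>x y. x \<in> Y \<Longrightarrow> y \<in> Y \<Longrightarrow> Q x y = Q y x"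
  obtains P where "lsubspace P" "P \<subseteq> Y" "pos_on Q P"
    "\<And>y. y \<in> Y \<Longrightarrow> (\<And>u. u \<in> P \<Longrightarrow> Q u y = 0) \<Longrightarrow> Q y y \<le> 0"
proof -
  define D where "D = {ldim P |P. lsubspace P \<and> P \<subseteq> Y \<and> pos_on Q P}"
  have "0 \<in> D" unfolding D_def
    by (rule CollectI, rule exI[of _ "{0}"])
       (use Y in \<open>auto simp: pos_on_def real_vector.subspace_0 real_vector.subspace_single_0 ldim_zero\<close>)
  have "d \<le> ldim Y" if "d \<in> D" for d
    using that Y dim_mono_finite unfolding D_def by auto
  then have fD: "finite D" using finite_nat_set_iff_bounded_le by blast
  have "Max D \<in> D" using Max_in[OF fD] \<open>0 \<in> D\<close> by blast
  then obtain P where "lsubspace P" "P \<subseteq> Y" "pos_on Q P" "Max D = ldim P" unfolding D_def by blast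
  then have P: "lsubspace P" "P \<subseteq> Y" "pos_on Q P" "\<And>d. d \<in> D \<Longrightarrow> d \<le> ldim P"
    using Max_ge[OF fD] by simp_all
  show ?thesis
  proof (rule that[OF P(1-3)], rule ccontr)
    fix y assume y: "y \<in> Y" "\<And>u. u \<in> P \<Longrightarrow> Q u y = 0" and neg: "\<not> Q y y \<le> 0"
    define P' where "P' = {u + v |u v. u \<in> P \<and> v \<in> lspan {y}}"
    have fy: "finite_dim (lspan {y})" unfolding finite_dim_def by blast
    have fP: "finite_dim P" using Y P finite_dim_subset by blast
    have "v = 0" if "v \<in> P" "v \<in> lspan {y}" for v
    proof -
      obtain k where k: "v = k *\<^sub>R y" using \<open>v \<in> lspan {y}\<close> by (auto simp: real_vector.span_singleton)
      have "Q v y = 0" using y that by blast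
      then have "k = 0" using k neg by (simp add: scale_left)
      then show ?thesis using k by simp
    qed
    then have "ldim P' = ldim P + ldim (lspan {y})"
      unfolding P'_def by (intro dim_direct_sum fP fy P) (auto simp: real_vector.subspace_span)
    moreover have "ldim (lspan {y}) = 1"
      using neg by (subst real_vector.dim_span_eq_card_independent) auto
    moreover have "ldim P' \<in> D" unfolding D_def
    proof (intro CollectI exI[of _ P'] conjI refl)
      show "lsubspace P'" unfolding P'_def
        by (intro lsubspace_sum P real_vector.subspace_span)
      have yY: "lspan {y} \<subseteq> Y" using Y y by (intro real_vector.span_minimal) auto
      then show "P' \<subseteq> Y" unfolding P'_def using P Y real_vector.subspace_add by blast
      show "pos_on Q P'" unfolding pos_on_def
      proof (intro ballI impI)
        fix x assume "x \<in> P'" "x \<noteq> 0"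
        then obtain u k where u: "u \<in> P" "x = u + k *\<^sub>R y"
          unfolding P'_def by (auto simp: real_vector.span_singleton)
        have uy: "Q u y = 0" "Q y u = 0" using y u sym P by (blast, metis subsetD)
        have "Q x x = Q u u + k * k * Q y y"
          unfolding u(2) by (simp add: add_left add_right scale_left scale_right uy)
        moreover have "u \<noteq> 0 \<or> k \<noteq> 0" using \<open>x \<noteq> 0\<close> u by auto
        moreover have "u \<noteq> 0 \<Longrightarrow> Q u u > 0" using P(3) u by (auto simp: pos_on_def)
        moreover have "k \<noteq> 0 \<Longrightarrow> k * k * Q y y > 0"
          using neg by (simp add: zero_less_mult_iff linorder_neq_iff) argo
        moreover have "0 \<le> k * k * Q y y" using neg by simp
        moreover have "u = 0 \<Longrightarrow> Q u u = 0" by simp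
        ultimately show "0 < Q x x" by (smt (verit))
      qed
    qed
    ultimately show False using P(4)[of "ldim P'"] by simp
  qed
qed

text \<open>Polarisation: expand the square of \<open>x + y\<close>.\<close>

lemma isotropic_if_null:
  assumes Y: "lsubspace Y" and sym: "\<And>x y. x \<in> Y \<Longrightarrow> y \<in> Y \<Longrightarrow> Q x y = Q y x"
    and zero: "\<And>y. y \<in> Y \<Longrightarrow> Q y y = 0" and "x \<in> Y" "y \<in> Y"
  shows "Q x y = 0"
proof -
  have "Q (x + y) (x + y) = 0" using assms real_vector.subspace_add by blast
  then show ?thesis using zero[OF \<open>x \<in> Y\<close>] zero[OF \<open>y \<in> Y\<close>] sym[OF \<open>x \<in> Y\<close> \<open>y \<in> Y\<close>]
    by (simp add: add_left add_right)
qed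

text \<open>Take a maximal positive \<open>P\<close>, then a maximal negative \<open>M\<close> in
  its complement. A vector orthogonal to both has a square that is neither positive nor negative, so
  by polarisation the form vanishes on what remains.\<close>

lemma inertia_exists:
  assumes Y: "finite_dim Y" "lsubspace Y" and sym: "\<And>x y. x \<in> Y \<Longrightarrow> y \<in> Y \<Longrightarrow> Q x y = Q y x"
  obtains p n where "inertia Q Y p n"
proof -
  interpret neg: bilinear_form "\<lambda>x y. - Q x y" by (rule bilinear_form_uminus)
  obtain P where P: "lsubspace P" "P \<subseteq> Y" "pos_on Q P"
    "\<And>y. y \<in> Y \<Longrightarrow> (\<And>u. u \<in> P \<Longrightarrow> Q u y = 0) \<Longrightarrow> Q y y \<le> 0"
    using maximal_pos_subspace[OF assms] by metis
  define Y1 where "Y1 = {y \<in> Y. \<forall>u\<in>P. Q u y = 0}"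
  have Y1: "lsubspace Y1" "Y1 \<subseteq> Y" unfolding Y1_def using subspace_orthogonal[OF Y(2)] by auto
  have f1: "finite_dim Y1" using Y Y1 finite_dim_subset by blast
  have s1: "- Q x y = - Q y x" if "x \<in> Y1" "y \<in> Y1" for x y using that Y1 sym by (metis subsetD)
  obtain M where M: "lsubspace M" "M \<subseteq> Y1" "pos_on (\<lambda>x y. - Q x y) M"
    "\<And>y. y \<in> Y1 \<Longrightarrow> (\<And>u. u \<in> M \<Longrightarrow> - Q u y = 0) \<Longrightarrow> - Q y y \<le> 0"
    using neg.maximal_pos_subspace[OF f1 Y1(1) s1] by metis
  define Y2 where "Y2 = {y \<in> Y1. \<forall>u\<in>M. Q u y = 0}"
  have Y2: "lsubspace Y2" "Y2 \<subseteq> Y1" unfolding Y2_def using subspace_orthogonal[OF Y1(1)] by auto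
  have z2: "Q y y = 0" if "y \<in> Y2" for y
    using M(4)[of y] P(4)[of y] that by (fastforce simp: Y2_def Y1_def)
  have i2: "Q x y = 0" if "x \<in> Y2" "y \<in> Y2" for x y
    by (rule isotropic_if_null[OF Y2(1) _ z2])
       (use that Y2 Y1 sym in \<open>blast+\<close>)
  have dec: "\<exists>x\<in>P. \<exists>z\<in>M. \<exists>r\<in>Y2. y = x + z + r" if yY: "y \<in> Y" for y
  proof -
    obtain p z where p: "p \<in> P" "z \<in> Y" "y = p + z" "\<And>u. u \<in> P \<Longrightarrow> Q u z = 0"
      using pos_on_projection[OF Y sym P(1-3) yY] by blast
    then have z: "z \<in> Y1" by (simp add: Y1_def)
    obtain m r where m: "m \<in> M" "r \<in> Y1" "z = m + r" "\<And>u. u \<in> M \<Longrightarrow> - Q u r = 0"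
      using neg.pos_on_projection[OF f1 Y1(1) s1 M(1-3) z] by blast
    then have "r \<in> Y2" by (simp add: Y2_def)
    then show ?thesis using p m by (metis add.assoc)
  qed
  \<comment> \<open>A vector of \<open>Y2\<close> is orthogonal to \<open>P\<close>, to
    \<open>M\<close> and to \<open>Y2\<close> itself, and these three span \<open>Y\<close>.\<close>
  have "Y2 \<subseteq> radical_on Q Y" unfolding radical_on_def
  proof (intro subsetI CollectI conjI ballI)
    fix r assume r: "r \<in> Y2"
    then show "r \<in> Y" using Y1 Y2 by blast
    fix w assume w: "w \<in> Y"
    then obtain x z s where "x \<in> P" "z \<in> M" "s \<in> Y2" "w = x + z + s" using dec by blast
    moreover have "Q x r = 0" "Q z r = 0" if "x \<in> P" "z \<in> M" for x z
      using r that by (auto simp: Y1_def Y2_def)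
    ultimately show "Q w r = 0" using r i2 by (simp add: add_left)
    then show "Q r w = 0" using sym[OF w \<open>r \<in> Y\<close>] by simp
  qed
  then have dec': "\<exists>x\<in>P. \<exists>z\<in>M. \<exists>r\<in>radical_on Q Y. y = x + z + r" if "y \<in> Y" for y
    using dec[OF that] by blast
  have oPM: "Q x y = 0" "Q y x = 0" if xy: "x \<in> P" "y \<in> M" for x y
  proof -
    have "y \<in> Y" "x \<in> Y" and *: "Q x y = 0" using xy M(2) P(2) unfolding Y1_def by blast+
    then show "Q x y = 0" "Q y x = 0" using sym[of x y] by auto
  qed
  have "inertia Q Y (ldim P) (ldim M)" unfolding inertia_def
    by (rule exI[of _ P], rule exI[of _ M], intro conjI refl P M ballI)
       (use M(2) Y1 dec' P(2) oPM in \<open>blast+\<close>)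
  then show ?thesis using that by blast
qed

lemma inertia_uminus: "inertia Q Y p n \<Longrightarrow> inertia (\<lambda>x y. - Q x y) Y n p"
proof -
  assume "inertia Q Y p n"
  then obtain P M where PM: "lsubspace P" "lsubspace M" "P \<subseteq> Y" "M \<subseteq> Y"
     "pos_on Q P" "pos_on (\<lambda>x y. - Q x y) M" "\<And>x y. x \<in> P \<Longrightarrow> y \<in> M \<Longrightarrow> Q x y = 0 \<and> Q y x = 0"
     "\<And>y. y\<in>Y \<Longrightarrow> \<exists>x\<in>P. \<exists>z\<in>M. \<exists>r\<in>radical_on Q Y. y = x + z + r" "ldim P = p" "ldim M = n"
    unfolding inertia_def by blast
  have r1: "radical_on (\<lambda>x y. - Q x y) Y = radical_on Q Y" by (simp add: radical_on_def)
  have r2: "\<exists>x\<in>M. \<exists>z\<in>P. \<exists>r\<in>radical_on Q Y. y = x + z + r" if "y \<in> Y" for y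
    using PM(8)[OF that] by (metis add.commute)
  show ?thesis unfolding inertia_def
    by (rule exI[of _ M], rule exI[of _ P]) (use PM r1 r2 in auto)
qed

text \<open>Projection of \<open>W\<close> to \<open>P\<close> along \<open>M\<close> and the
  radical is injective, since the form is nonpositive on its kernel. The projection enters as the
  relation \<open>R\<close>.\<close>

lemma pos_dim_le:
  assumes Y: "finite_dim Y" "lsubspace Y" and in1: "inertia Q Y p n"
    and W: "lsubspace W" "W \<subseteq> Y" "pos_on Q W"
  shows "ldim W \<le> p"
proof -
  obtain P M where PM: "lsubspace P" "lsubspace M" "P \<subseteq> Y" "M \<subseteq> Y"
     "pos_on Q P" "pos_on (\<lambda>x y. - Q x y) M"
     "\<And>y. y\<in>Y \<Longrightarrow> \<exists>x\<in>P. \<exists>z\<in>M. \<exists>r\<in>radical_on Q Y. y = x + z + r" "ldim P = p"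
    using in1 unfolding inertia_def by blast
  define R where "R = (\<lambda>y x. \<exists>z\<in>M. \<exists>r\<in>radical_on Q Y. y = x + z + r)"
  note rad = subspace_radical[OF Y(2)]
  have "ldim W \<le> ldim P"
  proof (rule dim_le_by_relation[where R = R])
    show "finite_dim W" "finite_dim P" using Y W PM finite_dim_subset by blast+
    show "lsubspace W" "lsubspace P" by fact+
    show "\<exists>z\<in>P. R x z" if "x \<in> W" for x using PM(7) W that unfolding R_def by blast
    show "R (x + x') (z + z')" if xz: "R x z" "R x' z'" for x z x' z'
    proof -
      obtain m r m' r' where "m \<in> M" "r \<in> radical_on Q Y" "x = z + m + r"
         "m' \<in> M" "r' \<in> radical_on Q Y" "x' = z' + m' + r'" using xz unfolding R_def by blast
      then show ?thesis unfolding R_def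
        by (intro bexI[of _ "m + m'"] bexI[of _ "r + r'"]) (use PM rad in \<open>auto intro: real_vector.subspace_add\<close>)
    qed
    show "R (c *\<^sub>R x) (c *\<^sub>R z)" if xz: "R x z" for c x z
    proof -
      obtain m r where "m \<in> M" "r \<in> radical_on Q Y" "x = z + m + r" using xz unfolding R_def by blast
      then show ?thesis unfolding R_def
        by (intro bexI[of _ "c *\<^sub>R m"] bexI[of _ "c *\<^sub>R r"])
           (use PM rad in \<open>auto intro: real_vector.subspace_scale simp: scaleR_add_right\<close>)
    qed
    show "x = 0" if x: "x \<in> W" "R x 0" for x
    proof (rule ccontr)
      assume "x \<noteq> 0"
      then have pos: "0 < Q x x" using W x by (auto simp: pos_on_def)
      obtain m r where m: "m \<in> M" "r \<in> radical_on Q Y" "x = m + r" using x unfolding R_def by auto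
      have "Q x x = Q m m" unfolding m(3) using m PM by (auto simp: add_left add_right radical_on_def)
      moreover have "Q m m \<le> 0" using PM(6) m by (cases "m = 0") (auto simp: pos_on_def)
      ultimately show False using pos by simp
    qed
  qed
  then show ?thesis using PM by simp
qed

text \<open>Sylvester's law of inertia: each positive part bounds the other, and likewise for the
  negative parts.\<close>

lemma inertia_unique:
  assumes Y: "finite_dim Y" "lsubspace Y" and in1: "inertia Q Y p n" and in2: "inertia Q Y p' n'"
  shows "p = p'" "n = n'"
proof -
  interpret neg: bilinear_form "\<lambda>x y. - Q x y" by (rule bilinear_form_uminus)
  have *: "p \<le> p'" "n \<le> n'" if 1: "inertia Q Y p n" and 2: "inertia Q Y p' n'" for p n p' n'
    using 1 pos_dim_le[OF Y 2] neg.pos_dim_le[OF Y inertia_uminus[OF 2]] unfolding inertia_def by blast+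
  show "p = p'" "n = n'" using *[OF in1 in2] *[OF in2 in1] by auto
qed

lemma inertia_orthogonal_sum:
  assumes Y: "finite_dim Y"
    and Y12: "Y = {x + y |x y. x \<in> Y1 \<and> y \<in> Y2}" and sub: "lsubspace Y1" "lsubspace Y2"
    and ortho: "\<And>x y. x \<in> Y1 \<Longrightarrow> y \<in> Y2 \<Longrightarrow> Q x y = 0 \<and> Q y x = 0"
    and in1: "inertia Q Y1 p1 n1" and in2: "inertia Q Y2 p2 n2"
  shows "inertia Q Y (p1 + p2) (n1 + n2)"
proof -
  interpret neg: bilinear_form "\<lambda>x y. - Q x y" by (rule bilinear_form_uminus)
  have Y12': "Y1 \<subseteq> Y" "Y2 \<subseteq> Y"
    unfolding Y12 using real_vector.subspace_0[OF sub(1)] real_vector.subspace_0[OF sub(2)]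
    by (auto, metis add.right_neutral, metis add.left_neutral)
  obtain P1 M1 where 1: "lsubspace P1" "lsubspace M1" "P1 \<subseteq> Y1" "M1 \<subseteq> Y1"
     "pos_on Q P1" "pos_on (\<lambda>x y. - Q x y) M1" "\<And>x y. x \<in> P1 \<Longrightarrow> y \<in> M1 \<Longrightarrow> Q x y = 0 \<and> Q y x = 0"
     "\<And>y. y\<in>Y1 \<Longrightarrow> \<exists>x\<in>P1. \<exists>z\<in>M1. \<exists>r\<in>radical_on Q Y1. y = x + z + r" "ldim P1 = p1" "ldim M1 = n1"
    using in1 unfolding inertia_def by blast
  obtain P2 M2 where 2: "lsubspace P2" "lsubspace M2" "P2 \<subseteq> Y2" "M2 \<subseteq> Y2"
     "pos_on Q P2" "pos_on (\<lambda>x y. - Q x y) M2" "\<And>x y. x \<in> P2 \<Longrightarrow> y \<in> M2 \<Longrightarrow> Q x y = 0 \<and> Q y x = 0"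
     "\<And>y. y\<in>Y2 \<Longrightarrow> \<exists>x\<in>P2. \<exists>z\<in>M2. \<exists>r\<in>radical_on Q Y2. y = x + z + r" "ldim P2 = p2" "ldim M2 = n2"
    using in2 unfolding inertia_def by blast
  have fd: "finite_dim P1" "finite_dim P2" "finite_dim M1" "finite_dim M2"
    using Y12' Y 1(3,4) 2(3,4) finite_dim_subset by (metis subset_trans)+
  have pos: "pos_on Q' {x + y |x y. x \<in> A \<and> y \<in> B} \<and> A \<inter> B \<subseteq> {0}"
    if "bilinear_form Q'" "pos_on Q' A" "pos_on Q' B" "\<And>x y. x \<in> A \<Longrightarrow> y \<in> B \<Longrightarrow> Q' x y = 0 \<and> Q' y x = 0"
    for Q' :: "'v \<Rightarrow> 'v \<Rightarrow> real" and A B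
  proof
    interpret b: bilinear_form Q' by fact
    show "pos_on Q' {x + y |x y. x \<in> A \<and> y \<in> B}" unfolding pos_on_def
    proof (intro ballI impI)
      fix z assume "z \<in> {x + y |x y. x \<in> A \<and> y \<in> B}" "z \<noteq> 0"
      then obtain x y where xy: "x \<in> A" "y \<in> B" "z = x + y" by blast
      have "Q' z z = Q' x x + Q' y y" using that(4)[OF xy(1,2)] xy by (simp add: b.add_left b.add_right)
      moreover have "x \<noteq> 0 \<Longrightarrow> Q' x x > 0" "y \<noteq> 0 \<Longrightarrow> Q' y y > 0" using that xy by (auto simp: pos_on_def)
      moreover have "x = 0 \<Longrightarrow> Q' x x = 0" "y = 0 \<Longrightarrow> Q' y y = 0" by simp_all
      moreover have "x \<noteq> 0 \<or> y \<noteq> 0" using xy \<open>z \<noteq> 0\<close> by auto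
      ultimately show "0 < Q' z z" by (smt (verit))
    qed
    show "A \<inter> B \<subseteq> {0}" using that(2,4) unfolding pos_on_def by force
  qed
  have oP: "Q x y = 0 \<and> Q y x = 0" if "x \<in> P1" "y \<in> P2" for x y using ortho that 1 2 by blast
  have oM: "- Q x y = 0 \<and> - Q y x = 0" if "x \<in> M1" "y \<in> M2" for x y
    using ortho[of x y] that 1(4) 2(4) by auto
  let ?P = "{x + y |x y. x \<in> P1 \<and> y \<in> P2}" and ?M = "{x + y |x y. x \<in> M1 \<and> y \<in> M2}"
  note pP = pos[OF bilinear_form_axioms 1(5) 2(5) oP] and pM = pos[OF bilinear_form_uminus 1(6) 2(6) oM]
  show ?thesis unfolding inertia_def
  proof (rule exI[of _ ?P], rule exI[of _ ?M], intro conjI)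
    show "lsubspace ?P" "lsubspace ?M" using 1 2 by (auto intro: lsubspace_sum)
    show "?P \<subseteq> Y" "?M \<subseteq> Y" unfolding Y12 using 1 2 by blast+
    show "pos_on Q ?P" "pos_on (\<lambda>x y. - Q x y) ?M" using pP pM by blast+
    show "ldim ?P = p1 + p2"
      using dim_direct_sum[OF fd(1) 1(1) fd(2) 2(1)] pP 1 2 by auto
    show "ldim ?M = n1 + n2"
      using dim_direct_sum[OF fd(3) 1(2) fd(4) 2(2)] pM 1 2 by auto
    have o': "Q x z = 0 \<and> Q z x = 0" if "x \<in> P1 \<and> z \<in> M2 \<or> x \<in> P2 \<and> z \<in> M1" for x z
      using that ortho 1(3,4) 2(3,4) by blast
    show "\<forall>x\<in>?P. \<forall>y\<in>?M. Q x y = 0 \<and> Q y x = 0"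
    proof (intro ballI)
      fix x y assume "x \<in> ?P" "y \<in> ?M"
      then obtain a b c d where "a \<in> P1" "b \<in> P2" "c \<in> M1" "d \<in> M2" "x = a + b" "y = c + d" by blast
      then show "Q x y = 0 \<and> Q y x = 0"
        using 1(7)[of a c] 2(7)[of b d] o'[of a d] o'[of b c] by (simp add: add_left add_right)
    qed
    show "\<forall>y\<in>Y. \<exists>x\<in>?P. \<exists>z\<in>?M. \<exists>r\<in>radical_on Q Y. y = x + z + r"
    proof
      fix y assume "y \<in> Y"
      then obtain y1 y2 where y: "y1 \<in> Y1" "y2 \<in> Y2" "y = y1 + y2" unfolding Y12 by blast
      obtain x1 z1 r1 where a: "x1\<in>P1" "z1\<in>M1" "r1\<in>radical_on Q Y1" "y1 = x1 + z1 + r1"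
        using 1(8)[OF y(1)] by blast
      obtain x2 z2 r2 where b: "x2\<in>P2" "z2\<in>M2" "r2\<in>radical_on Q Y2" "y2 = x2 + z2 + r2"
        using 2(8)[OF y(2)] by blast
      have "r1 + r2 \<in> radical_on Q Y" unfolding radical_on_def
      proof (intro CollectI conjI ballI)
        show "r1 + r2 \<in> Y" using a b unfolding Y12 radical_on_def by blast
        fix w assume "w \<in> Y"
        then obtain w1 w2 where "w1 \<in> Y1" "w2 \<in> Y2" "w = w1 + w2" unfolding Y12 by blast
        then show "Q (r1 + r2) w = 0" "Q w (r1 + r2) = 0"
          using a(3) b(3) ortho unfolding radical_on_def by (auto simp: add_left add_right)
      qed
      moreover have "x1 + x2 \<in> ?P" "z1 + z2 \<in> ?M" "y = (x1 + x2) + (z1 + z2) + (r1 + r2)"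
        using a b y by (auto simp: algebra_simps)
      ultimately show "\<exists>x\<in>?P. \<exists>z\<in>?M. \<exists>r\<in>radical_on Q Y. y = x + z + r" by blast
    qed
  qed
qed

text \<open>A self-orthogonal isotropic subspace forces equality of the two indices: it projects
  isomorphically onto both definite parts.\<close>
lemma inertia_balanced:
  assumes Y: "finite_dim Y" "lsubspace Y" and sym: "\<And>x y. x \<in> Y \<Longrightarrow> y \<in> Y \<Longrightarrow> Q x y = Q y x"
    and in1: "inertia Q Y p n"
    and S: "lsubspace S" "S \<subseteq> Y" and iso: "\<And>x. x \<in> S \<Longrightarrow> Q x x = 0"
    and self: "\<And>y. y \<in> Y \<Longrightarrow> (\<And>x. x \<in> S \<Longrightarrow> Q x y = 0) \<Longrightarrow> y \<in> S"
  shows "p \<le> n"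
proof -
  obtain P M where PM: "lsubspace P" "lsubspace M" "P \<subseteq> Y" "M \<subseteq> Y"
     "pos_on Q P" "pos_on (\<lambda>x y. - Q x y) M" "\<And>x y. x \<in> P \<Longrightarrow> y \<in> M \<Longrightarrow> Q x y = 0 \<and> Q y x = 0"
     "\<And>y. y\<in>Y \<Longrightarrow> \<exists>x\<in>P. \<exists>z\<in>M. \<exists>r\<in>radical_on Q Y. y = x + z + r" "ldim P = p" "ldim M = n"
    using in1 unfolding inertia_def by blast
  note rad = subspace_radical[OF Y(2)]
  have fd: "finite_dim P" "finite_dim M" using Y PM finite_dim_subset by blast+
  have QP: "0 < Q x x" if "x \<in> P" "x \<noteq> 0" for x using PM that by (auto simp: pos_on_def)
  have QM: "Q x x < 0" if "x \<in> M" "x \<noteq> 0" for x using PM that by (auto simp: pos_on_def)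
  \<comment> \<open>The projection of \<open>S\<close> to \<open>P\<close> along \<open>M\<close>;
    it will turn out to be all of \<open>P\<close>.\<close>
  define SP where "SP = {x \<in> P. \<exists>z\<in>M. x + z \<in> S}"
  have subSP: "lsubspace SP" unfolding real_vector.subspace_def
  proof (intro conjI ballI allI)
    show "0 \<in> SP" unfolding SP_def
      using real_vector.subspace_0[OF PM(1)] real_vector.subspace_0[OF PM(2)] real_vector.subspace_0[OF S(1)]
      by (intro CollectI conjI bexI[of _ 0]) auto
    fix x y c assume "x \<in> SP"
    then obtain z where z: "x \<in> P" "z \<in> M" "x + z \<in> S" unfolding SP_def by blast
    have "c *\<^sub>R x + c *\<^sub>R z \<in> S"
      using real_vector.subspace_scale[OF S(1) z(3), of c] by (simp add: scaleR_add_right)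
    then show "c *\<^sub>R x \<in> SP" unfolding SP_def
      using real_vector.subspace_scale[OF PM(1) z(1), of c]
        real_vector.subspace_scale[OF PM(2) z(2), of c] by blast
    assume "y \<in> SP"
    then obtain z' where z': "y \<in> P" "z' \<in> M" "y + z' \<in> S" unfolding SP_def by blast
    have "(x + y) + (z + z') \<in> S"
      using real_vector.subspace_add[OF S(1) z(3) z'(3)] by (simp add: algebra_simps)
    then show "x + y \<in> SP" unfolding SP_def
      using real_vector.subspace_add[OF PM(1) z(1) z'(1)]
        real_vector.subspace_add[OF PM(2) z(2) z'(2)] by blast
  qed
  have "P \<subseteq> SP"
  proof
    \<comment> \<open>Split off the part \<open>v\<close> of \<open>x\<close> orthogonal to
      \<open>SP\<close>. It is orthogonal to all of \<open>S\<close>, hence lies in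
      \<open>S\<close>; being isotropic and in \<open>P\<close>, it vanishes.\<close>
    fix x assume x: "x \<in> P"
    have posSP: "pos_on Q SP" using PM(5) unfolding pos_on_def SP_def by blast
    have SPY: "SP \<subseteq> Y" unfolding SP_def using PM by blast
    obtain u v where u: "u \<in> SP" "v \<in> Y" "x = u + v" "\<And>w. w \<in> SP \<Longrightarrow> Q w v = 0"
      using pos_on_projection[OF Y sym subSP SPY posSP] x PM by blast
    have vP: "v \<in> P" using u x PM(1) unfolding SP_def
      by (metis (mono_tags) add_diff_cancel_left' mem_Collect_eq real_vector.subspace_diff)
    have "v \<in> S"
    proof (rule self[OF u(2)])
      fix s assume s: "s \<in> S"
      then obtain a b r where a: "a \<in> P" "b \<in> M" "r \<in> radical_on Q Y" "s = a + b + r"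
        using PM(8) S by blast
      \<comment> \<open>A radical vector is orthogonal to everything, so \<open>self\<close> puts it
        into \<open>S\<close>.\<close>
      have rS: "r \<in> S" using a(3) S by (intro self) (auto simp: radical_on_def)
      then have "a + b \<in> S" using real_vector.subspace_diff[OF S(1) s rS] a by simp
      then have "a \<in> SP" using a unfolding SP_def by blast
      then show "Q s v = 0" using a u(4) PM(7)[OF vP a(2)] \<open>v \<in> Y\<close> by (auto simp: add_left radical_on_def)
    qed
    then have "v = 0" using iso QP[OF vP] by force
    then show "x \<in> SP" using u by simp
  qed
  \<comment> \<open>\<open>S\<close> now relates every element of \<open>P\<close> to one of
    \<open>M\<close>; an element of \<open>P\<close> related to \<open>0\<close> lies in
    \<open>S\<close>, is isotropic and hence zero.\<close>
  then have "ldim P \<le> ldim M"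
  proof (intro dim_le_by_relation[where R = "\<lambda>x z. x + z \<in> S"] fd PM(1,2))
    show "\<exists>z\<in>M. x + z \<in> S" if "x \<in> P" for x using \<open>P \<subseteq> SP\<close> that unfolding SP_def by blast
    show "x + x' + (z + z') \<in> S" if "x + z \<in> S" "x' + z' \<in> S" for x z x' z'
      using real_vector.subspace_add[OF S(1) that] by (simp add: algebra_simps)
    show "r *\<^sub>R x + r *\<^sub>R z \<in> S" if "x + z \<in> S" for r x z
      using real_vector.subspace_scale[OF S(1) that, of r] by (simp add: scaleR_add_right)
    show "x = 0" if "x \<in> P" "x + 0 \<in> S" for x using that iso QP by force
  qed
  then show ?thesis using PM by simp
qed

text \<open>On the orthogonal complement of the definite parts of \<open>N\<close>, the orthogonal complement of \<open>N\<close>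
  becomes a self-orthogonal isotropic subspace.\<close>
theorem inertia_coisotropic:
  assumes Y: "finite_dim Y" "lsubspace Y" and sym: "\<And>x y. x \<in> Y \<Longrightarrow> y \<in> Y \<Longrightarrow> Q x y = Q y x"
    and N: "lsubspace N" "N \<subseteq> Y"
    and iso: "\<And>y. y \<in> Y \<Longrightarrow> (\<And>x. x \<in> N \<Longrightarrow> Q x y = 0) \<Longrightarrow> Q y y = 0"
    and inY: "inertia Q Y p n" and inN: "inertia Q N p' n'"
  shows "int p - int n = int p' - int n'"
proof -
  interpret neg: bilinear_form "\<lambda>x y. - Q x y" by (rule bilinear_form_uminus)
  obtain P M where PM: "lsubspace P" "lsubspace M" "P \<subseteq> N" "M \<subseteq> N"
     "pos_on Q P" "pos_on (\<lambda>x y. - Q x y) M" "\<And>x y. x \<in> P \<Longrightarrow> y \<in> M \<Longrightarrow> Q x y = 0 \<and> Q y x = 0"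
     "\<And>y. y\<in>N \<Longrightarrow> \<exists>x\<in>P. \<exists>z\<in>M. \<exists>r\<in>radical_on Q N. y = x + z + r" "ldim P = p'" "ldim M = n'"
    using inN unfolding inertia_def by blast
  \<comment> \<open>The nondegenerate part of \<open>N\<close>. It splits off from \<open>Y\<close>
    with the inertia of \<open>N\<close> and leaves \<open>Y'\<close>, which has to be
    balanced.\<close>
  define D where "D = {x + y |x y. x \<in> P \<and> y \<in> M}"
  have D: "lsubspace D" "D \<subseteq> N" "D \<subseteq> Y"
    unfolding D_def using lsubspace_sum[OF PM(1,2)] PM N real_vector.subspace_add by blast+
  have inD: "inertia Q D p' n'" unfolding inertia_def
  proof (rule exI[of _ P], rule exI[of _ M], intro conjI ballI PM(1,2,5,6,9,10))
    show "P \<subseteq> D" "M \<subseteq> D" unfolding D_def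
      using real_vector.subspace_0[OF PM(1)] real_vector.subspace_0[OF PM(2)]
      by (auto, metis add.right_neutral, metis add.left_neutral)
    fix y assume "y \<in> D"
    moreover have "0 \<in> radical_on Q D" using D by (auto simp: radical_on_def real_vector.subspace_0)
    ultimately show "\<exists>x\<in>P. \<exists>z\<in>M. \<exists>r\<in>radical_on Q D. y = x + z + r" unfolding D_def by force
  qed (use PM(7) in auto)
  define Y' where "Y' = {y \<in> Y. \<forall>u\<in>D. Q u y = 0}"
  have Y': "lsubspace Y'" "Y' \<subseteq> Y" unfolding Y'_def using subspace_orthogonal[OF Y(2)] by auto
  have fY': "finite_dim Y'" using Y Y' finite_dim_subset by blast
  have sym': "Q x y = Q y x" if "x \<in> Y'" "y \<in> Y'" for x y using sym that Y' by blast
  obtain p1 n1 where in': "inertia Q Y' p1 n1" using inertia_exists[OF fY' Y'(1) sym'] by blast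
  have "Y = {x + y |x y. x \<in> D \<and> y \<in> Y'}"
  proof (intro subset_antisym subsetI)
    fix y assume "y \<in> {x + y |x y. x \<in> D \<and> y \<in> Y'}"
    then show "y \<in> Y" using D Y' Y real_vector.subspace_add by blast
  next
    fix y assume y: "y \<in> Y"
    have PY: "P \<subseteq> Y" "M \<subseteq> Y" using PM N by blast+
    obtain a z where a: "a \<in> P" "z \<in> Y" "y = a + z" "\<And>u. u \<in> P \<Longrightarrow> Q u z = 0"
      using pos_on_projection[OF Y sym PM(1) PY(1) PM(5) y] by metis
    have nsym: "- Q x y = - Q y x" if "x \<in> Y" "y \<in> Y" for x y using sym that by metis
    obtain b w where b: "b \<in> M" "w \<in> Y" "z = b + w" "\<And>u. u \<in> M \<Longrightarrow> - Q u w = 0"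
      using neg.pos_on_projection[OF Y nsym PM(2) PY(2) PM(6) a(2)] by metis
    have "Q u w = 0" if "u \<in> P" for u
      using a(4)[OF that] PM(7)[OF that b(1)] unfolding b(3) by (simp add: add_right)
    then have "w \<in> Y'" unfolding Y'_def D_def using b by (auto simp: add_left)
    moreover have "a + b \<in> D" unfolding D_def using a b by blast
    ultimately show "y \<in> {x + y |x y. x \<in> D \<and> y \<in> Y'}" using a b by (metis (mono_tags, lifting) add.assoc mem_Collect_eq)
  qed
  moreover have "Q x y = 0 \<and> Q y x = 0" if "x \<in> D" "y \<in> Y'" for x y
    using that sym D unfolding Y'_def by (metis (mono_tags, lifting) mem_Collect_eq subsetD)
  ultimately have "inertia Q Y (p' + p1) (n' + n1)"
    using inertia_orthogonal_sum[OF Y(1) _ D(1) Y'(1) _ inD in'] by blast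
  then have pn: "p = p' + p1" "n = n' + n1" using inertia_unique[OF Y inY] by blast+
  define S where "S = {y \<in> Y. \<forall>x\<in>N. Q x y = 0}"
  have S: "lsubspace S" "S \<subseteq> Y'" unfolding S_def Y'_def using subspace_orthogonal[OF Y(2)] D by auto
  have isoS: "Q x x = 0" if "x \<in> S" for x using iso that unfolding S_def by blast
  have self: "y \<in> S" if y: "y \<in> Y'" "\<And>x. x \<in> S \<Longrightarrow> Q x y = 0" for y
  proof -
    have "Q x y = 0" if "x \<in> N" for x
    proof -
      obtain a b r where a: "a \<in> P" "b \<in> M" "r \<in> radical_on Q N" "x = a + b + r"
        using PM(8) \<open>x \<in> N\<close> by blast
      have "a + b \<in> D" using a unfolding D_def by blast
      then have "Q (a + b) y = 0" using y unfolding Y'_def by blast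
      moreover have "r \<in> S" using a N unfolding S_def radical_on_def by auto
      ultimately show ?thesis using y a by (simp add: add_left)
    qed
    then show ?thesis using y Y' unfolding S_def by blast
  qed
  \<comment> \<open>\<open>S\<close> is self-orthogonal in \<open>Y'\<close>, for \<open>Q\<close>
    as well as for its negative; each of the two gives one inequality.\<close>
  have "p1 \<le> n1"
    by (rule inertia_balanced[OF fY' Y'(1) sym' in' S isoS]) (use self in blast)+
  moreover have "n1 \<le> p1"
    by (rule neg.inertia_balanced[OF fY' Y'(1) _ inertia_uminus[OF in'] S])
       (use self sym' isoS in \<open>auto\<close>)
  ultimately show ?thesis using pn by simp
qed

end

section \<open>Signatures of possibly degenerate forms\<close>

definition signature_on :: "('v::real_vector \<Rightarrow> 'v \<Rightarrow> real) \<Rightarrow> 'v set \<Rightarrow> int" where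
  "signature_on Q Y = (THE s. \<exists>p n. inertia Q Y p n \<and> s = int p - int n)"

context bilinear_form
begin

lemma signature_eq:
  assumes "finite_dim Y" "lsubspace Y" "inertia Q Y p n"
  shows "signature_on Q Y = int p - int n"
  unfolding signature_on_def using assms inertia_unique[OF assms(1,2)] by (intro the_equality) blast+

text \<open>What makes unrelated subspaces comparable: two coisotropic subspaces of the same
  \<open>Y\<close> have equal signature although no map between them is given.\<close>

lemma signature_coisotropic:
  assumes Y: "finite_dim Y" "lsubspace Y" and sym: "\<And>x y. x \<in> Y \<Longrightarrow> y \<in> Y \<Longrightarrow> Q x y = Q y x"
    and N: "lsubspace N" "N \<subseteq> Y"
    and iso: "\<And>y. y \<in> Y \<Longrightarrow> (\<And>x. x \<in> N \<Longrightarrow> Q x y = 0) \<Longrightarrow> Q y y = 0"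
  shows "signature_on Q N = signature_on Q Y"
proof -
  have fN: "finite_dim N" using N Y finite_dim_subset by blast
  have sN: "Q x y = Q y x" if "x \<in> N" "y \<in> N" for x y using that N sym by blast
  obtain p n where 1: "inertia Q Y p n" using inertia_exists[OF Y sym] by blast
  obtain p' n' where 2: "inertia Q N p' n'" using inertia_exists[OF fN N(1) sN] by blast
  have "int p - int n = int p' - int n'"
    by (rule inertia_coisotropic[OF Y sym N iso 1 2])
  then show ?thesis unfolding signature_eq[OF Y 1] signature_eq[OF fN N(1) 2] by simp
qed

lemma signature_uminus:
  assumes Y: "finite_dim Y" "lsubspace Y" and sym: "\<And>x y. x \<in> Y \<Longrightarrow> y \<in> Y \<Longrightarrow> Q x y = Q y x"
  shows "signature_on (\<lambda>x y. - Q x y) Y = - signature_on Q Y"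
proof -
  obtain p n where 1: "inertia Q Y p n" using inertia_exists[OF Y sym] by blast
  show ?thesis
    using signature_eq[OF Y 1] bilinear_form.signature_eq[OF bilinear_form_uminus Y inertia_uminus[OF 1]]
    by simp
qed

lemma signature_orthogonal_sum:
  assumes Y: "finite_dim Y"  and sym: "\<And>x y. x \<in> Y \<Longrightarrow> y \<in> Y \<Longrightarrow> Q x y = Q y x"
    and Y12: "Y = {x + y |x y. x \<in> Y1 \<and> y \<in> Y2}" and sub: "lsubspace Y1" "lsubspace Y2"
    and ortho: "\<And>x y. x \<in> Y1 \<Longrightarrow> y \<in> Y2 \<Longrightarrow> Q x y = 0"
  shows "signature_on Q Y = signature_on Q Y1 + signature_on Q Y2"
proof -
  have Y12': "Y1 \<subseteq> Y" "Y2 \<subseteq> Y"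
    unfolding Y12 using real_vector.subspace_0[OF sub(1)] real_vector.subspace_0[OF sub(2)]
    by (auto, metis add.right_neutral, metis add.left_neutral)
  have f: "finite_dim Y1" "finite_dim Y2" using Y12' Y finite_dim_subset by blast+
  have s: "Q x y = Q y x" if "x \<in> Y1 \<and> y \<in> Y1 \<or> x \<in> Y2 \<and> y \<in> Y2" for x y
    using that sym Y12' by blast
  obtain p n where 1: "inertia Q Y1 p n" using inertia_exists[OF f(1) sub(1)] s by blast
  obtain p' n' where 2: "inertia Q Y2 p' n'" using inertia_exists[OF f(2) sub(2)] s by blast
  have o: "Q x y = 0 \<and> Q y x = 0" if "x \<in> Y1" "y \<in> Y2" for x y
    using ortho[OF that] sym[of x y] that Y12' by auto
  have "lsubspace Y" unfolding Y12 using sub by (rule lsubspace_sum)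
  then show ?thesis
    using signature_eq[OF Y _ inertia_orthogonal_sum[OF Y Y12 sub o 1 2]]
     signature_eq[OF f(1) sub(1) 1] signature_eq[OF f(2) sub(2) 2] by simp
qed

lemma signature_zero:
  assumes "finite_dim Y" "lsubspace Y" "\<And>x y. x \<in> Y \<Longrightarrow> y \<in> Y \<Longrightarrow> Q x y = 0"
  shows "signature_on Q Y = 0"
proof -
  have 0: "0 \<in> Y" using assms real_vector.subspace_0 by blast
  have "inertia Q Y 0 0" unfolding inertia_def
    by (rule exI[of _ "{0}"], rule exI[of _ "{0}"])
       (use assms 0 in \<open>auto simp: pos_on_def radical_on_def ldim_zero real_vector.subspace_single_0\<close>)
  then show ?thesis using signature_eq[OF assms(1,2)] by fastforce
qed

lemma signature_pos:
  assumes "finite_dim Y" "lsubspace Y" "pos_on Q Y"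
  shows "signature_on Q Y = ldim Y"
proof -
  have 0: "0 \<in> Y" using assms real_vector.subspace_0 by blast
  have "0 \<in> radical_on Q Y" using 0 by (simp add: radical_on_def)
  then have *: "\<exists>x\<in>Y. \<exists>z\<in>{0}. \<exists>r\<in>radical_on Q Y. y = x + z + r" if "y \<in> Y" for y
    using that by force
  have "inertia Q Y (ldim Y) 0" unfolding inertia_def
    by (rule exI[of _ Y], rule exI[of _ "{0}"])
       (use assms 0 * in \<open>auto simp: pos_on_def ldim_zero real_vector.subspace_single_0\<close>)
  then show ?thesis using signature_eq[OF assms(1,2)] by fastforce
qed

text \<open>A definite subspace meets the kernel of \<open>f\<close> trivially, so both indices are
  at most the dimension of \<open>Z\<close>.\<close>

lemma signature_abs_le:
  assumes Y: "finite_dim Y" "lsubspace Y" and sym: "\<And>x y. x \<in> Y \<Longrightarrow> y \<in> Y \<Longrightarrow> Q x y = Q y x"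
    and f: "linear f" "f ` Y \<subseteq> Z" "finite_dim Z" "lsubspace Z"
    and ker: "\<And>x. x \<in> Y \<Longrightarrow> f x = 0 \<Longrightarrow> Q x x = 0"
  shows "\<bar>signature_on Q Y\<bar> \<le> int (ldim Z)"
proof -
  obtain p n where pn: "inertia Q Y p n" using inertia_exists[OF Y sym] by blast
  then obtain P M where PM: "lsubspace P" "lsubspace M" "P \<subseteq> Y" "M \<subseteq> Y"
     "pos_on Q P" "pos_on (\<lambda>x y. - Q x y) M" "ldim P = p" "ldim M = n"
    unfolding inertia_def by blast
  interpret f: linear f by fact
  have "ldim W \<le> ldim Z" if "lsubspace W" "W \<subseteq> Y" "\<And>x. x \<in> W \<Longrightarrow> Q x x = 0 \<Longrightarrow> x = 0" for W
  proof (rule dim_le_by_relation[where R = "\<lambda>x z. z = f x", OF _ that(1) f(3,4)])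
    show "finite_dim W" using that Y finite_dim_subset by blast
  qed (use f that ker in \<open>auto simp: f.add f.scaleR\<close>)
  then have "p \<le> ldim Z" "n \<le> ldim Z" using PM unfolding pos_on_def by (metis less_irrefl, metis less_irrefl neg_equal_0_iff_equal)
  then show ?thesis using signature_eq[OF Y pn] by linarith
qed

end

lemma linear_image_subspace: "linear f \<Longrightarrow> lsubspace X \<Longrightarrow> lsubspace (f ` X)"
  using linear_subspace_image by blast

lemma finite_dim_linear_image:
  assumes "linear f" "finite_dim X"
  shows "finite_dim (f ` X)"
proof -
  obtain B where "finite B" "X \<subseteq> lspan B" using assms by (auto simp: finite_dim_def)
  then have "f ` X \<subseteq> lspan (f ` B)" using linear_span_image[OF assms(1)] by blast
  then show ?thesis using \<open>finite B\<close> unfolding finite_dim_def by blast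
qed

lemma ldim_linear_image:
  assumes f: "linear f" and X: "finite_dim X" "lsubspace X" and inj: "\<And>x. x \<in> X \<Longrightarrow> f x = 0 \<Longrightarrow> x = 0"
  shows "ldim (f ` X) = ldim X"
proof (rule antisym)
  interpret f: linear f by fact
  note fX = finite_dim_linear_image[OF f X(1)] linear_image_subspace[OF f X(2)]
  show "ldim (f ` X) \<le> ldim X"
    by (rule dim_le_by_relation[where R = "\<lambda>z x. z = f x", OF fX X])
       (auto simp: f.add f.scaleR f.zero)
  show "ldim X \<le> ldim (f ` X)"
    by (rule dim_le_by_relation[where R = "\<lambda>x z. z = f x", OF X fX])
       (use inj in \<open>auto simp: f.add f.scaleR\<close>)
qed

lemma inertia_image:
  assumes f: "linear f" and X: "finite_dim X" "lsubspace X" and inj: "\<And>x. x \<in> X \<Longrightarrow> f x = 0 \<Longrightarrow> x = 0"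
    and Q: "\<And>x y. x \<in> X \<Longrightarrow> y \<in> X \<Longrightarrow> Q' (f x) (f y) = Q x y" and inX: "inertia Q X p n"
  shows "inertia Q' (f ` X) p n"
proof -
  interpret f: linear f by fact
  obtain P M where PM: "lsubspace P" "lsubspace M" "P \<subseteq> X" "M \<subseteq> X"
     "pos_on Q P" "pos_on (\<lambda>x y. - Q x y) M" "\<And>x y. x \<in> P \<Longrightarrow> y \<in> M \<Longrightarrow> Q x y = 0 \<and> Q y x = 0"
     "\<And>y. y\<in>X \<Longrightarrow> \<exists>x\<in>P. \<exists>z\<in>M. \<exists>r\<in>radical_on Q X. y = x + z + r" "ldim P = p" "ldim M = n"
    using inX unfolding inertia_def by blast
  have d: "ldim (f ` W) = ldim W" if "lsubspace W" "W \<subseteq> X" for W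
    using that X finite_dim_subset inj by (intro ldim_linear_image f) blast+
  have rad: "f r \<in> radical_on Q' (f ` X)" if "r \<in> radical_on Q X" for r
    using that Q by (auto simp: radical_on_def)
  have pos: "pos_on Q' (f ` W)" if "pos_on Q W" "W \<subseteq> X" "\<And>x y. x \<in> X \<Longrightarrow> y \<in> X \<Longrightarrow> Q' (f x) (f y) = Q x y"
    for Q Q' W using that f.zero unfolding pos_on_def by (auto simp: subset_iff)
  show ?thesis unfolding inertia_def
  proof (rule exI[of _ "f ` P"], rule exI[of _ "f ` M"], intro conjI)
    show "\<forall>y\<in>f ` X. \<exists>x\<in>f ` P. \<exists>z\<in>f ` M. \<exists>r\<in>radical_on Q' (f ` X). y = x + z + r"
    proof
      fix y assume "y \<in> f ` X"
      then obtain x where x: "x \<in> X" "y = f x" by blast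
      obtain a b r where "a \<in> P" "b \<in> M" "r \<in> radical_on Q X" "x = a + b + r" using PM(8)[OF x(1)] by blast
      then show "\<exists>x\<in>f ` P. \<exists>z\<in>f ` M. \<exists>r\<in>radical_on Q' (f ` X). y = x + z + r"
        using rad x by (auto simp: f.add)
    qed
    show "\<forall>x\<in>f ` P. \<forall>y\<in>f ` M. Q' x y = 0 \<and> Q' y x = 0"
    proof (intro ballI)
      fix x y assume "x \<in> f ` P" "y \<in> f ` M"
      then obtain a b where ab: "a \<in> P" "b \<in> M" "x = f a" "y = f b" by blast
      then have "a \<in> X" "b \<in> X" using PM(3,4) by auto
      then show "Q' x y = 0 \<and> Q' y x = 0" using PM(7)[OF ab(1,2)] Q ab by simp
    qed
    show "pos_on Q' (f ` P)" using pos[OF PM(5,3)] Q by blast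
    show "pos_on (\<lambda>x y. - Q' x y) (f ` M)" using pos[OF PM(6,4), of "\<lambda>x y. - Q' x y"] Q by simp
    show "lsubspace (f ` P)" "lsubspace (f ` M)" using PM linear_image_subspace[OF f] by blast+
    show "ldim (f ` P) = p" "ldim (f ` M) = n" using d PM by auto
    show "f ` P \<subseteq> f ` X" "f ` M \<subseteq> f ` X" using PM by auto
  qed
qed

lemma signature_image:
  assumes f: "linear f" and X: "finite_dim X" "lsubspace X" and inj: "\<And>x. x \<in> X \<Longrightarrow> f x = 0 \<Longrightarrow> x = 0"
    and Q: "\<And>x y. x \<in> X \<Longrightarrow> y \<in> X \<Longrightarrow> Q' (f x) (f y) = Q x y"
    and b: "bilinear_form Q" "bilinear_form Q'" and sym: "\<And>x y. x \<in> X \<Longrightarrow> y \<in> X \<Longrightarrow> Q x y = Q y x"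
  shows "signature_on Q' (f ` X) = signature_on Q X"
proof -
  obtain p n where 1: "inertia Q X p n" using bilinear_form.inertia_exists[OF b(1) X sym] by blast
  show ?thesis using bilinear_form.signature_eq[OF b(1) X 1]
    bilinear_form.signature_eq[OF b(2) finite_dim_linear_image[OF f X(1)] linear_image_subspace[OF f X(2)]
      inertia_image[OF f X inj Q 1]] by simp
qed

lemma finite_dim_functions:
  fixes V :: "'v::real_vector set"
  assumes "finite I" "finite_dim V" "\<And>y i. y \<in> Y \<Longrightarrow> i \<in> I \<Longrightarrow> y i \<in> V" "\<And>y i. y \<in> Y \<Longrightarrow> i \<notin> I \<Longrightarrow> y i = 0"
  shows "finite_dim (Y :: ('i \<Rightarrow> 'v) set)"
proof -
  obtain B where B: "finite B" "V \<subseteq> lspan B" using assms by (auto simp: finite_dim_def)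
  define single where "single = (\<lambda>(i::'i) v j. if j = i then v else (0::'v))"
  have lin: "linear (single i)" for i :: 'i
    by (rule linearI) (auto simp: single_def fun_eq_iff)
  let ?C = "\<Union>i\<in>I. single i ` B"
  have "y \<in> lspan ?C" if y: "y \<in> Y" for y
  proof -
    have "single i (y i) \<in> lspan ?C" if "i \<in> I" for i
    proof -
      have "single i (y i) \<in> single i ` lspan B" using B assms(3)[OF y that] by blast
      also have "\<dots> = lspan (single i ` B)" using linear_span_image[OF lin] by metis
      also have "\<dots> \<subseteq> lspan ?C" using that by (intro real_vector.span_mono) blast
      finally show ?thesis .
    qed
    then have "(\<Sum>i\<in>I. single i (y i)) \<in> lspan ?C" by (intro real_vector.span_sum)
    moreover have "(\<Sum>i\<in>I. single i (y i)) = y"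
      using assms(1) assms(4)[OF y] by (auto simp: fun_eq_iff sum_fun_apply single_def)
    ultimately show ?thesis by simp
  qed
  moreover have "finite ?C" using assms B by blast
  ultimately show ?thesis unfolding finite_dim_def by blast
qed

section \<open>Sums over the sides of a surface\<close>

lemma surface_finite:
  assumes "closed_oriented_surface K"
  shows "finite (triangles K)" "finite (edges K)" "finite (vertices K)"
  using assms by (auto simp: closed_oriented_surface_def delta_complex_def)

lemma sum_sides:
  fixes H :: "nat \<times> nat \<Rightarrow> real"
  assumes K: "closed_oriented_surface K"
  shows "(\<Sum>t\<in>triangles K. \<Sum>i<3. H (t, i)) = (\<Sum>e\<in>edges K. \<Sum>s\<in>sides K e. H s)"
proof -
  have fin: "finite (triangles K)" "finite (edges K)" using surface_finite[OF K] by auto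
  have "(\<Sum>t\<in>triangles K. \<Sum>i<3. H (t, i)) = (\<Sum>s\<in>triangles K \<times> {..<3}. H s)"
    by (simp add: sum.cartesian_product)
  also have "\<dots> = (\<Sum>e\<in>edges K. \<Sum>s\<in>{s \<in> triangles K \<times> {..<3}. (\<lambda>(t, i). face K i t) s = e}. H s)"
    using fin K
    by (intro sum.group[symmetric]) (auto simp: closed_oriented_surface_def delta_complex_def)
  also have "\<dots> = (\<Sum>e\<in>edges K. \<Sum>s\<in>sides K e. H s)"
    by (intro sum.cong refl arg_cong2[where f = sum]) (auto simp: sides_def)
  finally show ?thesis .
qed

text \<open>Stokes for a closed surface: regrouped by edges, the signs of the two sides of each edge
  cancel.\<close>

lemma sum_sides_signed:
  fixes H :: "nat \<Rightarrow> real"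
  assumes K: "closed_oriented_surface K"
  shows "(\<Sum>t\<in>triangles K. of_int (orient K t) * (H (face K 2 t) - H (face K 1 t) + H (face K 0 t))) = 0"
proof -
  let ?H = "\<lambda>(t, i). (-1) ^ i * of_int (orient K t) * H (face K i t)"
  have "(\<Sum>t\<in>triangles K. of_int (orient K t) * (H (face K 2 t) - H (face K 1 t) + H (face K 0 t)))
     = (\<Sum>t\<in>triangles K. \<Sum>i<3. ?H (t, i))"
    by (intro sum.cong refl) (simp add: numeral_3_eq_3 numeral_2_eq_2 algebra_simps)
  also have "\<dots> = (\<Sum>e\<in>edges K. \<Sum>s\<in>sides K e. ?H s)" by (rule sum_sides[OF K])
  also have "\<dots> = (\<Sum>e\<in>edges K. of_int (\<Sum>(t, i)\<in>sides K e. (-1) ^ i * orient K t) * H e)"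
    by (intro sum.cong refl) (auto simp: sum_distrib_right sides_def intro!: sum.cong)
  also have "\<dots> = 0" using K by (simp add: closed_oriented_surface_def)
  finally show ?thesis .
qed

lemma two_sides:
  assumes K: "closed_oriented_surface K" and e: "e \<in> edges K"
  obtains t i t' i' where "sides K e = {(t, i), (t', i')}" "(t, i) \<noteq> (t', i')"
    "(-1) ^ i' * orient K t' = - ((-1) ^ i * orient K t)"
proof -
  have z: "card (sides K e) = 2" "(\<Sum>(t, i)\<in>sides K e. (-1) ^ i * orient K t) = 0"
    using assms unfolding closed_oriented_surface_def by auto
  from z(1) obtain s s' where s: "sides K e = {s, s'}" "s \<noteq> s'" by (meson card_2_iff)
  obtain t i t' i' where st: "s = (t, i)" "s' = (t', i')" by (cases s; cases s') blast
  show ?thesis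
    by (rule that[of t i t' i']) (use s st z(2) in auto)
qed

section \<open>Lagrangians and the Maslov index of a symplectic representation\<close>

locale symplectic_rep = group G for G :: "('g, 'm) monoid_scheme" (structure) +
  fixes act :: "'g \<Rightarrow> 'v::real_vector \<Rightarrow> 'v" and V L :: "'v set"
    and \<omega> :: "'v \<Rightarrow> 'v \<Rightarrow> real" and J :: "'v \<Rightarrow> 'v"
  assumes act_linear: "linear (act g)"
    and act_mult: "g \<in> carrier G \<Longrightarrow> k \<in> carrier G \<Longrightarrow> act (g \<otimes> k) x = act g (act k x)"
    and act_one: "x \<in> V \<Longrightarrow> act \<one> x = x"
    and act_V: "x \<in> V \<Longrightarrow> act g x \<in> V"
    and \<omega>: "bilinear_form \<omega>"
    and \<omega>_self: "\<omega> x x = 0"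
    and \<omega>_act: "g \<in> carrier G \<Longrightarrow> \<omega> (act g x) (act g y) = \<omega> x y"
    and V: "finite_dim V" "lsubspace V"
    and L: "lsubspace L" "L \<subseteq> V"
    and L_isotropic: "x \<in> L \<Longrightarrow> y \<in> L \<Longrightarrow> \<omega> x y = 0"
    and L_maximal: "x \<in> V \<Longrightarrow> (\<And>y. y \<in> L \<Longrightarrow> \<omega> x y = 0) \<Longrightarrow> x \<in> L"
    and J_linear: "linear J"
    and J_V: "x \<in> V \<Longrightarrow> J x \<in> V"
    and J_sym: "\<omega> (J x) y = \<omega> (J y) x"
    and J_pos: "x \<in> V \<Longrightarrow> x \<noteq> 0 \<Longrightarrow> 0 < \<omega> (J x) x"
begin

sublocale \<omega>: bilinear_form \<omega> by (rule \<omega>)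

lemmas act_add = linear_add[OF act_linear] and act_scale = linear_scale[OF act_linear]
  and act_diff = linear_diff[OF act_linear] and act_zero [simp] = linear_0[OF act_linear]
  and act_neg = linear_neg[OF act_linear]

lemma \<omega>_swap: "\<omega> y x = - \<omega> x y"
proof -
  have "\<omega> (x + y) (x + y) = \<omega> x x + \<omega> y x + (\<omega> x y + \<omega> y y)"
    by (simp only: \<omega>.add_left \<omega>.add_right)
  then show ?thesis using \<omega>_self[of "x + y"] \<omega>_self[of x] \<omega>_self[of y] by simp
qed

lemma L_V: "x \<in> L \<Longrightarrow> x \<in> V" using L by blast

lemma L_finite: "finite_dim L" using V L finite_dim_subset by blast

lemmas L_closed = real_vector.subspace_0[OF L(1)] real_vector.subspace_add[OF L(1)]
  real_vector.subspace_diff[OF L(1)] real_vector.subspace_scale[OF L(1)] real_vector.subspace_neg[OF L(1)]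
lemmas V_closed = real_vector.subspace_0[OF V(2)] real_vector.subspace_add[OF V(2)]
  real_vector.subspace_diff[OF V(2)] real_vector.subspace_scale[OF V(2)] real_vector.subspace_neg[OF V(2)]

text \<open>The map \<open>J\<close> turns \<open>\<omega>\<close> into an inner product on
  \<open>V\<close>. Orthogonal projection for it replaces duality arguments about
  \<open>\<omega>\<close>.\<close>

sublocale ip: bilinear_form "\<lambda>x y. \<omega> (J x) y"
  by unfold_locales (simp_all add: \<omega>.add_left \<omega>.add_right \<omega>.scale_left \<omega>.scale_right
    linear_add[OF J_linear] linear_scale[OF J_linear])

text \<open>The fact behind this is that the \<open>\<omega>\<close>-complement of
  \<open>L \<inter> g L\<close> is \<open>L + g L\<close>. Project \<open>x\<close> orthogonally to
  \<open>L + g L\<close>, with residue \<open>r\<close>. Then \<open>J r\<close> is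
  \<open>\<omega>\<close>-orthogonal to \<open>L\<close> and to \<open>g L\<close>, hence lies in
  both by maximality; so the hypothesis applies to it and shows that \<open>r\<close> has norm
  zero.\<close>

lemma transverse_decomposition:
  assumes x: "x \<in> V" and g: "g \<in> carrier G"
    and ortho: "\<And>y. y \<in> L \<Longrightarrow> act g y \<in> L \<Longrightarrow> \<omega> x (act g y) = 0"
  obtains l l' where "l \<in> L" "l' \<in> L" "x = l + act g l'"
proof -
  define U where "U = {a + b |a b. a \<in> L \<and> b \<in> act g ` L}"
  have U: "finite_dim U" "lsubspace U" unfolding U_def
    by (intro finite_dim_sums finite_dim_linear_image linear_image_subspace lsubspace_sum act_linear L L_finite)+
  have UV: "U \<subseteq> V" unfolding U_def by (auto intro!: V_closed(2) intro: L_V act_V)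
  have aU: "w = 0" if "w \<in> U" "\<omega> (J w) w = 0" for w
    using J_pos[of w] that UV by auto
  have jU: "\<omega> (J a) b = \<omega> (J b) a" if "a \<in> U" "b \<in> U" for a b by (rule J_sym)
  obtain u where u: "u \<in> U" "\<And>w. w \<in> U \<Longrightarrow> \<omega> (J w) (x - u) = 0"
    using ip.orthogonal_projection[OF U aU jU, of x] by metis
  define r where "r = x - u"
  have rV: "r \<in> V" using x u UV V_closed by (auto simp: r_def)
  have JU: "\<omega> (J r) w = 0" if "w \<in> U" for w using u(2)[OF that] J_sym by (metis r_def)
  have LU: "L \<subseteq> U" "act g ` L \<subseteq> U" unfolding U_def using L_closed(1) act_zero
    by (force, metis (mono_tags, lifting) add.left_neutral mem_Collect_eq subsetI)
  have JL: "J r \<in> L" using L_maximal[OF J_V[OF rV]] JU LU by blast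
  define y where "y = act (inv g) (J r)"
  have gy: "act g y = J r" unfolding y_def
    using act_mult[OF g inv_closed[OF g], of "J r"] g act_one[OF J_V[OF rV]] by simp
  have "y \<in> L"
  proof (rule L_maximal)
    show "y \<in> V" unfolding y_def using J_V[OF rV] act_V by blast
    fix l assume "l \<in> L"
    then have "\<omega> (J r) (act g l) = 0" using JU LU by blast
    then show "\<omega> y l = 0" using \<omega>_act[OF g, of y l] gy by simp
  qed
  then have "\<omega> x (J r) = 0" using ortho[of y] gy JL by simp
  then have "\<omega> (J r) x = 0" using \<omega>_swap[of x "J r"] by simp
  then have "\<omega> (J r) r = 0" unfolding r_def[symmetric] using JU[OF u(1)]
    by (simp add: r_def \<omega>.diff_right)
  then have "r = 0" using J_pos[OF rV] by force
  then show ?thesis using u(1) that unfolding r_def U_def by auto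
qed

text \<open>Wall's description of the Maslov index by triples in \<open>L\<close>,
  \<open>g L\<close>, \<open>g k L\<close> whose alternating sum is zero, pulled back to
  \<open>L\<close>. The index of \<open>a\<close> is the number of a corner of the bar simplex
  \<open>[g|k]\<close>, which is how these triples will arise.\<close>

definition maslov_space :: "'g \<Rightarrow> 'g \<Rightarrow> (nat \<Rightarrow> 'v) set" where
  "maslov_space g k = {a. (\<forall>i<3. a i \<in> L) \<and> (\<forall>i\<ge>3. a i = 0) \<and>
    act g (a 1) = a 0 + act (g \<otimes> k) (a 2)}"

text \<open>The cup product of a truncated triangle on cochains that vanish on its edges and live on
  the three arcs; this fixes the sign.\<close>

definition maslov_form :: "'g \<Rightarrow> 'g \<Rightarrow> (nat \<Rightarrow> 'v) \<Rightarrow> (nat \<Rightarrow> 'v) \<Rightarrow> real" where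
  "maslov_form g k a b = - \<omega> (a 0) (act (g \<otimes> k) (b 2))"

definition maslov :: "'g \<Rightarrow> 'g \<Rightarrow> int" where
  "maslov g k = signature_on (maslov_form g k) (maslov_space g k)"

lemma maslov_form_bilinear: "bilinear_form (maslov_form g k)"
  by unfold_locales (simp_all add: maslov_form_def \<omega>.add_left \<omega>.add_right \<omega>.scale_left \<omega>.scale_right
      act_add act_scale)

lemma maslov_space_subspace: "lsubspace (maslov_space g k)"
  unfolding real_vector.subspace_def maslov_space_def
  by (auto simp: L_closed act_add act_scale algebra_simps)

lemma maslov_space_finite: "finite_dim (maslov_space g k)"
  by (rule finite_dim_functions[of "{..<3}" L]) (auto simp: maslov_space_def L_finite)

text \<open>\<open>L\<close>, \<open>g L\<close> and \<open>g k L\<close> are isotropic, so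
  expanding the zero pairing of \<open>g (a 1)\<close> with \<open>g (b 1)\<close> by the closing
  relation leaves exactly the two mixed terms.\<close>

lemma maslov_form_sym:
  assumes "g \<in> carrier G" "k \<in> carrier G" "a \<in> maslov_space g k" "b \<in> maslov_space g k"
  shows "maslov_form g k a b = maslov_form g k b a"
proof -
  let ?h = "act (g \<otimes> k)"
  have L: "a i \<in> L" "b i \<in> L" if "i < 3" for i using assms that by (auto simp: maslov_space_def)
  have a: "a 0 = act g (a 1) - ?h (a 2)" and b: "b 0 = act g (b 1) - ?h (b 2)"
    using assms by (auto simp: maslov_space_def)
  have gk: "g \<otimes> k \<in> carrier G" using assms by simp
  have z: "\<omega> (a 0) (b 0) = 0" "\<omega> (act g (a 1)) (act g (b 1)) = 0" "\<omega> (?h (a 2)) (?h (b 2)) = 0"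
    using L L_isotropic \<omega>_act[OF gk] \<omega>_act[OF assms(1)] by auto
  have "\<omega> (act g (a 1)) (act g (b 1)) = \<omega> (a 0 + ?h (a 2)) (b 0 + ?h (b 2))"
    using a b by simp
  then have "\<omega> (a 0) (?h (b 2)) = - \<omega> (?h (a 2)) (b 0)"
    using z by (simp add: \<omega>.add_left \<omega>.add_right)
  then show ?thesis unfolding maslov_form_def using \<omega>_swap[of "b 0" "?h (a 2)"] by simp
qed

text \<open>The form vanishes on triples with \<open>a 0 = 0\<close>, so the map to
  \<open>a 0\<close> bounds both indices.\<close>

lemma maslov_abs_le:
  assumes "g \<in> carrier G" "k \<in> carrier G"
  shows "\<bar>maslov g k\<bar> \<le> int (ldim L)"
  unfolding maslov_def
  by (rule bilinear_form.signature_abs_le[OF maslov_form_bilinear maslov_space_finite maslov_space_subspace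
        maslov_form_sym[OF assms], where f = "\<lambda>a. a 0"])
     (auto simp: maslov_form_def maslov_space_def L_finite L intro!: linearI)

text \<open>Each alternative makes two of the Lagrangians \<open>L\<close>, \<open>g L\<close>,
  \<open>g k L\<close> coincide, and then \<open>a 0\<close> and \<open>g k (b 2)\<close> lie in a
  common isotropic subspace.\<close>

lemma maslov_eq_zero:
  assumes g: "g \<in> carrier G" "k \<in> carrier G" and
    inv: "act g ` L \<subseteq> L \<or> act k ` L \<subseteq> L \<or> act (g \<otimes> k) ` L \<subseteq> L"
  shows "maslov g k = 0"
  unfolding maslov_def
proof (rule bilinear_form.signature_zero[OF maslov_form_bilinear maslov_space_finite maslov_space_subspace])
  fix a b assume ab: "a \<in> maslov_space g k" "b \<in> maslov_space g k"
  let ?h = "act (g \<otimes> k)"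
  have L: "a i \<in> L" "b i \<in> L" if "i < 3" for i using ab that by (auto simp: maslov_space_def)
  have a: "act g (a 1) = a 0 + ?h (a 2)" and b: "act g (b 1) = b 0 + ?h (b 2)"
    using ab by (auto simp: maslov_space_def)
  have gk: "g \<otimes> k \<in> carrier G" using assms by simp
  consider "act (g \<otimes> k) ` L \<subseteq> L" | "act k ` L \<subseteq> L" | "act g ` L \<subseteq> L" using inv by blast
  then have "\<omega> (a 0) (?h (b 2)) = 0"
  proof cases
    case 1 then show ?thesis using L L_isotropic by (simp add: image_subset_iff)
  next
    case 2
    have "?h (b 2) = act g (act k (b 2))" "?h (a 2) = act g (act k (a 2))" using act_mult g by blast+
    moreover have "act k (b 2) \<in> L" "act k (a 2) \<in> L" using 2 L by auto
    moreover have "a 0 = act g (a 1 - act k (a 2))" using a calculation by (simp add: act_diff)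
    ultimately show ?thesis using L L_isotropic \<omega>_act[OF g(1)] L_closed by simp
  next
    case 3
    have "?h (b 2) = act g (b 1) - b 0" using b by simp
    moreover have "act g (b 1) - b 0 \<in> L" using 3 L L_closed by (simp add: image_subset_iff)
    ultimately show ?thesis using L L_isotropic by simp
  qed
  then show "maslov_form g k a b = 0" by (simp add: maslov_form_def)
qed

end

section \<open>Corners of triangles and links of vertices\<close>

declare One_nat_def [simp del]

text \<open>Corner \<open>i\<close> of a triangle joins the edge end \<open>corner_lo\<close> to the edge end \<open>corner_hi\<close>; the
  corner at the end \<open>b\<close> of \<open>face i t\<close> is number \<open>corner_at i b\<close>.\<close>

definition corner_lo :: "surface \<Rightarrow> nat \<Rightarrow> nat \<Rightarrow> nat \<times> bool" where
  "corner_lo K t i = (if i = 0 then (face K 2 t, False) else if i = 1 then (face K 2 t, True)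
    else (face K 1 t, True))"

definition corner_hi :: "surface \<Rightarrow> nat \<Rightarrow> nat \<Rightarrow> nat \<times> bool" where
  "corner_hi K t i = (if i = 0 then (face K 1 t, False) else if i = 1 then (face K 0 t, False)
    else (face K 0 t, True))"

definition corner_at :: "nat \<Rightarrow> bool \<Rightarrow> nat" where
  "corner_at i b = (if b then (if i = 2 then 1 else 2) else (if i = 0 then 1 else 0))"

lemma corner_at_less: "corner_at i b < 3"
  by (simp add: corner_at_def)

lemma less_3_cases: "(i::nat) < 3 \<Longrightarrow> (i = 0 \<Longrightarrow> P) \<Longrightarrow> (i = 1 \<Longrightarrow> P) \<Longrightarrow> (i = 2 \<Longrightarrow> P) \<Longrightarrow> P"
  by linarith

lemma sum_less_3: "(\<Sum>i<(3::nat). H i) = H 0 + H 1 + H 2"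
  by (simp add: numeral_3_eq_3 numeral_2_eq_2 One_nat_def)

lemma surface_ends:
  assumes "closed_oriented_surface K" "t \<in> triangles K"
  shows "edge_end K (corner_lo K t i) = edge_end K (corner_hi K t i)"
    "i < 3 \<Longrightarrow> face K i t \<in> edges K"
    "source K (face K 2 t) = source K (face K 1 t)"
    "target K (face K 2 t) = source K (face K 0 t)"
    "target K (face K 1 t) = target K (face K 0 t)"
    "(orient K t)\<^sup>2 = 1"
  using assms
  by (auto simp: closed_oriented_surface_def delta_complex_def edge_end_def corner_lo_def corner_hi_def)

text \<open>A label on corners that agrees across every edge, at both of its ends, passes to edge
  ends and is then constant along links; connected links make it a function of the vertex. The
  second conclusion supplies a corner for each vertex, so that \<open>\<sigma>\<close> inherits
  membership in a subspace.\<close>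

lemma corner_function_by_vertex:
  assumes K: "closed_oriented_surface K"
    and agree: "\<And>e s s' b. e \<in> edges K \<Longrightarrow> s \<in> sides K e \<Longrightarrow> s' \<in> sides K e \<Longrightarrow>
      \<rho> (fst s, corner_at (snd s) b) = \<rho> (fst s', corner_at (snd s') b)"
  obtains \<sigma> where "\<And>t i. t \<in> triangles K \<Longrightarrow> i < 3 \<Longrightarrow> \<rho> (t, i) = \<sigma> (edge_end K (corner_lo K t i))"
    "\<And>v. v \<in> edge_end K ` (edges K \<times> UNIV) \<Longrightarrow> \<exists>t i. t \<in> triangles K \<and> i < 3 \<and> \<sigma> v = \<rho> (t, i)"
proof -
  define \<rho>' where "\<rho>' = (\<lambda>(e, b). let s = SOME s. s \<in> sides K e in \<rho> (fst s, corner_at (snd s) b))"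
  have \<rho>': "\<rho>' (e, b) = \<rho> (t, corner_at i b)" if "e \<in> edges K" "(t, i) \<in> sides K e" for e b t i
  proof -
    have "(SOME s. s \<in> sides K e) \<in> sides K e" using that(2) by (rule someI)
    then show ?thesis using agree[OF that(1) _ that(2)] by (simp add: \<rho>'_def Let_def)
  qed
  have \<rho>'f: "\<rho>' (face K i t, b) = \<rho> (t, corner_at i b)" if "t \<in> triangles K" "i < 3" for t i b
    using that surface_ends(2)[OF K that] by (intro \<rho>') (auto simp: sides_def)
  have link1: "\<rho>' p = \<rho>' q" if "(p, q) \<in> link_graph K" for p q
    using that \<rho>'f by (auto simp: link_graph_def corner_at_def)
  have link: "\<rho>' p = \<rho>' q" if "(p, q) \<in> (link_graph K \<union> (link_graph K)\<inverse>)\<^sup>*" for p q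
    using that by (induction rule: rtrancl_induct) (auto dest: link1)
  define \<sigma> where "\<sigma> = (\<lambda>v. \<rho>' (SOME p. p \<in> edges K \<times> UNIV \<and> edge_end K p = v))"
  have some: "(SOME q. q \<in> edges K \<times> UNIV \<and> edge_end K q = edge_end K p) \<in> edges K \<times> UNIV \<and>
      edge_end K (SOME q. q \<in> edges K \<times> UNIV \<and> edge_end K q = edge_end K p) = edge_end K p"
    if "p \<in> edges K \<times> UNIV" for p
    by (rule someI[of "\<lambda>q. q \<in> edges K \<times> UNIV \<and> edge_end K q = edge_end K p" p]) (use that in simp)
  have \<sigma>: "\<sigma> (edge_end K p) = \<rho>' p" if "p \<in> edges K \<times> UNIV" for p
  proof -
    have "(p, SOME q. q \<in> edges K \<times> UNIV \<and> edge_end K q = edge_end K p) \<in> (link_graph K \<union> (link_graph K)\<inverse>)\<^sup>*"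
    proof -
      have "\<forall>p\<in>edges K \<times> UNIV. \<forall>q\<in>edges K \<times> UNIV. edge_end K p = edge_end K q \<longrightarrow>
        (p, q) \<in> (link_graph K \<union> (link_graph K)\<inverse>)\<^sup>*"
        using K unfolding closed_oriented_surface_def by (elim conjE)
      from bspec[OF bspec[OF this that] conjunct1[OF some[OF that]]] show ?thesis
        using some[OF that] by simp
    qed
    from link[OF this] show ?thesis unfolding \<sigma>_def by simp
  qed
  show ?thesis
  proof (rule that)
    fix t i assume t: "t \<in> triangles K" "i < (3::nat)"
    have lo: "corner_lo K t i \<in> edges K \<times> UNIV"
      using surface_ends(2)[OF K t(1)] by (auto simp: corner_lo_def)
    have "\<rho>' (corner_lo K t i) = \<rho> (t, i)"
      using t(2) \<rho>'f[OF t(1)] by (auto elim!: less_3_cases simp: corner_lo_def corner_at_def)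
    then show "\<rho> (t, i) = \<sigma> (edge_end K (corner_lo K t i))" using \<sigma>[OF lo] by simp
  next
    fix v assume "v \<in> edge_end K ` (edges K \<times> UNIV)"
    then obtain e b where e: "e \<in> edges K" "v = edge_end K (e, b)" by blast
    obtain t i where "(t, i) \<in> sides K e" using two_sides[OF K e(1)] by (metis insertI1)
    then show "\<exists>t i. t \<in> triangles K \<and> i < 3 \<and> \<sigma> v = \<rho> (t, i)"
      using \<sigma>[of "(e, b)"] \<rho>'[OF e(1)] e corner_at_less by (fastforce simp: sides_def)
  qed
qed

section \<open>Cochains on the truncated triangles\<close>

locale surface_rep = symplectic_rep G act V L \<omega> J
  for G :: "('g, 'm) monoid_scheme" (structure) and act :: "'g \<Rightarrow> 'v::real_vector \<Rightarrow> 'v"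
    and V L :: "'v set" and \<omega> :: "'v \<Rightarrow> 'v \<Rightarrow> real" and J :: "'v \<Rightarrow> 'v" +
  fixes K :: surface and f :: "nat \<Rightarrow> 'g"
  assumes K: "closed_oriented_surface K" and f: "f \<in> bar_maps K G"
begin

abbreviation "e01 t \<equiv> face K 2 t"
abbreviation "e02 t \<equiv> face K 1 t"
abbreviation "e12 t \<equiv> face K 0 t"
abbreviation "A t \<equiv> act (f (e01 t))"
abbreviation "B t \<equiv> act (f (e02 t))"

lemma f_carrier: "e \<in> edges K \<Longrightarrow> f e \<in> carrier G"
  and f_mult: "t \<in> triangles K \<Longrightarrow> f (e02 t) = f (e01 t) \<otimes> f (e12 t)"
  using f by (auto simp: bar_maps_def PiE_def Pi_def)

lemma f_face: "t \<in> triangles K \<Longrightarrow> i < 3 \<Longrightarrow> f (face K i t) \<in> carrier G"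
  using f_carrier surface_ends(2)[OF K] by blast

lemma B_eq: "t \<in> triangles K \<Longrightarrow> B t x = A t (act (f (e12 t)) x)"
  using f_mult act_mult f_face by simp

text \<open>The cup product summed over pairs \<open>i < j\<close> of steps of a path. For a polygon
  bounded by two paths with common ends, the difference of the two values is the cup product on the
  polygon.\<close>

definition path_form :: "'v \<Rightarrow> 'v \<Rightarrow> 'v \<Rightarrow> 'v \<Rightarrow> 'v \<Rightarrow> 'v \<Rightarrow> real" where
  "path_form x1 x2 x3 y1 y2 y3 = \<omega> x1 y2 + \<omega> x1 y3 + \<omega> x2 y3"

text \<open>Truncating the triangles at their corners gives hexagons.  A cochain has a value
  \<open>y (Inl e)\<close> on each edge and a value \<open>y (Inr (t, i))\<close> on the arc that cuts off corner \<open>i\<close> of \<open>t\<close>.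
  The cup product on a hexagon compares the two paths
  \<open>01, corner 1, 12\<close> and \<open>corner 0, 02, corner 2\<close>.\<close>

definition hex_form :: "nat \<Rightarrow> (nat + nat \<times> nat \<Rightarrow> 'v) \<Rightarrow> (nat + nat \<times> nat \<Rightarrow> 'v) \<Rightarrow> real" where
  "hex_form t y z =
     path_form (y (Inl (e01 t))) (A t (y (Inr (t, 1)))) (A t (y (Inl (e12 t))))
       (z (Inl (e01 t))) (A t (z (Inr (t, 1)))) (A t (z (Inl (e12 t))))
   - path_form (y (Inr (t, 0))) (y (Inl (e02 t))) (B t (y (Inr (t, 2))))
       (z (Inr (t, 0))) (z (Inl (e02 t))) (B t (z (Inr (t, 2))))"

definition hex_closed :: "nat \<Rightarrow> (nat + nat \<times> nat \<Rightarrow> 'v) \<Rightarrow> bool" where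
  "hex_closed t y \<longleftrightarrow> y (Inl (e01 t)) + A t (y (Inr (t, 1))) + A t (y (Inl (e12 t)))
     = y (Inr (t, 0)) + y (Inl (e02 t)) + B t (y (Inr (t, 2)))"

definition Q :: "(nat + nat \<times> nat \<Rightarrow> 'v) \<Rightarrow> (nat + nat \<times> nat \<Rightarrow> 'v) \<Rightarrow> real" where
  "Q y z = (\<Sum>t\<in>triangles K. of_int (orient K t) * hex_form t y z)"

definition Y :: "(nat + nat \<times> nat \<Rightarrow> 'v) set" where
  "Y = {y. (\<forall>e\<in>edges K. y (Inl e) \<in> V) \<and> (\<forall>e. e \<notin> edges K \<longrightarrow> y (Inl e) = 0) \<and>
     (\<forall>t\<in>triangles K. \<forall>i<3. y (Inr (t, i)) \<in> L) \<and>
     (\<forall>t i. \<not> (t \<in> triangles K \<and> i < 3) \<longrightarrow> y (Inr (t, i)) = 0) \<and>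
     (\<forall>t\<in>triangles K. hex_closed t y)}"

lemma hex_form_bilinear: "bilinear_form (hex_form t)"
  by unfold_locales (simp_all add: hex_form_def path_form_def \<omega>.add_left \<omega>.add_right \<omega>.scale_left
      \<omega>.scale_right act_add act_scale algebra_simps)

lemma Q_bilinear: "bilinear_form Q"
proof -
  note h = bilinear_form.add_left[OF hex_form_bilinear] bilinear_form.add_right[OF hex_form_bilinear]
    bilinear_form.scale_left[OF hex_form_bilinear] bilinear_form.scale_right[OF hex_form_bilinear]
  show ?thesis
    by unfold_locales
       (simp_all add: Q_def h sum.distrib sum_distrib_left algebra_simps)
qed

sublocale Q: bilinear_form Q by (rule Q_bilinear)

lemma Y_subspace: "lsubspace Y"
  unfolding real_vector.subspace_def
proof (intro conjI ballI allI)
  show "0 \<in> Y" by (simp add: Y_def hex_closed_def L_closed V_closed)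
  fix x y c assume x: "x \<in> Y"
  have "hex_closed t (c *\<^sub>R x)" if "hex_closed t x" for t
    using arg_cong[OF that[unfolded hex_closed_def], of "\<lambda>v. c *\<^sub>R v"]
    by (simp add: hex_closed_def act_scale scaleR_add_right)
  then show "c *\<^sub>R x \<in> Y" using x by (auto simp: Y_def L_closed V_closed)
  assume y: "y \<in> Y"
  have "hex_closed t (x + y)" if "hex_closed t x" "hex_closed t y" for t
    using arg_cong2[OF that[unfolded hex_closed_def], of "(+)"]
    by (simp add: hex_closed_def act_add algebra_simps)
  then show "x + y \<in> Y" using x y by (auto simp: Y_def L_closed V_closed)
qed

lemma Y_finite: "finite_dim Y"
proof (rule finite_dim_functions[of "Inl ` edges K \<union> Inr ` (triangles K \<times> {..<3})" V])
  show "finite (Inl ` edges K \<union> Inr ` (triangles K \<times> {..<3::nat}))"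
    using surface_finite[OF K] by auto
  fix y i assume y: "y \<in> Y"
  show "y i \<in> V" if "i \<in> Inl ` edges K \<union> Inr ` (triangles K \<times> {..<3})"
    using y that by (auto simp: Y_def intro: L_V)
  show "y i = 0" if "i \<notin> Inl ` edges K \<union> Inr ` (triangles K \<times> {..<3})"
  proof (cases i)
    case (Inl e)
    then show ?thesis using y that by (auto simp: Y_def)
  next
    case (Inr c)
    obtain t j where "i = Inr (t, j)" using Inr by (cases c) simp
    moreover then have "\<not> (t \<in> triangles K \<and> j < 3)" using that by auto
    ultimately show ?thesis using y unfolding Y_def by blast
  qed
qed (rule V)

text \<open>Swapping the arguments produces, by antisymmetry of \<open>\<omega>\<close>, the terms
  with \<open>i > j\<close>; only the diagonal is then missing from
  \<open>\<omega> X Z\<close>.\<close>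

lemma path_form_antisym:
  assumes "x1 + x2 + x3 = X" "y1 + y2 + y3 = Z"
  shows "path_form x1 x2 x3 y1 y2 y3 - path_form y1 y2 y3 x1 x2 x3
    = \<omega> X Z - (\<omega> x1 y1 + \<omega> x2 y2 + \<omega> x3 y3)"
  unfolding path_form_def assms[symmetric]
  using \<omega>_swap[of y1] \<omega>_swap[of y2] \<omega>_swap[of y3] by (simp add: \<omega>.add_left \<omega>.add_right)

lemma Y_D:
  assumes "y \<in> Y" "t \<in> triangles K"
  shows "y (Inr (t, 0)) \<in> L" "y (Inr (t, 1)) \<in> L" "y (Inr (t, 2)) \<in> L" "hex_closed t y"
  using assms by (auto simp: Y_def)

text \<open>In one hexagon the asymmetry consists of diagonal terms only: both paths have the same
  total, so \<open>\<omega> X Z\<close> cancels, and arcs contribute nothing because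
  \<open>L\<close> is isotropic. The edge terms that remain cancel over the closed surface. Values
  in \<open>L\<close> on the arcs are imposed for this reason.\<close>

lemma Q_sym:
  assumes y: "y \<in> Y" and z: "z \<in> Y"
  shows "Q y z = Q z y"
proof -
  define H where "H = (\<lambda>e. \<omega> (y (Inl e)) (z (Inl e)))"
  have "hex_form t y z - hex_form t z y = - (H (e01 t) - H (e02 t) + H (e12 t))" if t: "t \<in> triangles K" for t
  proof -
    note yt = Y_D[OF y t] and zt = Y_D[OF z t]
    have 1: "\<omega> (A t a) (A t b) = \<omega> a b" "\<omega> (B t a) (B t b) = \<omega> a b" for a b
      using \<omega>_act f_face[OF t] by auto
    have "hex_form t y z - hex_form t z y =
      (path_form (y (Inl (e01 t))) (A t (y (Inr (t, 1)))) (A t (y (Inl (e12 t))))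
       (z (Inl (e01 t))) (A t (z (Inr (t, 1)))) (A t (z (Inl (e12 t))))
      - path_form (z (Inl (e01 t))) (A t (z (Inr (t, 1)))) (A t (z (Inl (e12 t))))
       (y (Inl (e01 t))) (A t (y (Inr (t, 1)))) (A t (y (Inl (e12 t)))))
      - (path_form (y (Inr (t, 0))) (y (Inl (e02 t))) (B t (y (Inr (t, 2))))
       (z (Inr (t, 0))) (z (Inl (e02 t))) (B t (z (Inr (t, 2))))
      - path_form (z (Inr (t, 0))) (z (Inl (e02 t))) (B t (z (Inr (t, 2))))
       (y (Inr (t, 0))) (y (Inl (e02 t))) (B t (y (Inr (t, 2)))))"
      unfolding hex_form_def by simp
    also have "\<dots> = - (H (e01 t) - H (e02 t) + H (e12 t))"
      unfolding path_form_antisym[OF yt(4)[unfolded hex_closed_def] zt(4)[unfolded hex_closed_def]]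
      unfolding path_form_antisym[OF refl refl]
      using yt(1-3) zt(1-3) by (simp add: 1 L_isotropic H_def)
    finally show ?thesis .
  qed
  then have "Q y z - Q z y = (\<Sum>t\<in>triangles K. of_int (orient K t) * - (H (e01 t) - H (e02 t) + H (e12 t)))"
    unfolding Q_def sum_subtractf[symmetric] right_diff_distrib[symmetric] by simp
  also have "\<dots> = - (\<Sum>t\<in>triangles K. of_int (orient K t) * (H (e01 t) - H (e02 t) + H (e12 t)))"
    unfolding mult_minus_right by (rule sum_negf)
  also have "\<dots> = 0" using sum_sides_signed[OF K] by simp
  finally show ?thesis by simp
qed

text \<open>The coboundary of a function on edge ends, which are the vertices of the truncated
  triangles.\<close>

definition dl :: "(nat \<times> bool \<Rightarrow> 'v) \<Rightarrow> nat + nat \<times> nat \<Rightarrow> 'v" where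
  "dl s = (\<lambda>x. case x of Inl e \<Rightarrow> if e \<in> edges K then act (f e) (s (e, True)) - s (e, False) else 0
    | Inr (t, i) \<Rightarrow> if t \<in> triangles K \<and> i < 3 then s (corner_hi K t i) - s (corner_lo K t i) else 0)"

lemma dl_simps:
  assumes "t \<in> triangles K"
  shows "dl s (Inl (e01 t)) = A t (s (e01 t, True)) - s (e01 t, False)"
    "dl s (Inl (e02 t)) = B t (s (e02 t, True)) - s (e02 t, False)"
    "dl s (Inl (e12 t)) = act (f (e12 t)) (s (e12 t, True)) - s (e12 t, False)"
    "dl s (Inr (t, 0)) = s (e02 t, False) - s (e01 t, False)"
    "dl s (Inr (t, 1)) = s (e12 t, False) - s (e01 t, True)"
    "dl s (Inr (t, 2)) = s (e12 t, True) - s (e02 t, True)"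
  using assms surface_ends(2)[OF K assms] by (auto simp: dl_def corner_lo_def corner_hi_def)

lemma dl_Y:
  assumes s: "\<And>p. s p \<in> V" and c: "\<And>t i. t \<in> triangles K \<Longrightarrow> i < 3 \<Longrightarrow> s (corner_hi K t i) - s (corner_lo K t i) \<in> L"
  shows "dl s \<in> Y"
proof -
  have "hex_closed t (dl s)" if t: "t \<in> triangles K" for t
    unfolding hex_closed_def by (simp add: dl_simps[OF t] act_diff B_eq[OF t])
  then show ?thesis using s c unfolding Y_def by (auto simp: dl_def V_closed act_V)
qed

text \<open>Stokes with boundary: edge terms cancel over the surface, and only the arcs, which form
  the boundary circles around the vertices, contribute.\<close>

lemma Q_dl:
  assumes z: "z \<in> Y"
  shows "Q (dl s) z = (\<Sum>t\<in>triangles K. of_int (orient K t) * (\<omega> (s (e01 t, True)) (z (Inr (t, 1)))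
     - \<omega> (s (e01 t, False)) (z (Inr (t, 0))) - \<omega> (s (e02 t, True)) (z (Inr (t, 2)))))"
proof -
  define H where "H = (\<lambda>e. \<omega> (s (e, False)) (z (Inl e)))"
  have "hex_form t (dl s) z = (H (e01 t) - H (e02 t) + H (e12 t)) + (\<omega> (s (e01 t, True)) (z (Inr (t, 1)))
     - \<omega> (s (e01 t, False)) (z (Inr (t, 0))) - \<omega> (s (e02 t, True)) (z (Inr (t, 2))))"
    if t: "t \<in> triangles K" for t
  proof -
    have 1: "\<omega> (A t a) (A t b) = \<omega> a b" "\<omega> (B t a) (B t b) = \<omega> a b" for a b
      using \<omega>_act f_face[OF t] by auto
    have "z (Inl (e01 t)) + A t (z (Inr (t, 1))) + A t (z (Inl (e12 t)))
     - (z (Inr (t, 0)) + z (Inl (e02 t)) + B t (z (Inr (t, 2)))) = 0"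
      using Y_D(4)[OF z t] unfolding hex_closed_def by simp
    \<comment> \<open>Both paths of the hexagon start at \<open>(e01 t, False)\<close>; pairing the
      value there with the closing relation gives the identity that cancels its terms.\<close>
    then have "\<omega> (s (e01 t, False)) (z (Inl (e01 t)) + A t (z (Inr (t, 1))) + A t (z (Inl (e12 t)))
     - (z (Inr (t, 0)) + z (Inl (e02 t)) + B t (z (Inr (t, 2))))) = 0" by simp
    then show ?thesis
      unfolding hex_form_def path_form_def H_def
      by (simp add: dl_simps[OF t] \<omega>.add_left \<omega>.add_right \<omega>.diff_left \<omega>.diff_right act_diff 1)
  qed
  then have "Q (dl s) z = (\<Sum>t\<in>triangles K. of_int (orient K t) * (H (e01 t) - H (e02 t) + H (e12 t)))
    + (\<Sum>t\<in>triangles K. of_int (orient K t) * (\<omega> (s (e01 t, True)) (z (Inr (t, 1)))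
     - \<omega> (s (e01 t, False)) (z (Inr (t, 0))) - \<omega> (s (e02 t, True)) (z (Inr (t, 2)))))"
    unfolding Q_def sum.distrib[symmetric] distrib_left[symmetric] by simp
  then show ?thesis using sum_sides_signed[OF K] by simp
qed

lemma Q_dl_L:
  assumes z: "z \<in> Y" and s: "\<And>p. s p \<in> L"
  shows "Q (dl s) z = 0"
  unfolding Q_dl[OF z] using s Y_D[OF z] L_isotropic by simp

definition JJ :: "(nat + nat \<times> nat \<Rightarrow> 'v) set" where
  "JJ = {y \<in> Y. \<forall>e\<in>edges K. y (Inl e) = 0}"

definition ZZ :: "(nat + nat \<times> nat \<Rightarrow> 'v) set" where
  "ZZ = {y \<in> Y. \<forall>c. y (Inr c) = 0}"

lemma JJ_subspace: "lsubspace JJ"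
  using Y_subspace unfolding real_vector.subspace_def JJ_def by auto

lemma ZZ_subspace: "lsubspace ZZ"
  using Y_subspace unfolding real_vector.subspace_def ZZ_def by auto

text \<open>Test elements supported in one triangle show that the value of \<open>y\<close> on an
  edge \<open>e\<close> is orthogonal to the intersection of \<open>L\<close> with its translate by
  \<open>f e\<close>, hence lies in their sum. So some \<open>L\<close>-valued \<open>s\<close> has
  \<open>dl s\<close> equal to \<open>y\<close> on all edges. As \<open>y - dl s\<close> is in
  \<open>JJ\<close> and \<open>dl s\<close> is orthogonal to \<open>Y\<close>, the square of
  \<open>y\<close> is zero.\<close>

lemma JJ_coisotropic:
  assumes y: "y \<in> Y" and ortho: "\<And>x. x \<in> JJ \<Longrightarrow> Q x y = 0"
  shows "Q y y = 0"
proof -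
  have pair: "\<omega> (y (Inl e)) (act (f e) w) = 0" if e: "e \<in> edges K" and w: "w \<in> L" "act (f e) w \<in> L" for e w
  proof -
    obtain t i where "(t, i) \<in> sides K e" using two_sides[OF K e] by (metis insertI1)
    then have t: "t \<in> triangles K" and i: "i < 3" and e': "e = face K i t" by (auto simp: sides_def)
    \<comment> \<open>Only the two corners at the ends of \<open>e\<close> are used, with the values
      and signs that close the hexagon for each position of \<open>e\<close> in
      \<open>t\<close>.\<close>
    define a :: "nat \<Rightarrow> 'v" where "a = (if i = 2 then (\<lambda>_. 0)(0 := act (f e) w, 1 := w)
      else if i = 1 then (\<lambda>_. 0)(0 := act (f e) w, 2 := - w) else (\<lambda>_. 0)(1 := act (f e) w, 2 := w))"
    define \<eta> :: "nat + nat \<times> nat \<Rightarrow> 'v" where "\<eta> = (\<lambda>x. case x of Inl _ \<Rightarrow> 0 | Inr (t', j) \<Rightarrow> if t' = t then a j else 0)"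
    have aL: "a j \<in> L" for j using w L_closed by (auto simp: a_def)
    have clos: "hex_closed t \<eta>" unfolding hex_closed_def using i e'
      by (auto elim!: less_3_cases simp: \<eta>_def a_def act_neg B_eq[OF t])
    have "\<eta> \<in> JJ" unfolding JJ_def Y_def
    proof (intro CollectI conjI ballI allI impI)
      fix t' assume "t' \<in> triangles K"
      show "hex_closed t' \<eta>"
        using clos by (cases "t' = t") (auto simp: hex_closed_def \<eta>_def)
    qed (use aL t L_closed V_closed in \<open>auto simp: \<eta>_def a_def\<close>)
    then have 0: "Q \<eta> y = 0" by (rule ortho)
    have "hex_form t' \<eta> y = 0" if "t' \<noteq> t" for t'
      using that by (simp add: hex_form_def path_form_def \<eta>_def)
    then have "Q \<eta> y = (\<Sum>t'\<in>triangles K. if t' = t then of_int (orient K t) * hex_form t \<eta> y else 0)"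
      unfolding Q_def by (intro sum.cong refl) auto
    then have "of_int (orient K t) * hex_form t \<eta> y = 0"
      using 0 t surface_finite[OF K] by simp
    moreover have "orient K t \<noteq> 0" using surface_ends(6)[OF K t] by auto
    ultimately have h0: "hex_form t \<eta> y = 0" by simp
    have 1: "\<omega> (A t a) (A t b) = \<omega> a b" "\<omega> (B t a) (B t b) = \<omega> a b" for a b
      using \<omega>_act f_face[OF t] by auto
    note yt = Y_D[OF y t]
    have "\<omega> (act (f e) w) (y (Inl e)) = 0"
      using i
    proof (rule less_3_cases)
      assume i0: "i = 0"
      then have "hex_form t \<eta> y = \<omega> (act (f e) w) (y (Inl e))"
        using e' by (simp add: hex_form_def path_form_def \<eta>_def a_def 1)
      then show ?thesis using h0 by simp
    next
      assume i1: "i = 1"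
      then have "hex_form t \<eta> y = - \<omega> (act (f e) w) (y (Inl e)) - \<omega> (act (f e) w) (B t (y (Inr (t, 2))))"
        using e' by (simp add: hex_form_def path_form_def \<eta>_def a_def)
      moreover have "\<omega> (act (f e) w) (B t (y (Inr (t, 2)))) = 0"
        using i1 e' 1 L_isotropic w yt by simp
      ultimately show ?thesis using h0 by simp
    next
      assume i2: "i = 2"
      then have "hex_form t \<eta> y = \<omega> (act (f e) w) (A t (y (Inl (e12 t)))) - \<omega> (act (f e) w) (y (Inl (e02 t)))
          - \<omega> (act (f e) w) (B t (y (Inr (t, 2))))"
        using e' by (simp add: hex_form_def path_form_def \<eta>_def a_def)
      also have "\<dots> = \<omega> (act (f e) w) (A t (y (Inl (e12 t))) - y (Inl (e02 t)) - B t (y (Inr (t, 2))))"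
        by (simp add: \<omega>.diff_right)
      also have "A t (y (Inl (e12 t))) - y (Inl (e02 t)) - B t (y (Inr (t, 2)))
         = y (Inr (t, 0)) - y (Inl (e01 t)) - A t (y (Inr (t, 1)))"
        using yt(4) unfolding hex_closed_def by (simp add: algebra_simps)
      also have "\<omega> (act (f e) w) \<dots> = - \<omega> (act (f e) w) (y (Inl e))"
        using i2 e' 1 L_isotropic w yt by (simp add: \<omega>.diff_right)
      finally show ?thesis using h0 by simp
    qed
    then show ?thesis using \<omega>_swap by (metis neg_equal_0_iff_equal)
  qed
  have "\<exists>l l'. l \<in> L \<and> l' \<in> L \<and> y (Inl e) = l + act (f e) l'" if e: "e \<in> edges K" for e
  proof -
    have "y (Inl e) \<in> V" using y e by (auto simp: Y_def)
    then show ?thesis using transverse_decomposition[OF _ f_carrier[OF e]] pair[OF e] by metis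
  qed
  then obtain l l' where l: "\<And>e. e \<in> edges K \<Longrightarrow> l e \<in> L \<and> l' e \<in> L \<and> y (Inl e) = l e + act (f e) (l' e)"
    by metis
  \<comment> \<open>The minus sign at the initial end makes \<open>dl s\<close> on \<open>e\<close>
    equal to \<open>l e\<close> plus the transport of \<open>l' e\<close>.\<close>
  define s where "s = (\<lambda>(e, b). if e \<in> edges K then (if b then l' e else - l e) else 0)"
  have sL: "s p \<in> L" for p using l L_closed by (auto simp: s_def split: prod.split)
  have dY: "dl s \<in> Y" using sL L_V L_closed by (intro dl_Y) auto
  have "y - dl s \<in> JJ" unfolding JJ_def
    using real_vector.subspace_diff[OF Y_subspace y dY] l by (auto simp: dl_def s_def)
  then have "Q (y - dl s) y = 0" by (rule ortho)
  then show ?thesis using Q_dl_L[OF y sL] by (simp add: Q.diff_left)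
qed

definition dc :: "(nat \<times> bool \<Rightarrow> 'v) \<Rightarrow> nat \<times> nat \<Rightarrow> 'v" where
  "dc s = (\<lambda>(t, i). if t \<in> triangles K \<and> i < 3 then s (corner_hi K t i) - s (corner_lo K t i) else 0)"

definition IP :: "(nat \<times> nat \<Rightarrow> 'v) \<Rightarrow> (nat \<times> nat \<Rightarrow> 'v) \<Rightarrow> real" where
  "IP a b = (\<Sum>t\<in>triangles K. \<Sum>i<3. \<omega> (J (a (t, i))) (b (t, i)))"

lemma IP_bilinear: "bilinear_form IP"
  by unfold_locales (simp_all add: IP_def ip.add_left ip.add_right ip.scale_left ip.scale_right
      sum.distrib sum_distrib_left)

sublocale IP: bilinear_form IP by (rule IP_bilinear)

lemma IP_sym: "IP a b = IP b a"
  unfolding IP_def by (intro sum.cong refl J_sym)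

lemma IP_pos:
  assumes V: "\<And>t i. t \<in> triangles K \<Longrightarrow> i < 3 \<Longrightarrow> a (t, i) \<in> V" and 0: "IP a a = 0"
    and t: "t \<in> triangles K" "i < 3"
  shows "a (t, i) = 0"
proof (rule ccontr)
  have ge: "0 \<le> \<omega> (J x) x" if "x \<in> V" for x using J_pos[OF that] by (cases "x = 0") auto
  have fin: "finite (triangles K)" using surface_finite[OF K] by simp
  assume "a (t, i) \<noteq> 0"
  then have "0 < \<omega> (J (a (t, i))) (a (t, i))" using J_pos V t by blast
  also have "\<dots> \<le> (\<Sum>i<3. \<omega> (J (a (t, i))) (a (t, i)))"
    by (rule member_le_sum[of i]) (use t V ge in auto)
  also have "\<dots> \<le> IP a a" unfolding IP_def
    by (rule member_le_sum[of t]) (use t V ge fin in \<open>auto intro!: sum_nonneg\<close>)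
  finally show False using 0 by simp
qed

text \<open>The adjoint of \<open>dc\<close>. Twisting corner \<open>i\<close> by
  \<open>orient K t * (-1) ^ i\<close> turns the difference along an arc into two terms with the
  signs of the adjacent sides, so that the sum regroups by edges.\<close>

lemma IP_dc:
  fixes \<rho> :: "nat \<times> nat \<Rightarrow> 'v"
  assumes r: "\<And>t i. t \<in> triangles K \<Longrightarrow> i < 3 \<Longrightarrow> r (t, i) = (of_int (orient K t) * (-1) ^ i) *\<^sub>R \<rho> (t, i)"
  shows "IP (dc s) r = (\<Sum>e\<in>edges K. \<Sum>(t, i)\<in>sides K e. ((-1) ^ i * of_int (orient K t)) *
    (\<omega> (J (s (e, True))) (\<rho> (t, corner_at i True)) - \<omega> (J (s (e, False))) (\<rho> (t, corner_at i False))))"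
proof -
  let ?H = "\<lambda>(t, i). ((-1) ^ i * of_int (orient K t)) *
    (\<omega> (J (s (face K i t, True))) (\<rho> (t, corner_at i True)) - \<omega> (J (s (face K i t, False))) (\<rho> (t, corner_at i False)))"
  have "IP (dc s) r = (\<Sum>t\<in>triangles K. \<Sum>i<3. ?H (t, i))"
    unfolding IP_def
  proof (rule sum.cong[OF refl])
    fix t assume t: "t \<in> triangles K"
    show "(\<Sum>i<3. \<omega> (J (dc s (t, i))) (r (t, i))) = (\<Sum>i<3. ?H (t, i))"
      using r[OF t, of 0] r[OF t, of 1] r[OF t, of 2] t
      by (simp add: sum_less_3 dc_def corner_lo_def corner_hi_def corner_at_def ip.diff_left
          ip.scale_right \<omega>.minus_right algebra_simps)
  qed
  also have "\<dots> = (\<Sum>e\<in>edges K. \<Sum>s\<in>sides K e. ?H s)" by (rule sum_sides[OF K])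
  also have "\<dots> = (\<Sum>e\<in>edges K. \<Sum>(t, i)\<in>sides K e. ((-1) ^ i * of_int (orient K t)) *
    (\<omega> (J (s (e, True))) (\<rho> (t, corner_at i True)) - \<omega> (J (s (e, False))) (\<rho> (t, corner_at i False))))"
    by (intro sum.cong refl) (auto simp: sides_def)
  finally show ?thesis .
qed

text \<open>Orthogonality to the image of \<open>dc\<close> is tested on a function concentrated at
  one end of \<open>e\<close>. Its value there is the difference \<open>w\<close> of the two corner
  values in question, and the opposite signs of the two sides leave exactly the norm of
  \<open>w\<close>.\<close>

lemma dc_single:
  assumes e: "e \<in> edges K"
    and r: "\<And>t i. t \<in> triangles K \<Longrightarrow> i < 3 \<Longrightarrow> r (t, i) = (of_int (orient K t) * (-1) ^ i) *\<^sub>R \<rho> (t, i)"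
    and \<rho>: "\<And>t i. t \<in> triangles K \<Longrightarrow> i < 3 \<Longrightarrow> \<rho> (t, i) \<in> L"
    and ortho: "\<And>s. (\<And>p. s p \<in> L) \<Longrightarrow> (\<And>p. p \<notin> edges K \<times> UNIV \<Longrightarrow> s p = 0) \<Longrightarrow> IP (dc s) r = 0"
    and s: "s \<in> sides K e" "s' \<in> sides K e"
  shows "\<rho> (fst s, corner_at (snd s) b) = \<rho> (fst s', corner_at (snd s') b)"
proof -
  obtain t i t' i' where tt: "sides K e = {(t, i), (t', i')}" "(t, i) \<noteq> (t', i')"
    "(-1) ^ i' * orient K t' = - ((-1) ^ i * orient K t)" using two_sides[OF K e] .
  have T: "t \<in> triangles K" "t' \<in> triangles K" using tt(1) unfolding sides_def by blast+
  define w where "w = \<rho> (t, corner_at i b) - \<rho> (t', corner_at i' b)"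
  have w: "w \<in> L" using \<rho>[OF T(1) corner_at_less] \<rho>[OF T(2) corner_at_less] L_closed by (simp add: w_def)
  define u :: "nat \<times> bool \<Rightarrow> 'v" where "u = (\<lambda>p. if p = (e, b) then w else 0)"
  define E where "E = (\<lambda>e'. \<Sum>(t, i)\<in>sides K e'. ((-1) ^ i * of_int (orient K t)) *
    (\<omega> (J (u (e', True))) (\<rho> (t, corner_at i True)) - \<omega> (J (u (e', False))) (\<rho> (t, corner_at i False))))"
  have "IP (dc u) r = 0" using w e L_closed by (intro ortho) (auto simp: u_def)
  then have "(\<Sum>e'\<in>edges K. E e') = 0" using IP_dc[OF r] unfolding E_def by simp
  moreover have "E e' = 0" if "e' \<noteq> e" for e'
    using that unfolding E_def u_def by (auto simp: linear_0[OF J_linear] intro!: sum.neutral)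
  then have "(\<Sum>e'\<in>edges K. E e') = E e"
    using e surface_finite[OF K] by (subst sum.remove[of _ e]) (auto intro!: sum.neutral)
  ultimately have "E e = 0" by simp
  moreover have "E e = (if b then 1 else -1) * ((-1) ^ i * of_int (orient K t)) * \<omega> (J w) w"
  proof -
    have sg: "(-1) ^ i' * of_int (orient K t') = - ((-1) ^ i * of_int (orient K t) :: real)"
      using arg_cong[OF tt(3), of real_of_int] by simp
    show ?thesis
      unfolding E_def tt(1) using tt(2)
      by (cases b) (simp_all add: u_def sg linear_0[OF J_linear], simp_all add: w_def ip.diff_right algebra_simps)
  qed
  moreover have "orient K t \<noteq> 0" using surface_ends(6)[OF K T(1)] by auto
  ultimately have "\<omega> (J w) w = 0" by (cases b) auto
  then have "w = 0" using J_pos[of w] w L_V by force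
  then show ?thesis using s tt(1) unfolding w_def by auto
qed

text \<open>Let \<open>r\<close> be the residue of the arc values of \<open>y\<close> after
  projection to the coboundaries \<open>dc s\<close> with \<open>s\<close> in \<open>L\<close>.
  After the sign twist it is a function \<open>\<sigma>\<close> of the vertex. So
  \<open>J \<sigma>\<close> is a 0-cochain of the surface itself, its coboundary lies in
  \<open>ZZ\<close>, and its pairing with \<open>y\<close> is minus the norm of \<open>r\<close>.
  Hence \<open>r\<close> is zero on all arcs, \<open>y - dl s\<close> lies in \<open>ZZ\<close>, and
  the end is as for \<open>JJ\<close>.\<close>

lemma ZZ_coisotropic:
  assumes y: "y \<in> Y" and ortho: "\<And>x. x \<in> ZZ \<Longrightarrow> Q x y = 0"
  shows "Q y y = 0"
proof -
  define S where "S = {s :: nat \<times> bool \<Rightarrow> 'v. (\<forall>p. s p \<in> L) \<and> (\<forall>p. p \<notin> edges K \<times> UNIV \<longrightarrow> s p = 0)}"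
  have S_sub: "lsubspace S" unfolding S_def real_vector.subspace_def by (auto simp: L_closed)
  have S_fin: "finite_dim S"
    by (rule finite_dim_functions[of "edges K \<times> UNIV" L])
       (use surface_finite[OF K] L_finite in \<open>auto simp: S_def\<close>)
  have dc_lin: "linear dc"
    by (rule linearI) (auto simp: dc_def fun_eq_iff algebra_simps)
  note W = finite_dim_linear_image[OF dc_lin S_fin] linear_image_subspace[OF dc_lin S_sub]
  have WL: "dc s (t, i) \<in> L" if "s \<in> S" for s t i
  proof -
    have "s p \<in> L" for p using that unfolding S_def by blast
    then show ?thesis by (simp add: dc_def L_closed)
  qed
  define a where "a = (\<lambda>c. y (Inr c))"
  have aniso: "w = 0" if "w \<in> dc ` S" "IP w w = 0" for w
  proof -
    have "w (t, i) = 0" if "t \<in> triangles K" "i < 3" for t i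
      by (rule IP_pos[OF _ \<open>IP w w = 0\<close> that]) (use \<open>w \<in> dc ` S\<close> WL L_V in blast)
    then show ?thesis using \<open>w \<in> dc ` S\<close> by (fastforce simp: dc_def fun_eq_iff)
  qed
  obtain w where w: "w \<in> dc ` S" "\<And>u. u \<in> dc ` S \<Longrightarrow> IP u (a - w) = 0"
    using IP.orthogonal_projection[OF W aniso IP_sym, of a] by metis
  obtain s where s: "s \<in> S" "w = dc s" using w by blast
  have sL: "s p \<in> L" for p using s(1) unfolding S_def by blast
  define r where "r = a - w"
  define \<rho> where "\<rho> = (\<lambda>(t, i). (of_int (orient K t) * (-1) ^ i) *\<^sub>R r (t, i))"
  have rL: "r (t, i) \<in> L" if "t \<in> triangles K" "i < 3" for t i
    using y that WL[OF s(1)] L_closed by (auto simp: r_def a_def s Y_def)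
  have \<rho>L: "\<rho> (t, i) \<in> L" if "t \<in> triangles K" "i < 3" for t i
    using rL[OF that] L_closed by (simp add: \<rho>_def)
  have sq: "of_int (orient K t) * (-1) ^ i * (of_int (orient K t) * (-1) ^ i) = (1::real)"
    if "t \<in> triangles K" for t i
  proof -
    have "of_int (orient K t) * (-1) ^ i * (of_int (orient K t) * (-1) ^ i)
       = of_int ((orient K t)\<^sup>2) * ((-1) ^ i * (-1) ^ i :: real)" by (simp add: power2_eq_square)
    then show ?thesis using surface_ends(6)[OF K that] by (simp add: power_mult_distrib[symmetric])
  qed
  have r\<rho>: "r (t, i) = (of_int (orient K t) * (-1) ^ i) *\<^sub>R \<rho> (t, i)" if "t \<in> triangles K" "i < 3" for t i
    using sq[OF that(1), of i] by (simp add: \<rho>_def)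
  have ow: "IP (dc s) r = 0" if "\<And>p. s p \<in> L" "\<And>p. p \<notin> edges K \<times> UNIV \<Longrightarrow> s p = 0" for s
  proof -
    have "s \<in> S" unfolding S_def using that by blast
    then show ?thesis unfolding r_def using w(2) by blast
  qed
  have agree: "\<rho> (fst s, corner_at (snd s) b) = \<rho> (fst s', corner_at (snd s') b)"
    if "e \<in> edges K" "s \<in> sides K e" "s' \<in> sides K e" for e s s' b
    by (rule dc_single[OF that(1) r\<rho> \<rho>L ow that(2,3)])
  obtain \<sigma> where \<sigma>: "\<And>t i. t \<in> triangles K \<Longrightarrow> i < 3 \<Longrightarrow> \<rho> (t, i) = \<sigma> (edge_end K (corner_lo K t i))"
    "\<And>v. v \<in> edge_end K ` (edges K \<times> UNIV) \<Longrightarrow> \<exists>t i. t \<in> triangles K \<and> i < 3 \<and> \<sigma> v = \<rho> (t, i)"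
    by (rule corner_function_by_vertex[where \<rho> = \<rho>, OF K], erule (2) agree, blast)
  \<comment> \<open>The values lie in \<open>V\<close> but need not lie in \<open>L\<close>. This is
    allowed because all ends at one vertex receive the same vector, so the arcs receive
    zero.\<close>
  define \<tau> where "\<tau> = (\<lambda>p. if p \<in> edges K \<times> UNIV then J (\<sigma> (edge_end K p)) else 0)"
  have \<tau>V: "\<tau> p \<in> V" for p
  proof (cases "p \<in> edges K \<times> UNIV")
    case True
    then obtain t i where "t \<in> triangles K" "i < 3" "\<sigma> (edge_end K p) = \<rho> (t, i)"
      using \<sigma>(2)[of "edge_end K p"] by blast
    then show ?thesis using True \<rho>L[of t i] by (simp add: \<tau>_def J_V L_V del: mem_Sigma_iff)
  next
    case False
    then show ?thesis by (simp add: \<tau>_def V_closed del: mem_Sigma_iff)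
  qed
  have ends: "corner_lo K t i \<in> edges K \<times> UNIV" "corner_hi K t i \<in> edges K \<times> UNIV"
    if "t \<in> triangles K" for t i
    using surface_ends(2)[OF K that] by (auto simp: corner_lo_def corner_hi_def)
  have \<tau>c: "\<tau> (corner_hi K t i) = \<tau> (corner_lo K t i)" if "t \<in> triangles K" for t i
    using ends[OF that] surface_ends(1)[OF K that] by (simp add: \<tau>_def del: mem_Sigma_iff)
  have "dl \<tau> \<in> Y" using \<tau>V \<tau>c L_closed by (intro dl_Y) simp_all
  then have "dl \<tau> \<in> ZZ" using \<tau>c by (auto simp: ZZ_def dl_def)
  then have "Q (dl \<tau>) y = 0" by (rule ortho)
  \<comment> \<open>The signs of the arc terms in \<open>Q_dl\<close> are those of the twist, up to
    one overall minus sign.\<close>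
  moreover have "Q (dl \<tau>) y = - IP r a"
    unfolding Q_dl[OF y] IP_def sum_negf[symmetric]
  proof (rule sum.cong[OF refl])
    fix t assume t: "t \<in> triangles K"
    have "\<tau> (corner_lo K t i) = J (\<rho> (t, i))" if "i < 3" for i
      using ends[OF t] \<sigma>(1)[OF t that] by (simp add: \<tau>_def del: mem_Sigma_iff)
    from this[of 0] this[of 1] this[of 2]
    have 1: "\<tau> (e01 t, False) = J (\<rho> (t, 0))" "\<tau> (e01 t, True) = J (\<rho> (t, 1))" "\<tau> (e02 t, True) = J (\<rho> (t, 2))"
      using \<tau>c[OF t, of 0] \<tau>c[OF t, of 1] \<tau>c[OF t, of 2] by (simp_all add: corner_lo_def)
    show "of_int (orient K t) * (\<omega> (\<tau> (e01 t, True)) (y (Inr (t, 1))) - \<omega> (\<tau> (e01 t, False)) (y (Inr (t, 0)))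
       - \<omega> (\<tau> (e02 t, True)) (y (Inr (t, 2)))) = (\<Sum>i<3. - \<omega> (J (r (t, i))) (a (t, i)))"
      unfolding 1 using r\<rho>[OF t, of 0] r\<rho>[OF t, of 1] r\<rho>[OF t, of 2]
      by (simp add: sum_less_3 ip.scale_left ip.minus_left a_def algebra_simps)
  qed
  ultimately have "IP r a = 0" by simp
  moreover have "IP r w = 0" using w(2)[OF w(1)] IP_sym unfolding r_def by metis
  ultimately have "IP r r = 0" by (simp add: r_def IP.diff_right)
  then have r0: "r (t, i) = 0" if "t \<in> triangles K" "i < 3" for t i
    using IP_pos[OF _ _ that] rL L_V by blast
  have "dl s \<in> Y" using sL L_V L_closed by (intro dl_Y) auto
  then have yd: "y - dl s \<in> Y" by (rule real_vector.subspace_diff[OF Y_subspace y])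
  have "(y - dl s) (Inr (t, i)) = 0" for t i
  proof (cases "t \<in> triangles K \<and> i < 3")
    case True
    then show ?thesis using r0[of t i] by (simp add: dl_def r_def a_def s(2) dc_def)
  next
    case False
    then show ?thesis using yd unfolding Y_def by blast
  qed
  then have "y - dl s \<in> ZZ" using yd unfolding ZZ_def by (simp add: split_paired_All)
  then have "Q (y - dl s) y = 0" by (rule ortho)
  then show ?thesis using Q_dl_L[OF y sL] by (simp add: Q.diff_left)
qed

lemma signature_ZZ: "signature_on Q ZZ = signature_on Q JJ"
proof -
  have ZY: "ZZ \<subseteq> Y" "JJ \<subseteq> Y" by (auto simp: ZZ_def JJ_def)
  have "signature_on Q ZZ = signature_on Q Y"
    by (rule Q.signature_coisotropic[OF Y_finite Y_subspace Q_sym ZZ_subspace ZY(1) ZZ_coisotropic])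
  moreover have "signature_on Q JJ = signature_on Q Y"
    by (rule Q.signature_coisotropic[OF Y_finite Y_subspace Q_sym JJ_subspace ZY(2) JJ_coisotropic])
  ultimately show ?thesis by simp
qed

end

section \<open>Contributions of single triangles, and the cup product on cocycles\<close>

context surface_rep
begin

definition arcs_on :: "nat \<Rightarrow> (nat \<Rightarrow> 'v) \<Rightarrow> nat + nat \<times> nat \<Rightarrow> 'v" where
  "arcs_on t a = (\<lambda>x. case x of Inl _ \<Rightarrow> 0 | Inr (t', i) \<Rightarrow> if t' = t then a i else 0)"

text \<open>The part of \<open>JJ\<close> supported on the triangles in \<open>S\<close>, for an
  induction that adds one triangle at a time.\<close>

definition J_on :: "nat set \<Rightarrow> (nat + nat \<times> nat \<Rightarrow> 'v) set" where
  "J_on S = {y \<in> JJ. \<forall>t i. t \<notin> S \<longrightarrow> y (Inr (t, i)) = 0}"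

abbreviation "msp t \<equiv> maslov_space (f (e01 t)) (f (e12 t))"
abbreviation "mfm t \<equiv> maslov_form (f (e01 t)) (f (e12 t))"

lemma arcs_on_linear: "linear (arcs_on t)"
  by (rule linearI) (auto simp: arcs_on_def fun_eq_iff split: sum.split)

lemma arcs_on_inj: "arcs_on t a = 0 \<Longrightarrow> a = 0"
proof
  fix i assume "arcs_on t a = 0"
  from fun_cong[OF this, of "Inr (t, i)"] show "a i = 0 i" by (simp add: arcs_on_def)
qed

lemma arcs_on_JJ:
  assumes t: "t \<in> triangles K" and a: "a \<in> msp t"
  shows "arcs_on t a \<in> JJ"
  unfolding JJ_def Y_def
proof (intro CollectI conjI ballI allI impI)
  fix t' assume "t' \<in> triangles K"
  show "hex_closed t' (arcs_on t a)"
    using a f_mult[OF t] by (auto simp: hex_closed_def arcs_on_def maslov_space_def)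
qed (use a t L_closed V_closed in \<open>auto simp: arcs_on_def maslov_space_def\<close>)

lemma hex_form_vanish:
  assumes "\<And>i. y (Inr (t, i)) = 0" "\<And>i. i < 3 \<Longrightarrow> y (Inl (face K i t)) = 0"
  shows "hex_form t x y = 0" "hex_form t y x = 0"
  using assms by (simp_all add: hex_form_def path_form_def)

lemma Q_arcs_on:
  assumes t: "t \<in> triangles K" 
  shows "Q (arcs_on t a) y = of_int (orient K t) * hex_form t (arcs_on t a) y"
proof -
  have "hex_form t' (arcs_on t a) y = 0" if "t' \<noteq> t" for t'
    by (rule hex_form_vanish) (use that in \<open>auto simp: arcs_on_def\<close>)
  then have "Q (arcs_on t a) y = (\<Sum>t'\<in>triangles K. if t' = t then of_int (orient K t) * hex_form t (arcs_on t a) y else 0)"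
    unfolding Q_def by (intro sum.cong refl) auto
  then show ?thesis using t surface_finite[OF K] by simp
qed

lemma Q_arcs_on_self:
  assumes t: "t \<in> triangles K" 
  shows "Q (arcs_on t a) (arcs_on t b) = of_int (orient K t) * mfm t a b"
  unfolding Q_arcs_on[OF t]
  by (simp add: hex_form_def path_form_def arcs_on_def maslov_form_def f_mult[OF t, symmetric])

text \<open>A negative orientation replaces the Maslov form by its negative, hence the signature by
  its negative.\<close>

lemma signature_arcs_on:
  assumes t: "t \<in> triangles K"
  shows "signature_on Q (arcs_on t ` msp t) = orient K t * maslov (f (e01 t)) (f (e12 t))"
proof -
  have fc: "f (e01 t) \<in> carrier G" "f (e12 t) \<in> carrier G" using f_face[OF t] by auto
  note ms = maslov_space_finite maslov_space_subspace
  have sm: "mfm t a b = mfm t b a" if "a \<in> msp t" "b \<in> msp t" for a b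
    by (rule maslov_form_sym[OF fc that])
  have nsm: "- mfm t a b = - mfm t b a" if "a \<in> msp t" "b \<in> msp t" for a b
    using sm[OF that] by simp
  have "orient K t = 1 \<or> orient K t = -1" using K t by (auto simp: closed_oriented_surface_def)
  then show ?thesis
  proof
    assume o: "orient K t = 1"
    have "signature_on Q (arcs_on t ` msp t) = signature_on (mfm t) (msp t)"
      by (rule signature_image[OF arcs_on_linear ms arcs_on_inj _ maslov_form_bilinear Q_bilinear sm])
         (simp_all add: Q_arcs_on_self[OF t] o)
    then show ?thesis by (simp add: maslov_def o)
  next
    assume o: "orient K t = -1"
    have "signature_on Q (arcs_on t ` msp t) = signature_on (\<lambda>a b. - mfm t a b) (msp t)"
      by (rule signature_image[OF arcs_on_linear ms arcs_on_inj _
            bilinear_form.bilinear_form_uminus[OF maslov_form_bilinear] Q_bilinear nsm])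
         (simp_all add: Q_arcs_on_self[OF t] o)
    also have "\<dots> = - signature_on (mfm t) (msp t)"
      by (rule bilinear_form.signature_uminus[OF maslov_form_bilinear ms sm])
    finally show ?thesis by (simp add: maslov_def o)
  qed
qed

lemma J_on_subspace: "lsubspace (J_on S)"
  using JJ_subspace unfolding real_vector.subspace_def J_on_def by auto

lemma JJ_Y: "JJ \<subseteq> Y" by (auto simp: JJ_def)

lemma J_on_Y: "J_on S \<subseteq> Y" using JJ_Y by (auto simp: J_on_def)

text \<open>When the edge values vanish, closing a hexagon is a condition on the arcs of that
  triangle alone, namely membership in \<open>maslov_space\<close>.\<close>

lemma J_on_insert:
  assumes t: "t \<in> triangles K"
  shows "J_on (insert t S) = {x + y |x y. x \<in> arcs_on t ` msp t \<and> y \<in> J_on S}"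
proof (intro subset_antisym subsetI)
  fix z assume "z \<in> {x + y |x y. x \<in> arcs_on t ` msp t \<and> y \<in> J_on S}"
  then obtain a y where a: "a \<in> msp t" "y \<in> J_on S" "z = arcs_on t a + y" by blast
  have "z \<in> JJ"
    using real_vector.subspace_add[OF JJ_subspace arcs_on_JJ[OF t a(1)], of y] a by (simp add: J_on_def)
  moreover have "z (Inr (t', i)) = 0" if "t' \<notin> insert t S" for t' i
    using a(2,3) that by (simp add: J_on_def arcs_on_def)
  ultimately show "z \<in> J_on (insert t S)" by (simp add: J_on_def)
next
  fix z assume z: "z \<in> J_on (insert t S)"
  define a where "a = (\<lambda>i. z (Inr (t, i)))"
  have zJ: "z \<in> JJ" and zY: "z \<in> Y" using z JJ_Y by (auto simp: J_on_def)
  have "z (Inl e) = 0" for e using zJ by (cases "e \<in> edges K") (auto simp: JJ_def Y_def)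
  then have a: "a \<in> msp t"
    using zY t f_mult[OF t] by (auto simp: a_def maslov_space_def Y_def hex_closed_def)
  have "z - arcs_on t a \<in> JJ"
    by (rule real_vector.subspace_diff[OF JJ_subspace zJ arcs_on_JJ[OF t a]])
  then have "z - arcs_on t a \<in> J_on S"
    using z by (auto simp: J_on_def arcs_on_def a_def)
  then show "z \<in> {x + y |x y. x \<in> arcs_on t ` msp t \<and> y \<in> J_on S}"
    using a by (intro CollectI exI[of _ "arcs_on t a"] exI[of _ "z - arcs_on t a"]) simp
qed

lemma signature_J_on:
  assumes "finite S" "S \<subseteq> triangles K"
  shows "signature_on Q (J_on S) = (\<Sum>t\<in>S. orient K t * maslov (f (e01 t)) (f (e12 t)))"
  using assms
proof (induction S rule: finite_induct)
  case empty
  have 0: "x = 0" if "x \<in> J_on {}" for x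
  proof
    fix c show "x c = 0 c" using that
      by (cases c) (auto simp: J_on_def JJ_def Y_def)
  qed
  have "signature_on Q (J_on {}) = 0"
    by (rule Q.signature_zero[OF finite_dim_subset[OF Y_finite J_on_Y] J_on_subspace])
       (metis 0 Q.zero_left)
  then show ?case by simp
next
  case (insert t S)
  have t: "t \<in> triangles K" using insert by simp
  have sy: "Q x y = Q y x" if "x \<in> J_on (insert t S)" "y \<in> J_on (insert t S)" for x y
    using that J_on_Y Q_sym by blast
  have "signature_on Q (J_on (insert t S)) = signature_on Q (arcs_on t ` msp t) + signature_on Q (J_on S)"
  proof (rule Q.signature_orthogonal_sum[OF finite_dim_subset[OF Y_finite J_on_Y] sy J_on_insert[OF t] _ J_on_subspace])
    show "lsubspace (arcs_on t ` msp t)"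
      by (rule linear_image_subspace[OF arcs_on_linear maslov_space_subspace])
    fix x y assume "x \<in> arcs_on t ` msp t" and y: "y \<in> J_on S"
    then obtain a where x: "x = arcs_on t a" by blast
    have "hex_form t x y = 0"
    proof (rule hex_form_vanish)
      show "y (Inr (t, i)) = 0" for i using y insert by (simp add: J_on_def)
      show "y (Inl (face K i t)) = 0" if "i < 3" for i
        using y surface_ends(2)[OF K t that] by (simp add: J_on_def JJ_def)
    qed
    then show "Q x y = 0" unfolding x Q_arcs_on[OF t] by simp
  qed
  then show ?case using insert signature_arcs_on[OF t] by simp
qed

lemma signature_JJ: "signature_on Q JJ = (\<Sum>t\<in>triangles K. orient K t * maslov (f (e01 t)) (f (e12 t)))"
proof -
  have "JJ = J_on (triangles K)" by (auto simp: J_on_def JJ_def Y_def)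
  then show ?thesis using signature_J_on[of "triangles K"] surface_finite[OF K] by simp
qed

definition Z1 :: "(nat \<Rightarrow> 'v) set" where
  "Z1 = {\<phi>. (\<forall>e\<in>edges K. \<phi> e \<in> V) \<and> (\<forall>e. e \<notin> edges K \<longrightarrow> \<phi> e = 0) \<and>
    (\<forall>t\<in>triangles K. A t (\<phi> (e12 t)) - \<phi> (e02 t) + \<phi> (e01 t) = 0)}"

definition cup :: "(nat \<Rightarrow> 'v) \<Rightarrow> (nat \<Rightarrow> 'v) \<Rightarrow> real" where
  "cup \<phi> \<psi> = (\<Sum>t\<in>triangles K. of_int (orient K t) * \<omega> (\<phi> (e01 t)) (A t (\<psi> (e12 t))))"

definition d0 :: "(nat \<Rightarrow> 'v) \<Rightarrow> nat \<Rightarrow> 'v" where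
  "d0 s = (\<lambda>e. if e \<in> edges K then act (f e) (s (target K e)) - s (source K e) else 0)"

definition no_arcs :: "(nat \<Rightarrow> 'v) \<Rightarrow> nat + nat \<times> nat \<Rightarrow> 'v" where
  "no_arcs \<phi> = (\<lambda>x. case x of Inl e \<Rightarrow> \<phi> e | Inr _ \<Rightarrow> 0)"

lemma no_arcs_linear: "linear no_arcs"
  by (rule linearI) (auto simp: no_arcs_def fun_eq_iff split: sum.split)

lemma no_arcs_inj: "no_arcs a = 0 \<Longrightarrow> a = 0"
proof
  fix e assume "no_arcs a = 0"
  from fun_cong[OF this, of "Inl e"] show "a e = 0 e" by (simp add: no_arcs_def)
qed

lemma no_arcs_Y:
  assumes "\<phi> \<in> Z1" shows "no_arcs \<phi> \<in> Y"
  using assms by (auto simp: Y_def Z1_def no_arcs_def hex_closed_def L_closed algebra_simps eq_diff_eq diff_eq_eq add_eq_0_iff)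

lemma ZZ_eq: "ZZ = no_arcs ` Z1"
proof (intro subset_antisym subsetI)
  fix y assume y: "y \<in> ZZ"
  define \<phi> where "\<phi> = (\<lambda>e. y (Inl e))"
  have yY: "y \<in> Y" and y0: "y (Inr c) = 0" for c using y unfolding ZZ_def by blast+
  have "\<phi> \<in> Z1" unfolding Z1_def
  proof (intro CollectI conjI ballI allI impI)
    fix t assume t: "t \<in> triangles K"
    then show "A t (\<phi> (e12 t)) - \<phi> (e02 t) + \<phi> (e01 t) = 0"
      using Y_D(4)[OF yY t] y0 by (simp add: hex_closed_def \<phi>_def algebra_simps)
  qed (use yY in \<open>auto simp: \<phi>_def Y_def\<close>)
  moreover have "y = no_arcs \<phi>"
    using y0 by (auto simp: no_arcs_def \<phi>_def fun_eq_iff split: sum.split)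
  ultimately show "y \<in> no_arcs ` Z1" by blast
next
  fix y assume "y \<in> no_arcs ` Z1"
  then show "y \<in> ZZ" using no_arcs_Y by (auto simp: ZZ_def no_arcs_def)
qed

lemma Q_no_arcs: "Q (no_arcs \<phi>) (no_arcs \<psi>) = cup \<phi> \<psi>"
  by (simp add: Q_def cup_def hex_form_def path_form_def no_arcs_def)

lemma cup_bilinear: "bilinear_form cup"
  by unfold_locales (simp_all add: cup_def \<omega>.add_left \<omega>.add_right \<omega>.scale_left \<omega>.scale_right
      act_add act_scale sum.distrib sum_distrib_left algebra_simps)

lemma cup_sym: "\<phi> \<in> Z1 \<Longrightarrow> \<psi> \<in> Z1 \<Longrightarrow> cup \<phi> \<psi> = cup \<psi> \<phi>"
  using Q_sym[OF no_arcs_Y no_arcs_Y] by (simp add: Q_no_arcs)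

lemma Z1_subspace: "lsubspace Z1"
  unfolding real_vector.subspace_def
proof (intro conjI ballI allI)
  define c where "c = (\<lambda>t \<phi>. A t (\<phi> (e12 t)) - \<phi> (e02 t) + \<phi> (e01 t))"
  have Z: "Z1 = {\<phi>. (\<forall>e\<in>edges K. \<phi> e \<in> V) \<and> (\<forall>e. e \<notin> edges K \<longrightarrow> \<phi> e = 0) \<and>
    (\<forall>t\<in>triangles K. c t \<phi> = 0)}" by (simp add: Z1_def c_def)
  have c: "c t 0 = 0" "c t (x + y) = c t x + c t y" "c t (r *\<^sub>R x) = r *\<^sub>R c t x" for t x y r
    by (simp_all add: c_def act_add act_scale algebra_simps)
  show "0 \<in> Z1" by (simp add: Z c V_closed)
  fix x y r assume x: "x \<in> Z1"
  then show "r *\<^sub>R x \<in> Z1" by (simp add: Z c V_closed)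
  assume "y \<in> Z1"
  then show "x + y \<in> Z1" using x by (simp add: Z c V_closed)
qed

lemma Z1_finite: "finite_dim Z1"
  by (rule finite_dim_functions[of "edges K" V]) (use surface_finite[OF K] V in \<open>auto simp: Z1_def\<close>)

lemma d0_Z1:
  assumes "\<And>v. v \<in> vertices K \<Longrightarrow> s v \<in> V"
  shows "d0 s \<in> Z1"
  unfolding Z1_def
proof (intro CollectI conjI ballI allI impI)
  fix e assume "e \<in> edges K"
  moreover then have "source K e \<in> vertices K" "target K e \<in> vertices K"
    using K by (auto simp: closed_oriented_surface_def delta_complex_def)
  ultimately show "d0 s e \<in> V" using assms by (simp add: d0_def V_closed act_V)
next
  fix t assume t: "t \<in> triangles K"
  show "A t (d0 s (e12 t)) - d0 s (e02 t) + d0 s (e01 t) = 0"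
    using surface_ends(2-5)[OF K t]
    by (simp add: d0_def act_diff B_eq[OF t, symmetric])
qed (simp add: d0_def)

text \<open>A function on vertices has equal values at both ends of each arc, so its coboundary,
  extended by zero to the arcs, has the form \<open>dl\<close>. Against a cochain that vanishes on
  arcs, the Stokes formula has no terms left.\<close>

lemma cup_d0:
  assumes "\<psi> \<in> Z1"
  shows "cup (d0 s) \<psi> = 0"
proof -
  have "dl (\<lambda>p. s (edge_end K p)) = no_arcs (d0 s)"
    using surface_ends(1)[OF K]
    by (auto simp: dl_def no_arcs_def d0_def fun_eq_iff edge_end_def split: sum.split)
  then have "cup (d0 s) \<psi> = Q (dl (\<lambda>p. s (edge_end K p))) (no_arcs \<psi>)" by (simp add: Q_no_arcs)
  also have "\<dots> = 0" unfolding Q_dl[OF no_arcs_Y[OF assms]] by (simp add: no_arcs_def)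
  finally show ?thesis .
qed

text \<open>The left side is the signature of \<open>Q\<close> on \<open>ZZ\<close>, the right side
  its signature on \<open>JJ\<close>.\<close>

theorem signature_eq_sum_maslov:
  "signature_on cup Z1 = (\<Sum>t\<in>triangles K. orient K t * maslov (f (e01 t)) (f (e12 t)))"
proof -
  have "signature_on Q (no_arcs ` Z1) = signature_on cup Z1"
    by (rule signature_image[OF no_arcs_linear Z1_finite Z1_subspace no_arcs_inj Q_no_arcs
          cup_bilinear Q_bilinear cup_sym])
  then show ?thesis using signature_ZZ signature_JJ by (simp add: ZZ_eq)
qed

end

section \<open>The cocycle condition\<close>

text \<open>The boundary of a tetrahedron, with the edges \<open>01, 02, 03, 12, 13, 23\<close> and the triangles
  \<open>012, 013, 023, 123\<close> numbered in this order.\<close>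

definition tetrahedron :: surface where
  "tetrahedron = \<lparr>vertices = {0, 1, 2, 3}, edges = {0, 1, 2, 3, 4, 5}, triangles = {0, 1, 2, 3},
     source = (\<lambda>e. [0, 0, 0, 1, 1, 2] ! e), target = (\<lambda>e. [1, 2, 3, 2, 3, 3] ! e),
     face = (\<lambda>i t. [[3, 1, 0], [4, 2, 0], [5, 2, 1], [5, 4, 3]] ! t ! i),
     orient = (\<lambda>t. [-1, 1, -1, 1] ! t)\<rparr>"

lemma tetrahedron_simps:
  "vertices tetrahedron = {0, 1, 2, 3}" "edges tetrahedron = {0, 1, 2, 3, 4, 5}"
  "triangles tetrahedron = {0, 1, 2, 3}"
  "source tetrahedron e = [0, 0, 0, 1, 1, 2] ! e" "target tetrahedron e = [1, 2, 3, 2, 3, 3] ! e"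
  "face tetrahedron i t = [[3, 1, 0], [4, 2, 0], [5, 2, 1], [5, 4, 3]] ! t ! i"
  "orient tetrahedron t = [-1, 1, -1, 1] ! t"
  by (simp_all add: tetrahedron_def)

lemma tetrahedron_sides:
  "sides tetrahedron 0 = {(0, 2), (1, 2)}" "sides tetrahedron 1 = {(0, 1), (2, 2)}"
  "sides tetrahedron 2 = {(1, 1), (2, 1)}" "sides tetrahedron 3 = {(0, 0), (3, 2)}"
  "sides tetrahedron 4 = {(1, 0), (3, 1)}" "sides tetrahedron 5 = {(2, 0), (3, 0)}"
  unfolding sides_def tetrahedron_simps
  by (auto elim!: less_3_cases)

lemma tetrahedron_link:
  "link_graph tetrahedron = {((0, False), (1, False)), ((0, True), (3, False)), ((1, True), (3, True)),
    ((0, False), (2, False)), ((0, True), (4, False)), ((2, True), (4, True)),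
    ((1, False), (2, False)), ((1, True), (5, False)), ((2, True), (5, True)),
    ((3, False), (4, False)), ((3, True), (5, False)), ((4, True), (5, True))}"
  by (auto simp: link_graph_def tetrahedron_simps)

lemma tetrahedron_surface: "closed_oriented_surface tetrahedron"
  unfolding closed_oriented_surface_def
proof (intro conjI)
  show "delta_complex tetrahedron"
    by (auto simp: delta_complex_def tetrahedron_simps elim!: less_3_cases)
  show "triangles tetrahedron \<noteq> {}" by (simp add: tetrahedron_simps)
  show "\<forall>e\<in>edges tetrahedron. card (sides tetrahedron e) = 2"
    unfolding tetrahedron_simps by (simp add: tetrahedron_sides)
  show "\<forall>t\<in>triangles tetrahedron. orient tetrahedron t = 1 \<or> orient tetrahedron t = - 1"
    by (simp add: tetrahedron_simps)
  show "\<forall>e\<in>edges tetrahedron. (\<Sum>(t, i)\<in>sides tetrahedron e. (- 1) ^ i * orient tetrahedron t) = 0"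
    unfolding tetrahedron_simps(2) by (simp add: tetrahedron_sides tetrahedron_simps)
  have "v = w \<or> (v, w) \<in> edge_graph tetrahedron \<union> (edge_graph tetrahedron)\<inverse>"
    if "v \<in> vertices tetrahedron" "w \<in> vertices tetrahedron" for v w
    using that unfolding edge_graph_def tetrahedron_simps by auto
  then show "\<forall>v\<in>vertices tetrahedron. \<forall>w\<in>vertices tetrahedron.
    (v, w) \<in> (edge_graph tetrahedron \<union> (edge_graph tetrahedron)\<inverse>)\<^sup>*" by blast
  \<comment> \<open>Each link is a triangle, so two distinct edge ends at a vertex are already
    adjacent.\<close>
  have "p = q \<or> (p, q) \<in> link_graph tetrahedron \<union> (link_graph tetrahedron)\<inverse>"
    if "p \<in> edges tetrahedron \<times> UNIV" "q \<in> edges tetrahedron \<times> UNIV"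
      "edge_end tetrahedron p = edge_end tetrahedron q" for p q
  proof -
    obtain e b e' b' where pq: "p = (e, b)" "q = (e', b')" by (cases p; cases q)
    have "e \<in> {0, 1, 2, 3, 4, 5}" "e' \<in> {0, 1, 2, 3, 4, 5}" using that pq by (auto simp: tetrahedron_simps)
    then show ?thesis using that(3) unfolding pq tetrahedron_link edge_end_def
      by (cases b; cases b'; simp; elim disjE; simp add: tetrahedron_simps)
  qed
  then show "\<forall>p\<in>edges tetrahedron \<times> UNIV. \<forall>q\<in>edges tetrahedron \<times> UNIV.
     edge_end tetrahedron p = edge_end tetrahedron q \<longrightarrow>
     (p, q) \<in> (link_graph tetrahedron \<union> (link_graph tetrahedron)\<inverse>)\<^sup>*" by blast
qed

context symplectic_rep
begin

lemma act_injective: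
  assumes "g \<in> carrier G" "x \<in> V" "act g x = 0" shows "x = 0"
  using act_mult[OF inv_closed[OF assms(1)] assms(1), of x] assms act_one by simp

text \<open>The boundary of a tetrahedron is a sphere: every 1-cocycle on it is a coboundary, so the
  cup product is zero and its signature vanishes. The oriented sum of the Maslov indices of the four
  triangles is the coboundary of \<open>maslov\<close>.\<close>

theorem maslov_cocycle:
  assumes g: "g \<in> carrier G" and h: "h \<in> carrier G" and k: "k \<in> carrier G"
  shows "maslov h k - maslov (g \<otimes> h) k + maslov g (h \<otimes> k) - maslov g h = 0"
proof -
  define f where "f = (\<lambda>e\<in>edges tetrahedron. [g, g \<otimes> h, g \<otimes> h \<otimes> k, h, h \<otimes> k, k] ! e)"
  have fc: "f \<in> bar_maps tetrahedron G"
    using assms by (auto simp: bar_maps_def f_def tetrahedron_simps m_assoc)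
  interpret surface_rep G act V L \<omega> J tetrahedron f
    by unfold_locales (rule tetrahedron_surface, rule fc)
  have "cup \<phi> \<psi> = 0" if \<phi>: "\<phi> \<in> Z1" and \<psi>: "\<psi> \<in> Z1" for \<phi> \<psi>
  proof -
    have \<phi>V: "\<phi> e \<in> V" for e using \<phi> V_closed by (cases "e \<in> edges tetrahedron") (auto simp: Z1_def)
    \<comment> \<open>The potential that kills \<open>\<phi>\<close> on the three edges at vertex 0;
      edge \<open>v - 1\<close> joins vertex 0 to \<open>v\<close>.\<close>
    define s where "s = (\<lambda>v. if v = 0 then 0 else act (inv (f (v - 1))) (\<phi> (v - 1)))"
    define \<chi> where "\<chi> = \<phi> - d0 s"
    have "d0 s \<in> Z1" by (rule d0_Z1) (use \<phi>V in \<open>auto simp: s_def act_V V_closed\<close>)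
    then have \<chi>: "\<chi> \<in> Z1" unfolding \<chi>_def using \<phi> Z1_subspace real_vector.subspace_diff by blast
    have \<chi>V: "\<chi> e \<in> V" for e using \<chi> V_closed by (cases "e \<in> edges tetrahedron") (auto simp: Z1_def)
    have 0: "\<chi> e = 0" if "e \<in> {0, 1, 2}" for e
    proof -
      have e: "e \<in> edges tetrahedron" "source tetrahedron e = 0" "target tetrahedron e = Suc e"
        using that by (auto simp: tetrahedron_simps)
      note fe = f_carrier[OF e(1)]
      have "act (f e) (act (inv (f e)) (\<phi> e)) = \<phi> e"
        using act_mult[OF fe inv_closed[OF fe], of "\<phi> e"] fe act_one[OF \<phi>V] by simp
      then show ?thesis using e by (simp add: \<chi>_def d0_def s_def)
    qed
    have tri: "A t (\<chi> (e12 t)) - \<chi> (e02 t) + \<chi> (e01 t) = 0" if "t \<in> triangles tetrahedron" for t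
      using \<chi> that by (auto simp: Z1_def)
    have inj: "x = 0" if "t \<in> triangles tetrahedron" "A t x = 0" "x \<in> V" for x t
      using act_injective[OF f_face[OF that(1)] that(3,2)] by simp
    \<comment> \<open>The three triangles at vertex 0 pass the vanishing on to the opposite edges
      12, 13 and 23.\<close>
    have "A 0 (\<chi> 3) = 0" "A 1 (\<chi> 4) = 0" "A 2 (\<chi> 5) = 0"
      using tri[of 0] tri[of 1] tri[of 2] 0 by (simp_all add: tetrahedron_simps)
    then have "\<chi> 3 = 0" "\<chi> 4 = 0" "\<chi> 5 = 0"
      using inj[of 0, OF _ _ \<chi>V] inj[of 1, OF _ _ \<chi>V] inj[of 2, OF _ _ \<chi>V]
      by (simp_all add: tetrahedron_simps(3))
    then have "\<chi> e = 0" for e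
      using \<chi> 0 by (cases "e \<in> edges tetrahedron") (auto simp: Z1_def tetrahedron_simps)
    then have "\<phi> = d0 s" unfolding \<chi>_def fun_eq_iff by simp
    then show ?thesis using cup_d0[OF \<psi>] by simp
  qed
  then have "signature_on cup Z1 = 0"
    by (rule bilinear_form.signature_zero[OF cup_bilinear Z1_finite Z1_subspace])
  then have "(\<Sum>t\<in>{0, 1, 2, 3}. orient tetrahedron t * maslov (f (e01 t)) (f (e12 t))) = 0"
    unfolding signature_eq_sum_maslov tetrahedron_simps(3) .
  moreover have "f 0 = g" "f 1 = g \<otimes> h" "f 3 = h" "f 4 = h \<otimes> k" "f 5 = k"
    by (simp_all add: f_def tetrahedron_simps)
  ultimately show ?thesis by (simp add: tetrahedron_simps(6,7))
qed

end

section \<open>Signatures on quotients of subspaces\<close>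

text \<open>A bridge between two settings: \<open>H\<close> is a module given by a carrier set, as
  in the definition of the signature, while \<open>X\<close> is a subspace of a type, where inertia
  is available. The map \<open>\<pi>\<close> presents \<open>H\<close> as \<open>X\<close> modulo
  \<open>N\<close>.\<close>

locale quotient_presentation =
  fixes H :: "(real, 'w) module" and \<pi> :: "'v::real_vector \<Rightarrow> 'w" and X N :: "'v set"
  assumes X: "lsubspace X" "finite_dim X"
    and surj: "\<pi> ` X = carrier H"
    and add: "x \<in> X \<Longrightarrow> y \<in> X \<Longrightarrow> \<pi> x \<oplus>\<^bsub>H\<^esub> \<pi> y = \<pi> (x + y)"
    and smult: "x \<in> X \<Longrightarrow> r \<odot>\<^bsub>H\<^esub> \<pi> x = \<pi> (r *\<^sub>R x)"
    and zero: "\<zero>\<^bsub>H\<^esub> = \<pi> 0"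
    and ker: "x \<in> X \<Longrightarrow> \<pi> x = \<zero>\<^bsub>H\<^esub> \<longleftrightarrow> x \<in> N"
begin

lemmas X_closed = real_vector.subspace_0[OF X(1)] real_vector.subspace_add[OF X(1)]
  real_vector.subspace_diff[OF X(1)] real_vector.subspace_scale[OF X(1)] real_vector.subspace_neg[OF X(1)]

lemma vectorspace_H: "vectorspace class_ring H"
proof (rule vs_criteria)
  show "\<forall>v\<in>carrier H. \<exists>w\<in>carrier H. v \<oplus>\<^bsub>H\<^esub> w = \<zero>\<^bsub>H\<^esub>"
  proof
    fix v assume "v \<in> carrier H"
    then obtain x where "x \<in> X" "v = \<pi> x" using surj by blast
    then show "\<exists>w\<in>carrier H. v \<oplus>\<^bsub>H\<^esub> w = \<zero>\<^bsub>H\<^esub>"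
      using add[of x "- x"] X_closed(5)[of x] surj by (intro bexI[of _ "\<pi> (- x)"]) (auto simp: zero)
  qed
qed (auto simp: class_field surj[symmetric] add smult zero X_closed algebra_simps)

sublocale VH: vectorspace class_ring H by (rule vectorspace_H)

lemma subspace_image:
  assumes "lsubspace P" "P \<subseteq> X"
  shows "VectorSpace.subspace class_ring (\<pi> ` P) H"
  unfolding VectorSpace.subspace_def submodule_def
  using assms surj
  by (auto simp: vectorspace_H VH.module_axioms zero real_vector.subspace_0[OF assms(1)] add[OF subsetD[OF assms(2)] subsetD[OF assms(2)]]
      smult[OF subsetD[OF assms(2)]]
      intro!: imageI real_vector.subspace_add[OF assms(1)] real_vector.subspace_scale[OF assms(1)])

lemma dim_image:
  assumes P: "lsubspace P" "P \<subseteq> X" and inj: "\<And>x. x \<in> P \<Longrightarrow> x \<in> N \<Longrightarrow> x = 0"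
  shows "vectorspace.dim class_ring (H\<lparr>carrier := \<pi> ` P\<rparr>) = ldim P"
proof -
  let ?W = "H\<lparr>carrier := \<pi> ` P\<rparr>"
  interpret W: vectorspace class_ring ?W
    by (rule VH.subspace_is_vs[OF subspace_image[OF P]])
  have fP: "finite_dim P" using X P finite_dim_subset by blast
  obtain B where B: "finite B" "independent B" "P = lspan B" "card B = ldim P"
    using finite_dim_basis[OF fP P(1)] .
  note P_closed = real_vector.subspace_0[OF P(1)] real_vector.subspace_add[OF P(1)]
    real_vector.subspace_diff[OF P(1)] real_vector.subspace_scale[OF P(1)]
  have inj\<pi>: "inj_on \<pi> P"
  proof (rule inj_onI)
    fix x y assume xy: "x \<in> P" "y \<in> P" "\<pi> x = \<pi> y"
    have xX: "x \<in> X" "y \<in> X" using xy P by auto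
    then have xX: "x \<in> X" "y \<in> X" "- y \<in> X" "x - y \<in> X" using X_closed(3,5) by simp_all
    have "\<pi> (x - y) = \<pi> x \<oplus>\<^bsub>H\<^esub> \<pi> (- y)" using add[OF xX(1,3)] by simp
    also have "\<dots> = \<zero>\<^bsub>H\<^esub>" unfolding xy(3) add[OF xX(2,3)] zero by simp
    finally have "x - y \<in> N" using ker[OF xX(4)] by simp
    then show "x = y" using inj[of "x - y"] P_closed xy by simp
  qed
  have BP: "B \<subseteq> P" using B real_vector.span_superset by blast
  have lc: "W.lincomb a (\<pi> ` S) = \<pi> (\<Sum>b\<in>S. a (\<pi> b) *\<^sub>R b)" if "finite S" "S \<subseteq> B" for S a
    using that
  proof (induction S rule: finite_induct)
    case empty
    then show ?case by (simp add: W.lincomb_def zero)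
  next
    case (insert b S)
    have SP: "S \<subseteq> P" "b \<in> P" using insert BP by auto
    have nin: "\<pi> b \<notin> \<pi> ` S" using insert(2) SP inj\<pi> by (auto dest: inj_onD)
    have sumP: "(\<Sum>b\<in>S. a (\<pi> b) *\<^sub>R b) \<in> P"
      using SP by (intro real_vector.subspace_sum[OF P(1)] P_closed) auto
    have "W.lincomb a (\<pi> ` insert b S) = (a (\<pi> b) \<odot>\<^bsub>H\<^esub> \<pi> b) \<oplus>\<^bsub>H\<^esub> W.lincomb a (\<pi> ` S)"
      unfolding W.lincomb_def image_insert
      using insert(1) nin SP P_closed P
      by (subst W.finsum_insert) (auto simp: smult subset_iff)
    then show ?case using insert SP sumP P P_closed by (simp add: smult add subset_iff)
  qed
  have sub: "\<pi> ` B \<subseteq> carrier ?W" using BP by auto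
  have card: "card (\<pi> ` B) = ldim P" using inj_on_subset[OF inj\<pi> BP] B by (simp add: card_image)
  have "W.lin_indpt (\<pi> ` B)"
  proof (rule W.finite_lin_indpt2[OF _ sub])
    fix a assume "W.lincomb a (\<pi> ` B) = \<zero>\<^bsub>?W\<^esub>"
    then have "\<pi> (\<Sum>b\<in>B. a (\<pi> b) *\<^sub>R b) = \<pi> 0" using lc[OF B(1)] zero by simp
    moreover have "(\<Sum>b\<in>B. a (\<pi> b) *\<^sub>R b) \<in> P"
      using BP by (intro real_vector.subspace_sum[OF P(1)] P_closed) auto
    ultimately have "(\<Sum>b\<in>B. a (\<pi> b) *\<^sub>R b) = 0" using inj\<pi> P_closed(1) by (auto dest: inj_onD)
    then show "\<forall>v\<in>\<pi> ` B. a v = \<zero>\<^bsub>class_ring\<^esub>"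
      using independent_all_scalars[OF B(2) subset_refl B(1), of "\<lambda>b. a (\<pi> b)"] by simp
  qed (use B in simp)
  moreover have "W.gen_set (\<pi> ` B)"
  proof -
    have "\<pi> x \<in> W.span (\<pi> ` B)" if xP: "x \<in> P" for x
    proof -
      obtain c where c: "x = (\<Sum>b\<in>B. c b *\<^sub>R b)"
        using xP B(3) real_vector.span_finite[OF B(1)] by auto
      define a where "a = (\<lambda>w. c (inv_into B \<pi> w))"
      have "a (\<pi> b) = c b" if "b \<in> B" for b
        using inv_into_f_f[OF inj_on_subset[OF inj\<pi> BP] that] by (simp add: a_def)
      then have "W.lincomb a (\<pi> ` B) = \<pi> x" using lc[OF B(1) subset_refl, of a] c by simp
      then show ?thesis unfolding W.finite_span[OF finite_imageI[OF B(1)] sub]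
        by (intro CollectI exI[of _ a]) simp
    qed
    then show ?thesis using W.span_is_subset2[OF sub] by auto
  qed
  ultimately have "W.basis (\<pi> ` B)" unfolding W.basis_def using sub by blast
  then show ?thesis using W.dim_basis[OF finite_imageI[OF B(1)]] card by simp
qed

text \<open>A positive subspace \<open>W\<close> of \<open>H\<close> lifts: in its preimage take a
  maximal positive \<open>P\<close>. What is orthogonal to \<open>P\<close> there has nonpositive
  square, so its image in \<open>W\<close> is zero, and \<open>P\<close> maps isomorphically onto
  \<open>W\<close>.\<close>

lemma positive_index_eq:
  assumes Q: "bilinear_form Q" and q: "\<And>x y. x \<in> X \<Longrightarrow> y \<in> X \<Longrightarrow> q (\<pi> x) (\<pi> y) = Q x y"
    and sym: "\<And>x y. x \<in> X \<Longrightarrow> y \<in> X \<Longrightarrow> Q x y = Q y x" and pn: "inertia Q X p n"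
  shows "positive_index H q = p"
proof -
  interpret Q: bilinear_form Q by fact
  let ?D = "{vectorspace.dim class_ring (H\<lparr>carrier := W\<rparr>) | W.
    VectorSpace.subspace class_ring W H \<and> (\<forall>x\<in>W. x \<noteq> \<zero>\<^bsub>H\<^esub> \<longrightarrow> 0 < q x x)}"
  \<comment> \<open>\<open>\<pi>\<close> sends \<open>N\<close> to zero, so a positive vector in
    \<open>N\<close> would have the square of the zero vector.\<close>
  have triv: "x = 0" if "x \<in> P" "P \<subseteq> X" "pos_on Q P" "x \<in> N" for x P
  proof (rule ccontr)
    assume "x \<noteq> 0"
    then have "0 < q (\<pi> x) (\<pi> x)" using that q unfolding pos_on_def by auto
    moreover have "\<pi> x = \<pi> 0" using ker that zero by auto
    ultimately show False using q[of 0 0] X_closed(1) by simp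
  qed
  have le: "d \<le> p" if dD: "d \<in> ?D" for d
  proof -
    from dD obtain W where W: "d = vectorspace.dim class_ring (H\<lparr>carrier := W\<rparr>)"
      "VectorSpace.subspace class_ring W H" "\<And>x. x \<in> W \<Longrightarrow> x \<noteq> \<zero>\<^bsub>H\<^esub> \<Longrightarrow> 0 < q x x" by blast
    then have sm: "submodule class_ring W H" by (simp add: VectorSpace.subspace_def)
    define XW where "XW = {x \<in> X. \<pi> x \<in> W}"
    have XW: "lsubspace XW" "XW \<subseteq> X" unfolding XW_def real_vector.subspace_def
      using submodule.zero_closed[OF sm] submodule.m_closed[OF sm] submodule.smult_closed[OF sm]
      by (auto simp: X_closed zero add[symmetric] smult[symmetric])
    have fXW: "finite_dim XW" using X XW finite_dim_subset by blast
    have symW: "Q x y = Q y x" if "x \<in> XW" "y \<in> XW" for x y using sym that XW by blast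
    obtain P where P: "lsubspace P" "P \<subseteq> XW" "pos_on Q P"
      "\<And>y. y \<in> XW \<Longrightarrow> (\<And>u. u \<in> P \<Longrightarrow> Q u y = 0) \<Longrightarrow> Q y y \<le> 0"
      using Q.maximal_pos_subspace[OF fXW XW(1) symW] by metis
    have PX: "P \<subseteq> X" using P XW by blast
    have "W = \<pi> ` P"
    proof (intro subset_antisym subsetI)
      fix w assume w: "w \<in> W"
      then obtain x where x: "x \<in> X" "w = \<pi> x" using surj submodule.subset[OF sm] by blast
      then have xW: "x \<in> XW" using w by (simp add: XW_def)
      obtain a z where a: "a \<in> P" "z \<in> XW" "x = a + z" "\<And>u. u \<in> P \<Longrightarrow> Q u z = 0"
        using Q.pos_on_projection[OF fXW XW(1) symW P(1-3) xW] by metis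
      then have "Q z z \<le> 0" using P(4) by blast
      then have "\<pi> z = \<zero>\<^bsub>H\<^esub>" using W(3)[of "\<pi> z"] q[of z z] a(2) by (force simp: XW_def)
      then have "\<pi> x = \<pi> a"
        using add[of a z] add[of a 0] a PX XW X_closed(1) unfolding zero by (auto simp: subset_iff)
      then show "w \<in> \<pi> ` P" using a x by blast
    qed (use P in \<open>auto simp: XW_def\<close>)
    then have "d = ldim P" using W(1) dim_image[OF P(1) PX triv[OF _ PX P(3)]] by simp
    then show ?thesis using Q.pos_dim_le[OF X(2,1) pn P(1) PX P(3)] by simp
  qed
  obtain P where P: "lsubspace P" "P \<subseteq> X" "pos_on Q P" "ldim P = p" using pn unfolding inertia_def by blast
  have "p \<in> ?D"
  proof (intro CollectI exI[of _ "\<pi> ` P"] conjI ballI impI)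
    show "p = vectorspace.dim class_ring (H\<lparr>carrier := \<pi> ` P\<rparr>)"
      using dim_image[OF P(1,2) triv[OF _ P(2,3)]] P(4) by simp
    show "VectorSpace.subspace class_ring (\<pi> ` P) H" by (rule subspace_image[OF P(1,2)])
    fix x assume "x \<in> \<pi> ` P" "x \<noteq> \<zero>\<^bsub>H\<^esub>"
    then obtain y where y: "y \<in> P" "x = \<pi> y" "y \<noteq> 0" using zero by auto
    then show "0 < q x x" using P q unfolding pos_on_def by auto
  qed
  then show ?thesis unfolding positive_index_def using le
    by (intro Max_eqI finite_subset[of ?D "{..p}"]) auto
qed

theorem form_signature_eq:
  assumes Q: "bilinear_form Q" and q: "\<And>x y. x \<in> X \<Longrightarrow> y \<in> X \<Longrightarrow> q (\<pi> x) (\<pi> y) = Q x y"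
    and sym: "\<And>x y. x \<in> X \<Longrightarrow> y \<in> X \<Longrightarrow> Q x y = Q y x"
  shows "form_signature H q = signature_on Q X"
proof -
  interpret Q: bilinear_form Q by fact
  obtain p n where pn: "inertia Q X p n" using Q.inertia_exists[OF X(2,1) sym] by blast
  have "positive_index H (\<lambda>x y. - q x y) = n"
    by (rule positive_index_eq[OF Q.bilinear_form_uminus _ _ Q.inertia_uminus[OF pn]])
       (use q sym in auto)
  then show ?thesis
    using positive_index_eq[OF Q q sym pn] Q.signature_eq[OF X(2,1) pn] by (simp add: form_signature_def)
qed

end

section \<open>The integral symplectic group\<close>

text \<open>The type \<open>real vec\<close> mixes all lengths and is not itself a vector space.
  Vectors of length \<open>2 * h\<close> are therefore replaced by functions that vanish from index
  \<open>2 * h\<close> on; the zero branch keeps the images among them.\<close>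

definition sp_act :: "nat \<Rightarrow> int mat \<Rightarrow> (nat \<Rightarrow> real) \<Rightarrow> nat \<Rightarrow> real" where
  "sp_act h A x = (\<lambda>i. if i < 2 * h then \<Sum>j<2 * h. of_int (A $$ (i, j)) * x j else 0)"

definition sp_V :: "nat \<Rightarrow> (nat \<Rightarrow> real) set" where
  "sp_V h = {x. \<forall>i\<ge>2 * h. x i = 0}"

definition sp_L :: "nat \<Rightarrow> (nat \<Rightarrow> real) set" where
  "sp_L h = {x. \<forall>i\<ge>h. x i = 0}"

definition sp_form :: "nat \<Rightarrow> (nat \<Rightarrow> real) \<Rightarrow> (nat \<Rightarrow> real) \<Rightarrow> real" where
  "sp_form h x y = (\<Sum>i<h. x i * y (h + i) - x (h + i) * y i)"

text \<open>The standard complex structure, with the sign that makes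
  \<open>sp_form h (sp_J h x) x\<close> the sum of the squares of the coordinates.\<close>

definition sp_J :: "nat \<Rightarrow> (nat \<Rightarrow> real) \<Rightarrow> nat \<Rightarrow> real" where
  "sp_J h x = (\<lambda>i. if i < h then x (h + i) else if i < 2 * h then - x (i - h) else 0)"

lemma sp_form_bilinear: "bilinear_form (sp_form h)"
proof
  fix x y z :: "nat \<Rightarrow> real" and r :: real
  show "sp_form h (x + y) z = sp_form h x z + sp_form h y z"
    unfolding sp_form_def sum.distrib[symmetric] by (intro sum.cong refl) (simp add: algebra_simps)
  show "sp_form h x (y + z) = sp_form h x y + sp_form h x z"
    unfolding sp_form_def sum.distrib[symmetric] by (intro sum.cong refl) (simp add: algebra_simps)
  show "sp_form h (r *\<^sub>R x) z = r * sp_form h x z"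
    unfolding sp_form_def sum_distrib_left by (intro sum.cong refl) (simp add: algebra_simps)
  show "sp_form h x (r *\<^sub>R z) = r * sp_form h x z"
    unfolding sp_form_def sum_distrib_left by (intro sum.cong refl) (simp add: algebra_simps)
qed

lemma sp_act_one: "i < 2 * h \<Longrightarrow> sp_act h (1\<^sub>m (2 * h)) x i = x i"
proof -
  assume i: "i < 2 * h"
  have "sp_act h (1\<^sub>m (2 * h)) x i = (\<Sum>j<2 * h. if j = i then x j else 0)"
    unfolding sp_act_def if_P[OF i] by (rule sum.cong[OF refl]) (use i in simp)
  then show ?thesis using i by simp
qed

lemma sp_form_J: "sp_form h (sp_J h x) y = (\<Sum>i<h. x i * y i) + (\<Sum>i<h. x (h + i) * y (h + i))"
  unfolding sp_form_def sum.distrib[symmetric] by (intro sum.cong refl) (simp add: sp_J_def)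

lemma Sp_Z_carrier:
  "A \<in> carrier (Sp_Z h) \<longleftrightarrow> A \<in> carrier_mat (2 * h) (2 * h) \<and>
    (\<exists>B\<in>carrier_mat (2 * h) (2 * h). A * B = 1\<^sub>m (2 * h) \<and> B * A = 1\<^sub>m (2 * h)) \<and>
    (\<forall>x\<in>carrier_vec (2 * h). \<forall>y\<in>carrier_vec (2 * h).
          symp_form h (A *\<^sub>v x) (A *\<^sub>v y) = symp_form h x y)"
proof -
  have "invertible_mat A \<longleftrightarrow> (\<exists>B\<in>carrier_mat (2 * h) (2 * h). A * B = 1\<^sub>m (2 * h) \<and> B * A = 1\<^sub>m (2 * h))"
    if A: "A \<in> carrier_mat (2 * h) (2 * h)"
  proof
    assume "invertible_mat A"
    then obtain B where B: "A * B = 1\<^sub>m (2 * h)" "B * A = 1\<^sub>m (dim_row B)"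
      using A by (auto simp: invertible_mat_def inverts_mat_def)
    have "dim_col B = 2 * h" using arg_cong[OF B(1), of dim_col] by simp
    moreover have "dim_row B = 2 * h" using arg_cong[OF B(2), of dim_col] A by simp
    ultimately show "\<exists>B\<in>carrier_mat (2 * h) (2 * h). A * B = 1\<^sub>m (2 * h) \<and> B * A = 1\<^sub>m (2 * h)"
      using B by auto
  qed (use A in \<open>auto simp: invertible_mat_def inverts_mat_def\<close>)
  then show ?thesis by (auto simp: Sp_Z_def)
qed

lemma Sp_Z_ops [simp]: "x \<otimes>\<^bsub>Sp_Z h\<^esub> y = x * y" "\<one>\<^bsub>Sp_Z h\<^esub> = 1\<^sub>m (2 * h)"
  by (simp_all add: Sp_Z_def)

lemma Sp_Z_mat: "A \<in> carrier (Sp_Z h) \<Longrightarrow> A \<in> carrier_mat (2 * h) (2 * h)"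
  by (simp add: Sp_Z_def)

lemma Sp_Z_group: "group (Sp_Z h)"
proof (rule groupI)
  let ?n = "2 * h"
  show "\<one>\<^bsub>Sp_Z h\<^esub> \<in> carrier (Sp_Z h)"
    unfolding Sp_Z_carrier by (auto intro!: bexI[of _ "1\<^sub>m (2 * h)"])
  fix A B assume A: "A \<in> carrier (Sp_Z h)"
  then obtain A' where A': "A' \<in> carrier_mat ?n ?n" "A * A' = 1\<^sub>m ?n" "A' * A = 1\<^sub>m ?n"
    and Am: "A \<in> carrier_mat ?n ?n" and Af: "\<And>x y. x \<in> carrier_vec ?n \<Longrightarrow> y \<in> carrier_vec ?n \<Longrightarrow>
          symp_form h (A *\<^sub>v x) (A *\<^sub>v y) = symp_form h x y"
    unfolding Sp_Z_carrier by blast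
  show "\<one>\<^bsub>Sp_Z h\<^esub> \<otimes>\<^bsub>Sp_Z h\<^esub> A = A" using Am by simp
  have "A' \<in> carrier (Sp_Z h)"
    unfolding Sp_Z_carrier
  proof (intro conjI ballI)
    fix x y :: "int vec" assume xy: "x \<in> carrier_vec ?n" "y \<in> carrier_vec ?n"
    have "A *\<^sub>v (A' *\<^sub>v v) = v" if "v \<in> carrier_vec ?n" for v
      using assoc_mult_mat_vec[OF Am A'(1) that] A'(2) that by simp
    then show "symp_form h (A' *\<^sub>v x) (A' *\<^sub>v y) = symp_form h x y"
      using Af[of "A' *\<^sub>v x" "A' *\<^sub>v y"] xy A'(1) by simp
  qed (use A' Am in auto)
  then show "\<exists>y\<in>carrier (Sp_Z h). y \<otimes>\<^bsub>Sp_Z h\<^esub> A = \<one>\<^bsub>Sp_Z h\<^esub>" using A' by auto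
  assume B: "B \<in> carrier (Sp_Z h)"
  then obtain B' where B': "B' \<in> carrier_mat ?n ?n" "B * B' = 1\<^sub>m ?n" "B' * B = 1\<^sub>m ?n"
    and Bm: "B \<in> carrier_mat ?n ?n" and Bf: "\<And>x y. x \<in> carrier_vec ?n \<Longrightarrow> y \<in> carrier_vec ?n \<Longrightarrow>
          symp_form h (B *\<^sub>v x) (B *\<^sub>v y) = symp_form h x y"
    unfolding Sp_Z_carrier by blast
  have 1: "A * B * (B' * A') = 1\<^sub>m ?n"
  proof -
    have "A * B * (B' * A') = A * (B * (B' * A'))" using Am Bm A' B' by (simp add: assoc_mult_mat[of _ ?n ?n _ ?n _ ?n])
    also have "B * (B' * A') = A'" using Bm A' B' by (simp add: assoc_mult_mat[of _ ?n ?n _ ?n _ ?n, symmetric])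
    finally show ?thesis using A' by simp
  qed
  have 2: "B' * A' * (A * B) = 1\<^sub>m ?n"
  proof -
    have "B' * A' * (A * B) = B' * (A' * (A * B))" using Am Bm A' B' by (simp add: assoc_mult_mat[of _ ?n ?n _ ?n _ ?n])
    also have "A' * (A * B) = B" using Am Bm A' by (simp add: assoc_mult_mat[of _ ?n ?n _ ?n _ ?n, symmetric])
    finally show ?thesis using B' by simp
  qed
  have "symp_form h (A * B *\<^sub>v x) (A * B *\<^sub>v y) = symp_form h x y"
    if "x \<in> carrier_vec ?n" "y \<in> carrier_vec ?n" for x y
    using that Af Bf Am Bm by (simp add: assoc_mult_mat_vec[OF Am Bm])
  then show "A \<otimes>\<^bsub>Sp_Z h\<^esub> B \<in> carrier (Sp_Z h)"
    unfolding Sp_Z_carrier Sp_Z_ops using 1 2 mult_carrier_mat[OF Am Bm] mult_carrier_mat[OF B'(1) A'(1)]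
    by blast
  fix C assume "C \<in> carrier (Sp_Z h)"
  then show "A \<otimes>\<^bsub>Sp_Z h\<^esub> B \<otimes>\<^bsub>Sp_Z h\<^esub> C = A \<otimes>\<^bsub>Sp_Z h\<^esub> (B \<otimes>\<^bsub>Sp_Z h\<^esub> C)"
    using Am Bm by (simp add: assoc_mult_mat[of _ ?n ?n _ ?n _ ?n] Sp_Z_mat)
qed

text \<open>The group condition concerns integral vectors only. For real vectors the form of two
  images expands into its values on pairs of columns, and these agree with its values on unit
  vectors for every group element; so the result is the same for \<open>A\<close> and for the
  identity matrix.\<close>

lemma sp_form_act:
  assumes A: "A \<in> carrier (Sp_Z h)"
  shows "sp_form h (sp_act h A x) (sp_act h A y) = sp_form h x y"
proof -
  interpret bilinear_form "sp_form h" by (rule sp_form_bilinear)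
  let ?n = "2 * h"
  define c where "c = (\<lambda>(M :: int mat) j (i::nat). if i < ?n then real_of_int (M $$ (i, j)) else 0)"
  have act: "sp_act h M x = (\<Sum>j<?n. x j *\<^sub>R c M j)" for M x
    by (auto simp: fun_eq_iff sp_act_def c_def sum_fun_apply algebra_simps)
  have cc: "sp_form h (c M j) (c M k) = of_int (symp_form h (unit_vec ?n j) (unit_vec ?n k))"
    if M: "M \<in> carrier (Sp_Z h)" and "j < ?n" "k < ?n" for M j k
  proof -
    have Mm: "M \<in> carrier_mat ?n ?n" using M by (rule Sp_Z_mat)
    have "sp_form h (c M j) (c M k) = of_int (symp_form h (col M j) (col M k))"
      unfolding sp_form_def symp_form_def c_def using that Mm by simp
    also have "\<dots> = of_int (symp_form h (M *\<^sub>v unit_vec ?n j) (M *\<^sub>v unit_vec ?n k))"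
    proof -
      have "col M j = M *\<^sub>v unit_vec ?n j" "col M k = M *\<^sub>v unit_vec ?n k"
        using Mm that by (auto intro!: eq_vecI)
      then show ?thesis by simp
    qed
    finally show ?thesis using M unfolding Sp_Z_carrier by simp
  qed
  have eq: "sp_form h (sp_act h M x) (sp_act h M y) =
      (\<Sum>j<?n. \<Sum>k<?n. y j * (x k * of_int (symp_form h (unit_vec ?n k) (unit_vec ?n j))))"
    if "M \<in> carrier (Sp_Z h)" for M
    unfolding act sum_left sum_right scale_left scale_right sum_distrib_left
    using cc[OF that] by (intro sum.cong refl) simp
  have 1: "\<one>\<^bsub>Sp_Z h\<^esub> \<in> carrier (Sp_Z h)"
    using Sp_Z_group by (simp only: group.is_monoid monoid.one_closed)
  have "sp_act h \<one>\<^bsub>Sp_Z h\<^esub> u i = u i" if "i < ?n" for u i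
    using that by (simp add: sp_act_one)
  then have "sp_form h (sp_act h \<one>\<^bsub>Sp_Z h\<^esub> x) (sp_act h \<one>\<^bsub>Sp_Z h\<^esub> y) = sp_form h x y"
    unfolding sp_form_def by simp
  then show ?thesis using eq[OF A] eq[OF 1] by metis
qed

lemma sp_V_finite: "finite_dim (sp_V h)"
proof -
  define e where "e = (\<lambda>i (j::nat). if j = i then 1 else 0 :: real)"
  have "x \<in> lspan (e ` {..<2 * h})" if "x \<in> sp_V h" for x
  proof -
    have "x = (\<Sum>i<2 * h. x i *\<^sub>R e i)"
      using that by (auto simp: fun_eq_iff e_def sum_fun_apply sp_V_def if_distrib[of "\<lambda>a. _ * a"] cong: if_cong)
    also have "\<dots> \<in> lspan (e ` {..<2 * h})"
      by (intro real_vector.span_sum real_vector.span_scale real_vector.span_base) auto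
    finally show ?thesis .
  qed
  then show ?thesis unfolding finite_dim_def by (intro exI[of _ "e ` {..<2 * h}"]) auto
qed

lemma sp_L_dim: "ldim (sp_L h) = h"
proof -
  define e where "e = (\<lambda>i (j::nat). if j = i then 1 else 0 :: real)"
  have inj: "inj e" by (rule injI) (metis e_def one_neq_zero)
  have sum: "(\<Sum>i<h. u i *\<^sub>R e i) = (\<lambda>j. if j < h then u j else 0)" for u
    by (auto simp: fun_eq_iff e_def sum_fun_apply if_distrib[of "\<lambda>a. _ * a"] cong: if_cong)
  have eL: "e ` {..<h} \<subseteq> sp_L h" by (auto simp: e_def sp_L_def)
  have "sp_L h \<subseteq> lspan (e ` {..<h})"
  proof
    fix x assume "x \<in> sp_L h"
    then have "x = (\<Sum>i<h. x i *\<^sub>R e i)" unfolding sum by (auto simp: fun_eq_iff sp_L_def)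
    also have "\<dots> \<in> lspan (e ` {..<h})"
      by (intro real_vector.span_sum real_vector.span_scale real_vector.span_base) auto
    finally show "x \<in> lspan (e ` {..<h})" .
  qed
  moreover have "independent (e ` {..<h})"
  proof (rule real_vector.independent_if_scalars_zero)
    fix c v assume c: "(\<Sum>v\<in>e ` {..<h}. c v *\<^sub>R v) = 0" and v: "v \<in> e ` {..<h}"
    then obtain i where i: "i < h" "v = e i" by blast
    have "(\<Sum>i<h. c (e i) *\<^sub>R e i) = 0"
      using c by (subst (asm) sum.reindex) (use inj in \<open>auto simp: inj_on_def inj_def\<close>)
    from fun_cong[OF this[unfolded sum], of i] show "c v = 0" using i by simp
  qed simp
  ultimately show ?thesis
    using real_vector.dim_unique[OF eL] card_image[of e "{..<h}"] inj by (simp add: inj_on_def inj_def)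
qed

lemma symplectic_rep_Sp: "symplectic_rep (Sp_Z h) (sp_act h) (sp_V h) (sp_L h) (sp_form h) (sp_J h)"
proof -
  interpret group "Sp_Z h" by (rule Sp_Z_group)
  show ?thesis
  proof (rule symplectic_rep.intro, rule Sp_Z_group, rule symplectic_rep_axioms.intro)
    show "linear (sp_act h g)" for g
      by (rule linearI) (auto simp: sp_act_def fun_eq_iff sum.distrib sum_distrib_left algebra_simps)
    show "sp_act h (g \<otimes>\<^bsub>Sp_Z h\<^esub> k) x = sp_act h g (sp_act h k x)"
      if "g \<in> carrier (Sp_Z h)" "k \<in> carrier (Sp_Z h)" for g k x
    proof
      fix i
      have gk: "g \<in> carrier_mat (2 * h) (2 * h)" "k \<in> carrier_mat (2 * h) (2 * h)" using that Sp_Z_mat by auto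
      show "sp_act h (g \<otimes>\<^bsub>Sp_Z h\<^esub> k) x i = sp_act h g (sp_act h k x) i"
      proof (cases "i < 2 * h")
        case True
        have "sp_act h (g \<otimes>\<^bsub>Sp_Z h\<^esub> k) x i = (\<Sum>j<2 * h. (\<Sum>l<2 * h. real_of_int (g $$ (i, l)) * real_of_int (k $$ (l, j))) * x j)"
          using gk True by (auto simp: sp_act_def scalar_prod_def atLeast0LessThan intro!: sum.cong)
        also have "\<dots> = (\<Sum>l<2 * h. \<Sum>j<2 * h. real_of_int (g $$ (i, l)) * real_of_int (k $$ (l, j)) * x j)"
          unfolding sum_distrib_right by (rule sum.swap)
        also have "\<dots> = sp_act h g (sp_act h k x) i"
          using True by (simp add: sp_act_def sum_distrib_left mult.assoc)
        finally show ?thesis .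
      qed (simp add: sp_act_def)
    qed
    show "sp_act h \<one>\<^bsub>Sp_Z h\<^esub> x = x" if "x \<in> sp_V h" for x
    proof
      fix i show "sp_act h \<one>\<^bsub>Sp_Z h\<^esub> x i = x i"
        using that sp_act_one by (cases "i < 2 * h") (auto simp: sp_act_def sp_V_def)
    qed
    show "sp_act h g x \<in> sp_V h" for g x by (simp add: sp_act_def sp_V_def)
    show "bilinear_form (sp_form h)" by (rule sp_form_bilinear)
    show "sp_form h x x = 0" for x by (simp add: sp_form_def mult.commute)
    show "sp_form h (sp_act h g x) (sp_act h g y) = sp_form h x y" if "g \<in> carrier (Sp_Z h)" for g x y
      by (rule sp_form_act[OF that])
    show "finite_dim (sp_V h)" by (rule sp_V_finite)
    show "lsubspace (sp_V h)" "lsubspace (sp_L h)" by (auto simp: real_vector.subspace_def sp_V_def sp_L_def)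
    show "sp_L h \<subseteq> sp_V h" by (auto simp: sp_V_def sp_L_def)
    show "sp_form h x y = 0" if "x \<in> sp_L h" "y \<in> sp_L h" for x y using that by (simp add: sp_form_def sp_L_def)
    show "x \<in> sp_L h" if "x \<in> sp_V h" "\<And>y. y \<in> sp_L h \<Longrightarrow> sp_form h x y = 0" for x
    proof -
      have "x (h + i) = 0" if i: "i < h" for i
      proof -
        define y where "y = (\<lambda>j. if j = i then 1 else 0 :: real)"
        have "y \<in> sp_L h" using i by (simp add: y_def sp_L_def)
        then have "sp_form h x y = 0" by fact
        moreover have "sp_form h x y = (\<Sum>j<h. if j = i then - x (h + i) else 0)"
          unfolding sp_form_def using i by (intro sum.cong refl) (auto simp: y_def)
        ultimately show ?thesis using i by simp
      qed
      then have "x j = 0" if "j \<ge> h" for j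
        using that \<open>x \<in> sp_V h\<close> le_Suc_ex[OF that] by (cases "j < 2 * h") (auto simp: sp_V_def)
      then show ?thesis by (simp add: sp_L_def)
    qed
    show "linear (sp_J h)" by (rule linearI) (auto simp: sp_J_def fun_eq_iff)
    show "sp_J h x \<in> sp_V h" for x by (simp add: sp_J_def sp_V_def)
    show "sp_form h (sp_J h x) y = sp_form h (sp_J h y) x" for x y by (simp add: sp_form_J mult.commute)
    show "0 < sp_form h (sp_J h x) x" if "x \<in> sp_V h" "x \<noteq> 0" for x
    proof -
      obtain i where i: "x i \<noteq> 0" using \<open>x \<noteq> 0\<close> by (auto simp: fun_eq_iff)
      have "i < 2 * h"
      proof (rule ccontr)
        assume "\<not> i < 2 * h"
        then show False using \<open>x \<in> sp_V h\<close> i by (simp add: sp_V_def)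
      qed
      have nn: "0 \<le> (\<Sum>i<h. x i * x i)" "0 \<le> (\<Sum>i<h. x (h + i) * x (h + i))" by (auto intro: sum_nonneg)
      show ?thesis
      proof (cases "i < h")
        case True
        have "0 < x i * x i" using i by (simp add: zero_less_mult_iff linorder_neq_iff) argo
        also have "\<dots> \<le> (\<Sum>i<h. x i * x i)" by (rule member_le_sum[of i]) (use True in auto)
        finally show ?thesis using nn by (simp add: sp_form_J)
      next
        case False
        then have k: "i - h < h" "h + (i - h) = i" using \<open>i < 2 * h\<close> by auto
        have "0 < x i * x i" using i by (simp add: zero_less_mult_iff linorder_neq_iff) argo
        also have "\<dots> \<le> (\<Sum>i<h. x (h + i) * x (h + i))"
          using member_le_sum[of "i - h" "{..<h}" "\<lambda>i. x (h + i) * x (h + i)"] k by auto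
        finally show ?thesis using nn by (simp add: sp_form_J)
      qed
    qed
  qed
qed

definition sp_maslov :: "nat \<Rightarrow> int mat \<Rightarrow> int mat \<Rightarrow> int" where
  "sp_maslov h = symplectic_rep.maslov (Sp_Z h) (sp_act h) (sp_L h) (sp_form h)"

text \<open>Cochains with values in \<open>real vec\<close> correspond to functions with values in \<open>sp_V h\<close>.\<close>

definition to_cochain :: "nat \<Rightarrow> nat set \<Rightarrow> (nat \<Rightarrow> nat \<Rightarrow> real) \<Rightarrow> nat \<Rightarrow> real vec" where
  "to_cochain h S x = (\<lambda>s\<in>S. vec (2 * h) (x s))"

lemma to_cochain_surj:
  assumes "\<phi> \<in> carrier (vec_cochains (2 * h) S)"
  obtains x where "\<And>s. x s \<in> sp_V h" "\<And>s. s \<notin> S \<Longrightarrow> x s = 0" "\<phi> = to_cochain h S x"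
proof (rule that)
  define x where "x = (\<lambda>s i. if s \<in> S \<and> i < 2 * h then \<phi> s $ i else 0)"
  show "x s \<in> sp_V h" for s by (simp add: x_def sp_V_def)
  show "x s = 0" if "s \<notin> S" for s using that by (simp add: x_def fun_eq_iff)
  show "\<phi> = to_cochain h S x"
    using assms by (auto simp: to_cochain_def vec_cochains_def x_def fun_eq_iff PiE_def extensional_def Pi_def)
qed

lemma vec_eq_iff_sp_V:
  assumes "x \<in> sp_V h" "y \<in> sp_V h"
  shows "vec (2 * h) x = vec (2 * h) y \<longleftrightarrow> x = y"
proof
  assume v: "vec (2 * h) x = vec (2 * h) y"
  show "x = y"
  proof
    fix i show "x i = y i"
      using assms arg_cong[OF v, of "\<lambda>v. v $ i"] by (cases "i < 2 * h") (auto simp: sp_V_def)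
  qed
qed simp

lemma to_cochain_inj:
  assumes "\<And>s. s \<in> S \<Longrightarrow> x s \<in> sp_V h" "\<And>s. s \<in> S \<Longrightarrow> y s \<in> sp_V h"
    and "\<And>s. s \<notin> S \<Longrightarrow> x s = 0" "\<And>s. s \<notin> S \<Longrightarrow> y s = 0" and eq: "to_cochain h S x = to_cochain h S y"
  shows "x = y"
proof
  fix s show "x s = y s"
    using assms(1-4) fun_cong[OF eq, of s] vec_eq_iff_sp_V[of "x s" h "y s"]
    by (cases "s \<in> S") (auto simp: to_cochain_def)
qed

locale sp_surface =
  fixes h :: nat and K :: surface and f :: "nat \<Rightarrow> int mat"
  assumes surface: "closed_oriented_surface K" and bar_map: "f \<in> bar_maps K (Sp_Z h)"
begin

sublocale surface_rep "Sp_Z h" "sp_act h" "sp_V h" "sp_L h" "sp_form h" "sp_J h" K f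
  by (intro surface_rep.intro surface_rep_axioms.intro symplectic_rep_Sp surface bar_map)

abbreviation "dec \<equiv> to_cochain h (edges K)"

lemma transport_vec:
  assumes "e \<in> edges K"
  shows "transport f e (vec (2 * h) x) = vec (2 * h) (sp_act h (f e) x)"
proof -
  have "f e \<in> carrier_mat (2 * h) (2 * h)" using f_carrier[OF assms] by (rule Sp_Z_mat)
  then show ?thesis
    by (intro eq_vecI) (auto simp: transport_def sp_act_def scalar_prod_def atLeast0LessThan intro!: sum.cong)
qed

lemma local_delta1_dec:
  "local_delta1 K f (dec x) =
    to_cochain h (triangles K) (\<lambda>t. A t (x (e12 t)) - x (e02 t) + x (e01 t))"
proof
  fix t
  show "local_delta1 K f (dec x) t = to_cochain h (triangles K) (\<lambda>t. A t (x (e12 t)) - x (e02 t) + x (e01 t)) t"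
  proof (cases "t \<in> triangles K")
    case True
    have "face K i t \<in> edges K" if "i < 3" for i using surface_ends(2)[OF K True that] .
    then show ?thesis using True
      by (intro eq_vecI) (auto simp: local_delta1_def to_cochain_def transport_vec)
  qed (simp add: local_delta1_def to_cochain_def)
qed

lemma local_Z1_eq: "local_Z1 h K f = dec ` Z1"
proof -
  have z: "\<zero>\<^bsub>vec_cochains (2 * h) (triangles K)\<^esub> = to_cochain h (triangles K) 0"
    by (auto simp: vec_cochains_def to_cochain_def intro!: restrict_ext eq_vecI)
  have iff: "local_delta1 K f (dec x) = \<zero>\<^bsub>vec_cochains (2 * h) (triangles K)\<^esub> \<longleftrightarrow>
    (\<forall>t\<in>triangles K. A t (x (e12 t)) - x (e02 t) + x (e01 t) = 0)" if x: "\<And>e. x e \<in> sp_V h" for x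
  proof -
    define w where "w = (\<lambda>t. A t (x (e12 t)) - x (e02 t) + x (e01 t))"
    have wV: "w t \<in> sp_V h" for t unfolding w_def using x act_V V_closed by simp
    have "to_cochain h (triangles K) w = to_cochain h (triangles K) 0 \<longleftrightarrow> (\<forall>t\<in>triangles K. w t = 0)"
    proof
      assume eq: "to_cochain h (triangles K) w = to_cochain h (triangles K) 0"
      show "\<forall>t\<in>triangles K. w t = 0"
      proof
        fix t assume "t \<in> triangles K"
        then show "w t = 0" using fun_cong[OF eq, of t] vec_eq_iff_sp_V[OF wV V_closed(1), of t]
          by (simp add: to_cochain_def)
      qed
    qed (auto simp: to_cochain_def fun_eq_iff)
    then show ?thesis unfolding local_delta1_dec z w_def .
  qed
  have dc: "dec x \<in> carrier (vec_cochains (2 * h) (edges K))" for x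
    by (auto simp: vec_cochains_def to_cochain_def)
  show ?thesis
  proof (intro subset_antisym subsetI)
    fix \<phi> assume \<phi>: "\<phi> \<in> local_Z1 h K f"
    then obtain x where x: "\<And>s. x s \<in> sp_V h" "\<And>s. s \<notin> edges K \<Longrightarrow> x s = 0" "\<phi> = dec x"
      using to_cochain_surj[of \<phi> h "edges K"] unfolding local_Z1_def by blast
    then have "x \<in> Z1" using \<phi> iff[of x] unfolding Z1_def local_Z1_def by simp
    then show "\<phi> \<in> dec ` Z1" using x by blast
  next
    fix \<phi> assume "\<phi> \<in> dec ` Z1"
    then obtain x where x: "x \<in> Z1" "\<phi> = dec x" by blast
    have "x e \<in> sp_V h" for e using x V_closed(1) by (cases "e \<in> edges K") (auto simp: Z1_def)
    then show "\<phi> \<in> local_Z1 h K f" using x iff[of x] dc unfolding local_Z1_def Z1_def by simp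
  qed
qed

definition B1 :: "(nat \<Rightarrow> nat \<Rightarrow> real) set" where
  "B1 = d0 ` {s. \<forall>v. s v \<in> sp_V h}"

lemma B1_Z1: "B1 \<subseteq> Z1" unfolding B1_def using d0_Z1 by auto

lemma B1_subspace: "lsubspace B1"
  unfolding B1_def
proof (rule linear_image_subspace)
  show "linear d0" by (rule linearI) (auto simp: d0_def fun_eq_iff act_add act_scale algebra_simps)
  show "lsubspace {s. \<forall>v. s v \<in> sp_V h}" unfolding real_vector.subspace_def by (auto simp: V_closed)
qed

lemma cup_B1: "b \<in> B1 \<Longrightarrow> x \<in> Z1 \<Longrightarrow> cup b x = 0"
  unfolding B1_def using cup_d0 by auto

lemma local_B1_eq: "local_B1 h K f = dec ` B1"
proof -
  have d: "local_delta0 K f (to_cochain h (vertices K) s) = dec (d0 s)" for s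
  proof
    fix e show "local_delta0 K f (to_cochain h (vertices K) s) e = dec (d0 s) e"
    proof (cases "e \<in> edges K")
      case True
      then have "source K e \<in> vertices K" "target K e \<in> vertices K"
        using K by (auto simp: closed_oriented_surface_def delta_complex_def)
      then show ?thesis using True
        by (intro eq_vecI) (auto simp: local_delta0_def to_cochain_def transport_vec d0_def)
    qed (simp add: local_delta0_def to_cochain_def)
  qed
  have dc: "to_cochain h S x \<in> carrier (vec_cochains (2 * h) S)" for S x
    by (auto simp: vec_cochains_def to_cochain_def)
  show ?thesis
  proof (intro subset_antisym subsetI)
    fix \<phi> assume "\<phi> \<in> local_B1 h K f"
    then obtain s where s: "s \<in> carrier (vec_cochains (2 * h) (vertices K))" "\<phi> = local_delta0 K f s"
      unfolding local_B1_def by blast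
    obtain x where x: "\<And>v. x v \<in> sp_V h" "s = to_cochain h (vertices K) x"
      using to_cochain_surj[OF s(1)] by blast
    then show "\<phi> \<in> dec ` B1" using s d unfolding B1_def by blast
  next
    fix \<phi> assume "\<phi> \<in> dec ` B1"
    then show "\<phi> \<in> local_B1 h K f" using d dc unfolding B1_def local_B1_def
      by (auto intro!: image_eqI[of _ _ "to_cochain h (vertices K) _"])
  qed
qed

text \<open>The quotient map onto \<open>local_H1\<close>, in the role of \<open>\<pi>\<close>:
  cocycles as functions go to cosets of vector-valued cochains.\<close>

definition coset :: "(nat \<Rightarrow> nat \<Rightarrow> real) \<Rightarrow> (nat \<Rightarrow> real vec) set" where
  "coset x = (\<lambda>b. dec (b + x)) ` B1"

lemma dec_add: "dec x \<oplus>\<^bsub>vec_cochains (2 * h) (edges K)\<lparr>carrier := C\<rparr>\<^esub> dec y = dec (x + y)"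
  by (auto simp: vec_cochains_def to_cochain_def fun_eq_iff)

lemma dec_smult: "r \<odot>\<^bsub>vec_cochains (2 * h) (edges K)\<lparr>carrier := C\<rparr>\<^esub> dec x = dec (r *\<^sub>R x)"
  by (auto simp: vec_cochains_def to_cochain_def fun_eq_iff)

lemma coset_eq:
  "local_B1 h K f +>\<^bsub>vec_cochains (2 * h) (edges K)\<lparr>carrier := C\<rparr>\<^esub> dec x = coset x"
  unfolding a_r_coset_def r_coset_def local_B1_eq coset_def by (auto simp: dec_add[simplified])

lemmas B1_closed = real_vector.subspace_0[OF B1_subspace] real_vector.subspace_add[OF B1_subspace]
  real_vector.subspace_diff[OF B1_subspace] real_vector.subspace_scale[OF B1_subspace]

lemma coset_shift: "b \<in> B1 \<Longrightarrow> coset (b + x) = coset x"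
proof -
  assume b: "b \<in> B1"
  have "dec (c + x) = dec ((c - b) + (b + x))" for c by simp
  then show ?thesis unfolding coset_def using b B1_closed
    by (auto simp: add.assoc[symmetric] image_iff intro: bexI[of _ "_ + b"])
       (metis add_diff_cancel_left' diff_add_cancel add.commute)
qed

lemma quotient: "quotient_presentation (local_H1 h K f) coset Z1 B1"
proof
  let ?M = "vec_cochains (2 * h) (edges K)\<lparr>carrier := local_Z1 h K f\<rparr>"
  show "lsubspace Z1" "finite_dim Z1" by (rule Z1_subspace Z1_finite)+
  show "coset ` Z1 = carrier (local_H1 h K f)"
  proof -
    have "carrier (local_H1 h K f) = (\<Union>a\<in>local_Z1 h K f. {local_B1 h K f +>\<^bsub>?M\<^esub> a})"
      by (simp add: local_H1_def quotient_module_def A_RCOSETS_def RCOSETS_def a_r_coset_def)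
    also have "\<dots> = (\<Union>x\<in>Z1. {local_B1 h K f +>\<^bsub>?M\<^esub> dec x})"
      unfolding local_Z1_eq by blast
    finally show ?thesis by (auto simp: coset_eq)
  qed
  show "coset x \<oplus>\<^bsub>local_H1 h K f\<^esub> coset y = coset (x + y)" for x y
  proof -
    have "coset x \<oplus>\<^bsub>local_H1 h K f\<^esub> coset y = (\<Union>b\<in>B1. \<Union>c\<in>B1. {dec (b + x) \<oplus>\<^bsub>?M\<^esub> dec (c + y)})"
      by (auto simp: local_H1_def quotient_module_def set_add_def set_mult_def coset_def)
    also have "\<dots> = (\<Union>b\<in>B1. \<Union>c\<in>B1. {dec ((b + c) + (x + y))})"
      unfolding dec_add by (simp add: algebra_simps)
    also have "\<dots> = coset (x + y)"
    proof (intro subset_antisym subsetI)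
      fix z assume "z \<in> coset (x + y)"
      then obtain b where "b \<in> B1" "z = dec ((b + 0) + (x + y))" by (auto simp: coset_def)
      then show "z \<in> (\<Union>b\<in>B1. \<Union>c\<in>B1. {dec ((b + c) + (x + y))})" using B1_closed(1) by blast
    qed (use B1_closed(2) in \<open>auto simp: coset_def\<close>)
    finally show ?thesis .
  qed
  show "r \<odot>\<^bsub>local_H1 h K f\<^esub> coset x = coset (r *\<^sub>R x)" for r x
  proof -
    have "r \<odot>\<^bsub>local_H1 h K f\<^esub> coset x = (\<Union>b\<in>B1. local_B1 h K f +>\<^bsub>?M\<^esub> dec (r *\<^sub>R (b + x)))"
      by (simp add: local_H1_def quotient_module_def coset_def dec_smult[simplified])
    also have "\<dots> = (\<Union>b\<in>B1. coset (r *\<^sub>R b + r *\<^sub>R x))" by (simp add: coset_eq scaleR_add_right)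
    also have "\<dots> = (\<Union>b\<in>B1. coset (r *\<^sub>R x))" using coset_shift B1_closed(4) by simp
    finally show ?thesis using B1_closed(1) by auto
  qed
  show zero: "\<zero>\<^bsub>local_H1 h K f\<^esub> = coset 0"
    by (auto simp: local_H1_def quotient_module_def coset_def local_B1_eq)
  show "coset x = \<zero>\<^bsub>local_H1 h K f\<^esub> \<longleftrightarrow> x \<in> B1" if x: "x \<in> Z1" for x
  proof
    assume "coset x = \<zero>\<^bsub>local_H1 h K f\<^esub>"
    moreover have "dec (0 + x) \<in> coset x" unfolding coset_def using B1_closed(1) by blast
    ultimately have "dec x \<in> coset 0" unfolding zero by simp
    then obtain b where b: "b \<in> B1" "dec x = dec b" by (auto simp: coset_def)
    then have "b \<in> Z1" using B1_Z1 by blast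
    then have "x = b" using x b by (intro to_cochain_inj[of "edges K" x h b]) (auto simp: Z1_def)
    then show "x \<in> B1" using b by simp
  next
    assume "x \<in> B1"
    then show "coset x = \<zero>\<^bsub>local_H1 h K f\<^esub>" using coset_shift[of x 0] zero by simp
  qed
qed

lemma cochain_cup_dec: "cochain_cup h K f (dec x) (dec y) = cup x y"
  unfolding cochain_cup_def cup_def
proof (intro sum.cong refl arg_cong2[of _ _ _ _ "(*)"])
  fix t assume t: "t \<in> triangles K"
  have "face K i t \<in> edges K" if "i < 3" for i using surface_ends(2)[OF K t that] .
  then show "symp_form h (dec x (e01 t)) (transport f (e01 t) (dec y (e12 t))) =
      sp_form h (x (e01 t)) (A t (y (e12 t)))"
    by (auto simp: to_cochain_def transport_vec symp_form_def sp_form_def intro!: sum.cong)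
qed

text \<open>Coboundaries pair to zero with cocycles on either side, so the value is independent of
  the representatives and the definite description in \<open>cup_form\<close> has exactly one
  solution.\<close>

lemma cup_form_coset:
  assumes x: "x \<in> Z1" and y: "y \<in> Z1"
  shows "cup_form h K f (coset x) (coset y) = cup x y"
proof -
  interpret cup: bilinear_form cup by (rule cup_bilinear)
  have "cup (b + x) (c + y) = cup x y" if "b \<in> B1" "c \<in> B1" for b c
  proof -
    have bc: "b \<in> Z1" "c \<in> Z1" using that B1_Z1 by auto
    have "cup x c = 0" using cup_sym[OF x bc(2)] cup_B1[OF that(2) x] by simp
    then show ?thesis using cup_B1[OF that(1) y] cup_B1[OF that(1) bc(2)] by (simp add: cup.add_left cup.add_right)
  qed
  then have "(\<forall>\<phi>\<in>coset x. \<forall>\<psi>\<in>coset y. cochain_cup h K f \<phi> \<psi> = r) \<longleftrightarrow> r = cup x y" for r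
    using B1_closed(1) by (auto simp: coset_def cochain_cup_dec)
  then show ?thesis unfolding cup_form_def by simp
qed

theorem local_signature_eq:
  "local_signature h K f = (\<Sum>t\<in>triangles K. orient K t * sp_maslov h (f (e01 t)) (f (e12 t)))"
proof -
  have "local_signature h K f = signature_on cup Z1"
    unfolding local_signature_def
    by (rule quotient_presentation.form_signature_eq[OF quotient cup_bilinear cup_form_coset cup_sym])
  then show ?thesis unfolding signature_eq_sum_maslov sp_maslov_def .
qed

end

section \<open>Surfaces represent all integral cycles\<close>

lemma bar_eval_superset:
  assumes "finite S" "Poly_Mapping.keys z \<subseteq> S"
  shows "bar_eval c z = (\<Sum>p\<in>S. of_int (Poly_Mapping.lookup z p) * c p)"
  unfolding bar_eval_def using assms
  by (intro sum.mono_neutral_left) (auto simp: in_keys_iff)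

lemma bar_eval_add: "bar_eval c (x + y) = bar_eval c x + bar_eval c y"
proof -
  let ?S = "Poly_Mapping.keys x \<union> Poly_Mapping.keys y"
  have "finite ?S" by simp
  moreover have "Poly_Mapping.keys (x + y) \<subseteq> ?S" by (rule Poly_Mapping.keys_add)
  ultimately have "bar_eval c (x + y) = (\<Sum>p\<in>?S. of_int (Poly_Mapping.lookup (x + y) p) * c p)"
    by (rule bar_eval_superset)
  also have "\<dots> = (\<Sum>p\<in>?S. of_int (Poly_Mapping.lookup x p) * c p) + (\<Sum>p\<in>?S. of_int (Poly_Mapping.lookup y p) * c p)"
    by (simp add: lookup_add sum.distrib distrib_right)
  also have "\<dots> = bar_eval c x + bar_eval c y"
    using bar_eval_superset[of ?S x c] bar_eval_superset[of ?S y c] by simp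
  finally show ?thesis .
qed

lemma bar_eval_frag: "bar_eval c (frag_cmul n (frag_of p)) = of_int n * c p"
  by (subst bar_eval_superset[of "{p}"]) (auto simp: keys_cmul lookup_frag_of intro: subsetD[OF keys_cmul])

lemma bar_eval_push:
  assumes "finite (triangles K)"
  shows "bar_eval c (push_fundamental K f) =
    (\<Sum>t\<in>triangles K. of_int (orient K t) * c (f (face K 2 t), f (face K 0 t)))"
proof -
  have "bar_eval c (\<Sum>t\<in>S. frag_cmul (orient K t) (frag_of (f (face K 2 t), f (face K 0 t)))) =
     (\<Sum>t\<in>S. of_int (orient K t) * c (f (face K 2 t), f (face K 0 t)))" if "finite S" for S
    using that
    by (induction S rule: finite_induct) (simp_all add: bar_eval_add bar_eval_frag, simp add: bar_eval_def)
  then show ?thesis using assms by (simp add: push_fundamental_def)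
qed

definition vanishes_on_surfaces :: "('g, 'm) monoid_scheme \<Rightarrow> ('g \<times> 'g \<Rightarrow> real) \<Rightarrow> bool" where
  "vanishes_on_surfaces G c \<longleftrightarrow> (\<forall>K f. closed_oriented_surface K \<longrightarrow> f \<in> bar_maps K G \<longrightarrow>
     (\<Sum>t\<in>triangles K. of_int (orient K t) * c (f (face K 2 t), f (face K 0 t))) = 0)"

text \<open>Triangles with labelled sides, glued along sides of equal label and opposite sign.\<close>

locale triangle_gluing = monoid G for G :: "('g, 'm) monoid_scheme" (structure) +
  fixes T :: "nat set" and or :: "nat \<Rightarrow> int" and p :: "nat \<Rightarrow> 'g \<times> 'g"
  assumes T: "finite T"
    and or: "t \<in> T \<Longrightarrow> or t = 1 \<or> or t = -1"
    and p: "t \<in> T \<Longrightarrow> p t \<in> carrier G \<times> carrier G"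
    and balanced: "(\<Sum>t\<in>T. or t * (of_bool (snd (p t) = g) - of_bool (fst (p t) \<otimes> snd (p t) = g) + of_bool (fst (p t) = g))) = 0"
begin

definition label :: "nat \<times> nat \<Rightarrow> 'g" where
  "label = (\<lambda>(t, i). if i = 0 then snd (p t) else if i = 1 then fst (p t) \<otimes> snd (p t) else fst (p t))"

definition sgn_side :: "nat \<times> nat \<Rightarrow> int" where
  "sgn_side = (\<lambda>(t, i). (-1) ^ i * or t)"

definition Pos :: "(nat \<times> nat) set" where
  "Pos = {s \<in> T \<times> {..<3}. sgn_side s = 1}"

definition Neg :: "(nat \<times> nat) set" where
  "Neg = {s \<in> T \<times> {..<3}. sgn_side s = -1}"

lemma Pos_Neg: "Pos \<union> Neg = T \<times> {..<3}" "Pos \<inter> Neg = {}" "finite Pos" "finite Neg"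
proof -
  have "sgn_side s = 1 \<or> sgn_side s = -1" if sT: "s \<in> T \<times> {..<3}" for s
  proof -
    obtain t i where s: "s = (t, i)" "t \<in> T" "i < 3" using sT by auto
    show ?thesis using or[OF s(2)] s(1,3) by (auto simp: sgn_side_def elim!: less_3_cases)
  qed
  then show "Pos \<union> Neg = T \<times> {..<3}" by (auto simp: Pos_def Neg_def)
qed (use T in \<open>auto simp: Pos_def Neg_def\<close>)

text \<open>The coefficient of \<open>g\<close> in the boundary counts the sides labelled
  \<open>g\<close> with their signs, and \<open>balanced\<close> says that it is zero.\<close>

lemma card_label: "card {s \<in> Pos. label s = g} = card {s \<in> Neg. label s = g}"
proof -
  let ?S = "T \<times> {..<3::nat}"
  have fin: "finite ?S" using T by simp
  have "0 = (\<Sum>t\<in>T. \<Sum>i<3. sgn_side (t, i) * of_bool (label (t, i) = g))"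
    unfolding balanced[of g, symmetric]
    by (intro sum.cong refl) (simp add: sum_less_3 sgn_side_def label_def algebra_simps)
  also have "\<dots> = (\<Sum>s\<in>Pos \<union> Neg. sgn_side s * of_bool (label s = g))"
    unfolding Pos_Neg by (subst sum.cartesian_product) (simp add: split_def)
  also have "\<dots> = (\<Sum>s\<in>Pos. sgn_side s * of_bool (label s = g)) + (\<Sum>s\<in>Neg. sgn_side s * of_bool (label s = g))"
    using Pos_Neg by (intro sum.union_disjoint) auto
  also have "(\<Sum>s\<in>Pos. sgn_side s * of_bool (label s = g)) = (\<Sum>s\<in>Pos. of_bool (label s = g))"
    by (intro sum.cong) (auto simp: Pos_def)
  also have "(\<Sum>s\<in>Neg. sgn_side s * of_bool (label s = g)) = - (\<Sum>s\<in>Neg. of_bool (label s = g))"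
    unfolding sum_negf[symmetric] by (intro sum.cong) (auto simp: Neg_def)
  finally show ?thesis using Pos_Neg(3,4) by (simp add: Int_def sum_of_bool_eq conj_commute)
qed

text \<open>The counts agree for each label, so positive and negative sides can be matched label by
  label.\<close>

lemma ex_pairing: "\<exists>\<sigma>. bij_betw \<sigma> Pos Neg \<and> (\<forall>s\<in>Pos. label (\<sigma> s) = label s)"
proof -
  have "\<exists>\<tau>. bij_betw \<tau> {s \<in> Pos. label s = g} {s \<in> Neg. label s = g}" for g
    using Pos_Neg card_label[of g] by (intro finite_same_card_bij) auto
  then have "\<exists>\<tau>. \<forall>g. bij_betw (\<tau> g) {s \<in> Pos. label s = g} {s \<in> Neg. label s = g}"
    by (intro choice allI)
  then obtain \<tau> where \<tau>: "\<And>g. bij_betw (\<tau> g) {s \<in> Pos. label s = g} {s \<in> Neg. label s = g}" by blast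
  define \<sigma> where "\<sigma> = (\<lambda>s. \<tau> (label s) s)"
  have *: "\<sigma> s \<in> Neg" "label (\<sigma> s) = label s" if "s \<in> Pos" for s
    using bij_betw_apply[OF \<tau>[of "label s"], of s] that by (simp_all add: \<sigma>_def)
  have "inj_on \<sigma> Pos"
  proof (rule inj_onI)
    fix s s' assume s: "s \<in> Pos" "s' \<in> Pos" "\<sigma> s = \<sigma> s'"
    then have "label s = label s'" using * by metis
    then show "s = s'"
      using s inj_onD[OF bij_betw_imp_inj_on[OF \<tau>[of "label s"]], of s s'] by (simp add: \<sigma>_def)
  qed
  moreover have "Neg \<subseteq> \<sigma> ` Pos"
  proof
    fix s assume "s \<in> Neg"
    then have "s \<in> \<tau> (label s) ` {s' \<in> Pos. label s' = label s}"
      using bij_betw_imp_surj_on[OF \<tau>[of "label s"]] by simp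
    then obtain s' where "s' \<in> Pos" "label s' = label s" "s = \<tau> (label s) s'" by blast
    then have "s = \<sigma> s'" by (simp add: \<sigma>_def)
    then show "s \<in> \<sigma> ` Pos" using \<open>s' \<in> Pos\<close> by blast
  qed
  ultimately show ?thesis using * by (auto simp: bij_betw_def)
qed

definition \<sigma> :: "nat \<times> nat \<Rightarrow> nat \<times> nat" where
  "\<sigma> = (SOME \<sigma>. bij_betw \<sigma> Pos Neg \<and> (\<forall>s\<in>Pos. label (\<sigma> s) = label s))"

lemma \<sigma>: "bij_betw \<sigma> Pos Neg" "s \<in> Pos \<Longrightarrow> label (\<sigma> s) = label s"
  using someI_ex[OF ex_pairing] unfolding \<sigma>_def by blast+

definition code :: "nat \<times> nat \<Rightarrow> nat" where
  "code = (\<lambda>(t, i). 3 * t + i)"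

lemma code_inj: "code (t, i) = code (t', i') \<Longrightarrow> i < 3 \<Longrightarrow> i' < 3 \<Longrightarrow> (t, i) = (t', i')"
  unfolding code_def by (auto; presburger)

text \<open>A glued pair of sides is represented by its positive member, whose number becomes the
  edge.\<close>

definition rep :: "nat \<times> nat \<Rightarrow> nat \<times> nat" where
  "rep s = (if s \<in> Pos then s else inv_into Pos \<sigma> s)"

definition fc :: "nat \<Rightarrow> nat \<Rightarrow> nat" where
  "fc i t = code (rep (t, i))"

lemma rep_Pos: "s \<in> T \<times> {..<3} \<Longrightarrow> rep s \<in> Pos"
  using \<sigma>(1) Pos_Neg(1) by (auto simp: rep_def bij_betw_def intro!: inv_into_into)

lemma rep_eq_iff: "s \<in> T \<times> {..<3} \<Longrightarrow> r \<in> Pos \<Longrightarrow> rep s = r \<longleftrightarrow> s = r \<or> s = \<sigma> r"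
proof -
  assume s: "s \<in> T \<times> {..<3}" and r: "r \<in> Pos"
  have \<sigma>r: "\<sigma> r \<in> Neg" "\<sigma> r \<notin> Pos" using \<sigma>(1) r Pos_Neg(2) by (auto simp: bij_betw_def)
  show ?thesis
  proof (cases "s \<in> Pos")
    case True
    then show ?thesis using \<sigma>r by (auto simp: rep_def)
  next
    case False
    then have "s \<in> \<sigma> ` Pos" using s Pos_Neg(1) \<sigma>(1) by (auto simp: bij_betw_def)
    then have "inv_into Pos \<sigma> s = r \<longleftrightarrow> s = \<sigma> r"
      using r \<sigma>(1) by (metis bij_betw_def f_inv_into_f inv_into_f_f)
    then show ?thesis using False r by (auto simp: rep_def)
  qed
qed

lemma label_rep: "s \<in> T \<times> {..<3} \<Longrightarrow> label (rep s) = label s"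
  using rep_eq_iff[OF _ rep_Pos, of s s] \<sigma>(2)[OF rep_Pos, of s] by metis

lemma fc_eq_iff:
  assumes "t \<in> T" "i < 3" "t' \<in> T" "i' < 3"
  shows "fc i t = fc i' t' \<longleftrightarrow> rep (t, i) = rep (t', i')"
proof
  assume "fc i t = fc i' t'"
  moreover have "snd (rep (t, i)) < 3" "snd (rep (t', i')) < 3"
    using rep_Pos[of "(t, i)"] rep_Pos[of "(t', i')"] assms by (auto simp: Pos_def)
  ultimately show "rep (t, i) = rep (t', i')"
    using code_inj[of "fst (rep (t, i))" "snd (rep (t, i))" "fst (rep (t', i'))" "snd (rep (t', i'))"]
    by (simp add: fc_def)
qed (simp add: fc_def)

definition link :: "((nat \<times> bool) \<times> (nat \<times> bool)) set" where
  "link = (\<Union>t\<in>T. {((fc 2 t, False), (fc 1 t, False)), ((fc 2 t, True), (fc 0 t, False)),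
     ((fc 1 t, True), (fc 0 t, True))})"

abbreviation "same_link \<equiv> (link \<union> link\<inverse>)\<^sup>*"

definition end_code :: "nat \<times> bool \<Rightarrow> nat" where
  "end_code = (\<lambda>(e, b). 2 * e + of_bool b)"

lemma end_code_inj: "inj end_code"
  unfolding end_code_def by (rule injI) (auto split: prod.splits simp: of_bool_def split: if_splits; presburger)

text \<open>A vertex is a link class of edge ends, named by the least code of its members. Vertices
  cannot be taken over from the bar construction, which has a single one: identifying them all could
  pinch the surface. With link classes, links are connected by construction.\<close>

definition vertex :: "nat \<times> bool \<Rightarrow> nat" where
  "vertex q = (LEAST n. n \<in> end_code ` (same_link `` {q}))"

lemma same_link_sym: "(q, r) \<in> same_link \<Longrightarrow> (r, q) \<in> same_link"
  by (rule symD[OF sym_rtrancl]) (auto simp: sym_def)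

lemma vertex_eq_iff: "vertex q = vertex r \<longleftrightarrow> (q, r) \<in> same_link"
proof
  have *: "\<exists>u. (q, u) \<in> same_link \<and> vertex q = end_code u" for q
  proof -
    have "vertex q \<in> end_code ` (same_link `` {q})"
      unfolding vertex_def by (rule LeastI[of _ "end_code q"]) auto
    then show ?thesis by blast
  qed
  obtain u where u: "(q, u) \<in> same_link" "vertex q = end_code u" using *[of q] by blast
  obtain v where v: "(r, v) \<in> same_link" "vertex r = end_code v" using *[of r] by blast
  assume "vertex q = vertex r"
  then have "u = v" using u(2) v(2) injD[OF end_code_inj] by simp
  then show "(q, r) \<in> same_link" using rtrancl_trans[OF u(1) same_link_sym] v(1) by simp
next
  assume qr: "(q, r) \<in> same_link"
  have "same_link `` {q} = same_link `` {r}"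
    using qr same_link_sym[OF qr] by (auto intro: rtrancl_trans)
  then show "vertex q = vertex r" by (simp add: vertex_def)
qed

lemma vertex_link: "(q, r) \<in> link \<Longrightarrow> vertex q = vertex r"
  unfolding vertex_eq_iff by blast

definition adj :: "(nat \<times> nat) set" where
  "adj = {(t, t'). t \<in> T \<and> t' \<in> T \<and> (\<exists>i<3. \<exists>i'<3. fc i t = fc i' t')}"

text \<open>Surfaces are required to be connected, so the glued complex is cut into its components,
  each given by its set of triangles.\<close>

definition connected :: "(nat \<times> nat) set" where
  "connected = {(t, t'). t \<in> T \<and> (t, t') \<in> adj\<^sup>*}"

lemma adj_sym: "sym adj"
  unfolding sym_def adj_def by clarsimp metis

lemma connected_T: "(t, t') \<in> connected \<Longrightarrow> t \<in> T \<and> t' \<in> T"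
  unfolding connected_def by (auto elim: rtranclE simp: adj_def)

lemma connected_equiv: "equiv T connected"
proof (rule equivI)
  show "connected \<subseteq> T \<times> T" using connected_T by auto
  show "refl_on T connected" by (auto simp: refl_on_def connected_def)
  show "sym connected"
    using connected_T symD[OF sym_rtrancl[OF adj_sym]] unfolding sym_def by (fastforce simp: connected_def)
  show "trans connected" by (auto simp: trans_def connected_def intro: rtrancl_trans)
qed

definition component :: "nat set \<Rightarrow> surface" where
  "component C = \<lparr>vertices = vertex ` ((\<lambda>(i, t). fc i t) ` ({..<3} \<times> C) \<times> UNIV),
     edges = (\<lambda>(i, t). fc i t) ` ({..<3} \<times> C), triangles = C,
     source = (\<lambda>e. vertex (e, False)), target = (\<lambda>e. vertex (e, True)), face = fc, orient = or\<rparr>"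

lemma component_simps:
  "vertices (component C) = vertex ` (edges (component C) \<times> UNIV)"
  "e \<in> edges (component C) \<longleftrightarrow> (\<exists>t\<in>C. \<exists>i<3. e = fc i t)" "triangles (component C) = C"
  "source (component C) e = vertex (e, False)" "target (component C) e = vertex (e, True)"
  "face (component C) = fc" "orient (component C) = or" "edge_end (component C) q = vertex q"
  by (auto simp: component_def edge_end_def split: prod.split)

text \<open>By the gluing, each edge has two sides \<open>s\<close> and \<open>\<sigma> s\<close> of
  opposite sign. Links need an argument because \<open>link\<close> is formed over all of
  \<open>T\<close>: each step of a path in it happens in a triangle that contains the current edge,
  so a path that starts in the component stays there.\<close>

lemma component_surface:
  assumes t0: "t0 \<in> T" and C: "C = connected `` {t0}"
  shows "closed_oriented_surface (component C)"
proof -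
  let ?K = "component C"
  have CT: "C \<subseteq> T" using C connected_T by blast
  have closed: "t' \<in> C" if "t \<in> C" "t' \<in> T" "fc i t = fc i' t'" "i < 3" "i' < 3" for t t' i i'
    using that CT unfolding C connected_def adj_def
    by (auto intro!: rtrancl_into_rtrancl[of t0 t])
  have tri: "vertex (fc 2 t, False) = vertex (fc 1 t, False)" "vertex (fc 2 t, True) = vertex (fc 0 t, False)"
    "vertex (fc 1 t, True) = vertex (fc 0 t, True)" if "t \<in> T" for t
    using that by (auto intro!: vertex_link simp: link_def)
  have fin: "finite C" using CT T finite_subset by blast
  have sides: "\<exists>s\<in>Pos. sides ?K e = {s, \<sigma> s}" if eK: "e \<in> edges ?K" for e
  proof -
    obtain t i where t: "t \<in> C" "i < 3" "e = fc i t" using eK by (auto simp: component_simps)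
    define r where "r = rep (t, i)"
    have r: "r \<in> Pos" unfolding r_def using t CT by (intro rep_Pos) auto
    have \<sigma>r: "\<sigma> r \<in> Neg" using \<sigma>(1) r by (auto simp: bij_betw_def)
    have iff: "fc i' t' = e \<longleftrightarrow> (t', i') = r \<or> (t', i') = \<sigma> r" if "t' \<in> T" "i' < 3" for t' i'
      using fc_eq_iff[OF that, of t i] rep_eq_iff[OF _ r, of "(t', i')"] t CT that unfolding r_def by auto
    have "(t', i') \<in> sides ?K e \<longleftrightarrow> (t', i') = r \<or> (t', i') = \<sigma> r" for t' i'
    proof
      assume "(t', i') \<in> sides ?K e"
      then show "(t', i') = r \<or> (t', i') = \<sigma> r" using iff[of t' i'] CT by (auto simp: sides_def component_simps)
    next
      assume *: "(t', i') = r \<or> (t', i') = \<sigma> r"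
      then have T': "t' \<in> T" "i' < 3" using r \<sigma>r by (auto simp: Pos_def Neg_def)
      then show "(t', i') \<in> sides ?K e"
        using * iff[OF T'] closed[of t t' i i'] t by (auto simp: sides_def component_simps)
    qed
    then have "sides ?K e = {r, \<sigma> r}" by auto
    then show ?thesis using r by blast
  qed
  have link_C: "(q, r) \<in> (link_graph ?K \<union> (link_graph ?K)\<inverse>)\<^sup>* \<and> fst r \<in> edges ?K"
    if "(q, r) \<in> same_link" "fst q \<in> edges ?K" for q r
    using that
  proof (induction rule: rtrancl_induct)
    case (step r r')
    then have r: "fst r \<in> edges ?K" by blast
    \<comment> \<open>\<open>component {t}\<close> serves as a complex with one triangle, to name
      the corner in which the step takes place.\<close>
    obtain t where t: "t \<in> T" "(r, r') \<in> link_graph (component {t}) \<union> (link_graph (component {t}))\<inverse>"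
      using step(2) by (auto simp: link_def link_graph_def component_simps)
    then obtain i i' where i: "i < 3" "i' < 3" "fst r = fc i t" "fst r' = fc i' t"
      by (auto simp: link_graph_def component_simps)
         (metis (no_types, lifting) one_less_numeral_iff semiring_norm(77) zero_less_numeral lessI numeral_3_eq_3 numeral_2_eq_2)+
    obtain t' j where "t' \<in> C" "j < 3" "fst r = fc j t'" using r by (auto simp: component_simps)
    then have "t \<in> C" using closed[of t' t j i] t(1) i by simp
    then have "(r, r') \<in> link_graph ?K \<union> (link_graph ?K)\<inverse>" "fst r' \<in> edges ?K"
      using t(2) i by (auto simp: link_graph_def component_simps)
    then show ?case using step by (meson rtrancl.rtrancl_into_rtrancl)
  qed simp
  let ?R = "(edge_graph ?K \<union> (edge_graph ?K)\<inverse>)\<^sup>*"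
  have R_sym: "(v, w) \<in> ?R \<Longrightarrow> (w, v) \<in> ?R" for v w
    by (rule symD[OF sym_rtrancl]) (auto simp: sym_def)
  have R_edge: "(vertex (fc i t, b), vertex (fc i t, b')) \<in> ?R" if "t \<in> C" "i < 3" for t i b b'
  proof -
    have "(vertex (fc i t, False), vertex (fc i t, True)) \<in> edge_graph ?K"
    proof -
      have "fc i t \<in> edges ?K" using that by (auto simp: component_simps(2))
      then show ?thesis unfolding edge_graph_def
        by (rule image_eqI[rotated]) (simp add: component_simps)
    qed
    then show ?thesis by (cases b; cases b') auto
  qed
  have R_tri: "(vertex (fc i t, b), vertex (fc j t, b')) \<in> ?R" if t: "t \<in> C" "i < 3" "j < 3" for t i j b b'
  proof -
    have tT: "t \<in> T" using t CT by blast
    have 1: "(vertex (fc 2 t, False), vertex (fc k t, c)) \<in> ?R" if "k < 3" for k c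
      using that
    proof (rule less_3_cases)
      assume "k = 2" then show ?thesis using R_edge[OF t(1), of 2] by simp
    next
      assume "k = 1" then show ?thesis using R_edge[OF t(1), of 1 False c] tri(1)[OF tT] by simp
    next
      assume "k = 0"
      then show ?thesis using rtrancl_trans[OF R_edge[OF t(1), of 2 False True]] R_edge[OF t(1), of 0 False c] tri(2)[OF tT] by simp
    qed
    show ?thesis using rtrancl_trans[OF R_sym[OF 1[OF t(2)]] 1[OF t(3)]] .
  qed
  \<comment> \<open>Along a chain of adjacent triangles, the shared edge provides a common vertex
    from which \<open>R_tri\<close> reaches the next triangle.\<close>
  have conn: "(vertex (fc 0 t0, False), vertex (fc i t, b)) \<in> ?R" if "(t0, t) \<in> adj\<^sup>*" "i < 3" for t i b
    using that
  proof (induction arbitrary: i b rule: rtrancl_induct)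
    case base
    have "t0 \<in> C" using C t0 by (auto simp: connected_def)
    then show ?case using base by (intro R_tri) auto
  next
    case (step t t')
    obtain j j' where j: "j < 3" "j' < 3" "fc j t = fc j' t'" using step by (auto simp: adj_def)
    have "t' \<in> C" using C t0 step by (auto simp: connected_def intro: rtrancl_into_rtrancl)
    have "(vertex (fc 0 t0, False), vertex (fc j' t', False)) \<in> ?R" using step.IH[OF j(1), of False] j(3) by simp
    moreover have "(vertex (fc j' t', False), vertex (fc i t', b)) \<in> ?R"
      using \<open>t' \<in> C\<close> j step.prems by (intro R_tri)
    ultimately show ?case by (rule rtrancl_trans)
  qed
  show ?thesis unfolding closed_oriented_surface_def
  proof (intro conjI ballI impI)
    show "delta_complex ?K" unfolding delta_complex_def
    proof (intro conjI ballI allI impI)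
      show "finite (edges ?K)" "finite (vertices ?K)" using fin by (auto simp: component_def)
    qed (use fin CT tri in \<open>auto simp: component_simps image_iff Bex_def subset_iff\<close>)
    show "triangles ?K \<noteq> {}" using C t0 by (auto simp: component_simps connected_def)
    show "card (sides ?K e) = 2" if eK: "e \<in> edges ?K" for e
    proof -
      obtain s where s: "s \<in> Pos" "sides ?K e = {s, \<sigma> s}" using sides[OF eK] by blast
      have "\<sigma> s \<noteq> s" using s(1) bij_betw_apply[OF \<sigma>(1) s(1)] Pos_Neg(2) by auto
      then show ?thesis using s by auto
    qed
    show "(\<Sum>(t, i)\<in>sides ?K e. (- 1) ^ i * orient ?K t) = 0" if eK: "e \<in> edges ?K" for e
    proof -
      obtain s where s: "s \<in> Pos" "sides ?K e = {s, \<sigma> s}" using sides[OF eK] by blast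
      have n: "\<sigma> s \<in> Neg" "\<sigma> s \<noteq> s" using s(1) bij_betw_apply[OF \<sigma>(1) s(1)] Pos_Neg(2) by auto
      have "(\<Sum>(t, i)\<in>sides ?K e. (- 1) ^ i * orient ?K t) = (\<Sum>s\<in>{s, \<sigma> s}. sgn_side s)"
        unfolding s(2) by (intro sum.cong refl) (auto simp: sgn_side_def component_simps)
      then show ?thesis using s n by (simp add: Pos_def Neg_def)
    qed
    show "orient ?K t = 1 \<or> orient ?K t = - 1" if "t \<in> triangles ?K" for t
      using that CT or by (auto simp: component_simps)
    show "(q, r) \<in> (link_graph ?K \<union> (link_graph ?K)\<inverse>)\<^sup>*"
      if "q \<in> edges ?K \<times> UNIV" "r \<in> edges ?K \<times> UNIV" "edge_end ?K q = edge_end ?K r" for q r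
      using link_C[of q r] that by (auto simp: component_simps(8) vertex_eq_iff)
    show "(v, w) \<in> ?R" if "v \<in> vertices ?K" "w \<in> vertices ?K" for v w
    proof -
      have "(vertex (fc 0 t0, False), u) \<in> ?R" if uK: "u \<in> vertices ?K" for u
      proof -
        obtain e b where e: "e \<in> edges ?K" "u = vertex (e, b)" using uK unfolding component_simps(1) by blast
        then obtain t i where "t \<in> C" "i < 3" "e = fc i t" by (auto simp: component_simps)
        then show ?thesis using conn[of t i b] e C by (auto simp: connected_def)
      qed
      then show ?thesis using that R_sym by (meson rtrancl_trans)
    qed
  qed
qed

text \<open>The labels form a bar map on the component: glued sides have equal labels, and side 1
  carries the product of the labels of sides 2 and 0.\<close>

lemma component_sum:
  assumes c: "vanishes_on_surfaces G c" and t0: "t0 \<in> T" and C: "C = connected `` {t0}"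
  shows "(\<Sum>t\<in>C. of_int (or t) * c (p t)) = 0"
proof -
  let ?K = "component C"
  have CT: "C \<subseteq> T" using C connected_T by blast
  define f where "f = (\<lambda>e\<in>edges ?K. label (SOME s. s \<in> Pos \<and> code s = e))"
  have f: "f (fc i t) = label (t, i)" if "t \<in> C" "i < 3" for t i
  proof -
    have ti: "(t, i) \<in> T \<times> {..<3}" using that CT by auto
    note r = rep_Pos[OF ti]
    have "(SOME s. s \<in> Pos \<and> code s = fc i t) = rep (t, i)"
    proof (rule some_equality)
      show "rep (t, i) \<in> Pos \<and> code (rep (t, i)) = fc i t" using r by (simp add: fc_def)
      fix s assume "s \<in> Pos \<and> code s = fc i t"
      then show "s = rep (t, i)"
        using r code_inj[of "fst s" "snd s" "fst (rep (t, i))" "snd (rep (t, i))"]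
        by (auto simp: fc_def Pos_def)
    qed
    then show ?thesis using label_rep[OF ti] that by (auto simp: f_def component_simps)
  qed
  have "f \<in> bar_maps ?K G" unfolding bar_maps_def
  proof (intro CollectI conjI ballI)
    have "label (t, i) \<in> carrier G" if "t \<in> C" for t i
      using p[of t] that CT by (auto simp: label_def mem_Times_iff)
    then show "f \<in> edges ?K \<rightarrow>\<^sub>E carrier G"
    proof (intro PiE_I)
      fix e assume "e \<in> edges ?K"
      then obtain t i where "t \<in> C" "i < 3" "e = fc i t" by (auto simp: component_simps(2))
      then show "f e \<in> carrier G" using f \<open>\<And>t i. t \<in> C \<Longrightarrow> label (t, i) \<in> carrier G\<close> by simp
    qed (simp add: f_def)
  qed (simp add: component_simps f, simp add: label_def)
  then have "(\<Sum>t\<in>triangles ?K. of_int (orient ?K t) * c (f (face ?K 2 t), f (face ?K 0 t))) = 0"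
    using c component_surface[OF t0 C] unfolding vanishes_on_surfaces_def by blast
  then show ?thesis by (simp add: component_simps f label_def)
qed

theorem total_sum:
  assumes c: "vanishes_on_surfaces G c"
  shows "(\<Sum>t\<in>T. of_int (or t) * c (p t)) = 0"
proof -
  have U: "\<Union> (T // connected) = T" by (rule Union_quotient[OF connected_equiv])
  have "(\<Sum>t\<in>\<Union> (T // connected). of_int (or t) * c (p t)) =
      (\<Sum>C\<in>T // connected. \<Sum>t\<in>C. of_int (or t) * c (p t))"
  proof (subst sum.Union_disjoint)
    show "\<forall>A\<in>T // connected. finite A" using U T by (metis Union_upper finite_subset)
    show "\<forall>A\<in>T // connected. \<forall>B\<in>T // connected. A \<noteq> B \<longrightarrow> A \<inter> B = {}"
      using quotient_disj[OF connected_equiv] by blast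
  qed simp
  also have "\<dots> = 0"
    using component_sum[OF c] by (intro sum.neutral) (auto elim!: quotientE)
  finally show ?thesis unfolding U .
qed

end

section \<open>Cocycles that vanish on surfaces\<close>

definition bar_boundary :: "('g, 'm) monoid_scheme \<Rightarrow> 'g \<times> 'g \<Rightarrow> 'g \<Rightarrow> int" where
  "bar_boundary G = (\<lambda>(g, h) x. of_bool (h = x) - of_bool (g \<otimes>\<^bsub>G\<^esub> h = x) + of_bool (g = x))"

text \<open>A simplex with coefficient \<open>n\<close> becomes \<open>\<bar>n\<bar>\<close>
  triangles of sign \<open>sgn n\<close>; that the chain is a cycle is exactly the balance needed
  for gluing.\<close>

lemma (in monoid) integral_cycle_sum:
  assumes c: "vanishes_on_surfaces G c" and I: "finite I"
    and p: "\<And>i. i \<in> I \<Longrightarrow> p i \<in> carrier G \<times> carrier G"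
    and z: "\<And>x. (\<Sum>i\<in>I. n i * bar_boundary G (p i) x) = 0"
  shows "(\<Sum>i\<in>I. of_int (n i) * c (p i)) = 0"
proof -
  define S where "S = Sigma I (\<lambda>i. {..<nat \<bar>n i\<bar>})"
  have fS: "finite S" using I by (simp add: S_def)
  then obtain e where e: "bij_betw e {0..<card S} S" using ex_bij_betw_nat_finite by blast
  define or where "or = (\<lambda>t. sgn (n (fst (e t))))"
  have eS: "e t \<in> S" if "t \<in> {0..<card S}" for t using e that by (auto simp: bij_betw_def)
  \<comment> \<open>Stated for every commutative ring because it is applied to the integral boundary
    and to the real cochain.\<close>
  have sums: "(\<Sum>t\<in>{0..<card S}. of_int (or t) * F (p (fst (e t)))) = (\<Sum>i\<in>I. of_int (n i) * F (p i))"
    for F :: "'a \<times> 'a \<Rightarrow> 'r::comm_ring_1"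
  proof -
    have "(\<Sum>t\<in>{0..<card S}. of_int (or t) * F (p (fst (e t)))) = (\<Sum>s\<in>S. of_int (sgn (n (fst s))) * F (p (fst s)))"
      unfolding or_def by (rule sum.reindex_bij_betw[OF e, of "\<lambda>s. of_int (sgn (n (fst s))) * F (p (fst s))"])
    also have "\<dots> = (\<Sum>i\<in>I. \<Sum>k<nat \<bar>n i\<bar>. of_int (sgn (n i)) * F (p i))"
      unfolding S_def by (subst sum.Sigma) (use I in \<open>auto simp: split_def\<close>)
    also have "\<dots> = (\<Sum>i\<in>I. of_int (n i) * F (p i))"
    proof (intro sum.cong refl)
      fix i
      have "of_nat (nat \<bar>n i\<bar>) * of_int (sgn (n i)) = (of_int (n i) :: 'r)"
        by (simp add: sgn_if abs_if of_nat_nat)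
      then show "(\<Sum>k<nat \<bar>n i\<bar>. of_int (sgn (n i)) * F (p i)) = of_int (n i) * F (p i)"
        by (simp add: mult.assoc[symmetric])
    qed
    finally show ?thesis .
  qed
  interpret triangle_gluing G "{0..<card S}" or "\<lambda>t. p (fst (e t))"
  proof
    show "or t = 1 \<or> or t = -1" if "t \<in> {0..<card S}" for t
      using eS[OF that] by (auto simp: S_def or_def sgn_if split: if_splits)
    show "p (fst (e t)) \<in> carrier G \<times> carrier G" if "t \<in> {0..<card S}" for t
      using eS[OF that] p by (auto simp: S_def)
    fix g
    have "(\<Sum>t\<in>{0..<card S}. of_int (or t) * bar_boundary G (p (fst (e t))) g) = 0"
      using sums[of "\<lambda>q. bar_boundary G q g"] z[of g] by simp
    then show "(\<Sum>t = 0..<card S. or t * (of_bool (snd (p (fst (e t))) = g) -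
      of_bool (fst (p (fst (e t))) \<otimes> snd (p (fst (e t))) = g) + of_bool (fst (p (fst (e t))) = g))) = 0"
      by (simp add: bar_boundary_def split_def)
  qed simp
  show ?thesis using total_sum[OF c] sums[of c] by simp
qed

text \<open>Source and target of the extension problem: rational chains on the group, among them the
  boundaries of simplices, and the reals with rational scalars, where the cochain takes its
  values.\<close>

interpretation rat_fun: vector_space "\<lambda>(r::rat) (f::'a \<Rightarrow> rat) x. r * f x"
  by unfold_locales (auto simp: fun_eq_iff algebra_simps)

interpretation rat_real: vector_space "\<lambda>(r::rat) (x::real). of_rat r * x"
  by unfold_locales (auto simp: algebra_simps of_rat_add of_rat_mult)

interpretation rat_fun_real: vector_space_pair "\<lambda>(r::rat) (f::'a \<Rightarrow> rat) x. r * f x" "\<lambda>(r::rat) (x::real). of_rat r * x"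
  by unfold_locales

lemma common_denominator:
  assumes "finite t"
  shows "\<exists>N>0. \<forall>v\<in>t. \<exists>n. of_int N * (r v :: rat) = of_int n"
  using assms
proof (induction t rule: finite_induct)
  case empty
  show ?case by (intro exI[of _ 1]) simp
next
  case (insert v t)
  then obtain N where N: "N > 0" "\<forall>v\<in>t. \<exists>n. of_int N * r v = of_int n" by blast
  obtain a b where ab: "quotient_of (r v) = (a, b)" by (cases "quotient_of (r v)")
  have b: "b > 0" "of_int b * r v = of_int a"
    using quotient_of_denom_pos[OF ab] quotient_of_div[OF ab] by simp_all
  have "\<exists>n. of_int (N * b) * r w = of_int n" if w: "w \<in> insert v t" for w
  proof (cases "w = v")
    case True
    then show ?thesis using b by (intro exI[of _ "N * a"]) (simp add: mult.assoc)
  next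
    case False
    then obtain n where "of_int N * r w = of_int n" using N w by blast
    then show ?thesis by (intro exI[of _ "b * n"]) (simp add: mult.commute mult.left_commute)
  qed
  then show ?case using N b by (intro exI[of _ "N * b"]) simp
qed

text \<open>Choose a rational basis of the span of the boundaries of simplices, consisting of such
  boundaries, and a linear map \<open>\<beta>\<close> to the reals that sends each of them to the
  value of \<open>c\<close> on its simplex. For the other simplices this value is forced: a rational
  relation between boundaries is, up to a denominator, an integral cycle, and \<open>c\<close>
  vanishes on it. The values of \<open>\<beta>\<close> on indicator functions give
  \<open>b\<close>.\<close>

theorem (in monoid) coboundary_if_vanishes_on_surfaces:
  assumes c: "vanishes_on_surfaces G c"
  shows "\<exists>b. \<forall>q\<in>carrier G \<times> carrier G. c q = bar_delta1 G b q"
proof -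
  define D where "D = (\<lambda>q x. of_int (bar_boundary G q x) :: rat)"
  let ?P = "carrier G \<times> carrier G"
  obtain B where B: "B \<subseteq> D ` ?P" "\<not> rat_fun.dependent B" "D ` ?P \<subseteq> rat_fun.span B"
    using rat_fun.maximal_independent_subset[of "D ` ?P"] by blast
  define pre where "pre = (\<lambda>v. SOME q. q \<in> ?P \<and> D q = v)"
  have pre: "pre v \<in> ?P \<and> D (pre v) = v" if "v \<in> B" for v
    unfolding pre_def by (rule someI_ex) (use that B(1) in blast)
  obtain \<beta> where \<beta>: "Vector_Spaces.linear (\<lambda>(r::rat) f x. r * f x) (\<lambda>(r::rat) x. of_rat r * x) \<beta>"
    "\<And>v. v \<in> B \<Longrightarrow> \<beta> v = c (pre v)"
    using rat_fun_real.linear_independent_extend[OF B(2), of "\<lambda>v. c (pre v)"] by blast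
  interpret \<beta>: Vector_Spaces.linear "\<lambda>(r::rat) f x. r * f x" "\<lambda>(r::rat) x. of_rat r * x" \<beta> by fact
  have \<beta>D: "\<beta> (D q) = c q" if q: "q \<in> ?P" for q
  proof -
    have "D q \<in> rat_fun.span B" using B(3) q by blast
    then obtain t r where t: "finite t" "t \<subseteq> B" "D q = (\<Sum>v\<in>t. (\<lambda>x. r v * v x))"
      unfolding rat_fun.span_explicit by blast
    obtain N where N: "N > 0" "\<forall>v\<in>t. \<exists>n. of_int N * r v = of_int n" using common_denominator[OF t(1)] by blast
    then obtain n where n: "\<And>v. v \<in> t \<Longrightarrow> of_int N * r v = of_int (n v)" by metis
    \<comment> \<open>The option index keeps \<open>q\<close> apart from the simplices
      \<open>pre v\<close> even when it is one of them. In \<open>n'\<close> the factor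
      \<open>N\<close> clears the denominators of the relation.\<close>
    define p' where "p' = (\<lambda>i. case i of None \<Rightarrow> q | Some v \<Rightarrow> pre v)"
    define n' where "n' = (\<lambda>i. case i of None \<Rightarrow> N | Some v \<Rightarrow> - n v)"
    have sum: "(\<Sum>i\<in>insert None (Some ` t). of_int (n' i) * F (p' i)) = of_int N * F q - (\<Sum>v\<in>t. of_int (n v) * F (pre v))"
      for F :: "'a \<times> 'a \<Rightarrow> 'r::comm_ring_1"
      using t(1) by (simp add: sum.reindex n'_def p'_def sum_negf)
    have z: "(\<Sum>i\<in>insert None (Some ` t). n' i * bar_boundary G (p' i) x) = 0" for x
    proof -
      have "(\<Sum>v\<in>t. of_int (n v) * D (pre v) x) = of_int N * D q x"
        unfolding t(3) sum_fun_apply sum_distrib_left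
        using n pre t(2) by (intro sum.cong refl) (simp add: mult.assoc[symmetric] subset_iff)
      then have "of_int (\<Sum>i\<in>insert None (Some ` t). n' i * bar_boundary G (p' i) x) = (0::rat)"
        using sum[of "\<lambda>q. D q x"] by (simp add: D_def)
      then show ?thesis by (simp only: of_int_eq_0_iff)
    qed
    have "(\<Sum>i\<in>insert None (Some ` t). of_int (n' i) * c (p' i)) = 0"
      by (rule integral_cycle_sum[OF c _ _ z]) (use t q pre in \<open>auto simp: p'_def subset_iff\<close>)
    then have "of_int N * c q = (\<Sum>v\<in>t. of_int (n v) * c (pre v))" unfolding sum by simp
    also have "\<dots> = (\<Sum>v\<in>t. of_int N * (of_rat (r v) * c (pre v)))"
    proof (intro sum.cong refl)
      fix v assume "v \<in> t"
      then have "of_rat (of_int N * r v) = (of_rat (of_int (n v)) :: real)" using n by simp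
      then have "of_int N * of_rat (r v) = (of_int (n v) :: real)" by (simp add: of_rat_mult)
      then show "of_int (n v) * c (pre v) = of_int N * (of_rat (r v) * c (pre v))"
        by (simp add: mult.assoc[symmetric])
    qed
    also have "\<dots> = of_int N * \<beta> (D q)"
      unfolding t(3) \<beta>.sum \<beta>.scale sum_distrib_left using \<beta>(2) t(2) by (intro sum.cong refl) (auto simp: subset_iff)
    finally show ?thesis using N(1) by simp
  qed
  define b where "b = (\<lambda>g. \<beta> (\<lambda>x. of_bool (g = x)))"
  have "c q = bar_delta1 G b q" if q: "q \<in> ?P" for q
  proof -
    obtain g h where gh: "q = (g, h)" by (cases q)
    have "D q = (\<lambda>x. of_bool (h = x)) - (\<lambda>x. of_bool (g \<otimes> h = x)) + (\<lambda>x. of_bool (g = x))"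
      by (auto simp: D_def gh bar_boundary_def fun_eq_iff)
    then have "\<beta> (D q) = b h - b (g \<otimes> h) + b g" by (simp add: \<beta>.add \<beta>.diff b_def)
    then show ?thesis using \<beta>D[OF q] q by (simp add: gh bar_delta1_def)
  qed
  then show ?thesis by blast
qed

section \<open>The Maslov cocycle represents the signature class\<close>

lemma bar_delta1_apply:
  "g \<in> carrier G \<Longrightarrow> k \<in> carrier G \<Longrightarrow> bar_delta1 G b (g, k) = b k - b (g \<otimes>\<^bsub>G\<^esub> k) + b g"
  by (simp add: bar_delta1_def)

lemma cohomologous2_equiv: "equiv (bar_cocycles2 G) (cohomologous2 G)"
proof (rule equivI)
  let ?P = "carrier G \<times> carrier G"
  show "cohomologous2 G \<subseteq> bar_cocycles2 G \<times> bar_cocycles2 G" by (auto simp: cohomologous2_def)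
  have "\<forall>p\<in>?P. bar_delta1 G (\<lambda>_. 0) p = 0" by (auto simp: bar_delta1_def)
  then show "refl_on (bar_cocycles2 G) (cohomologous2 G)"
    unfolding refl_on_def cohomologous2_def by fastforce
  show "sym (cohomologous2 G)" unfolding sym_def cohomologous2_def
  proof clarsimp
    fix c c' b assume b: "\<forall>x\<in>carrier G. \<forall>y\<in>carrier G. c' (x, y) - c (x, y) = bar_delta1 G b (x, y)"
    show "\<exists>b. \<forall>x\<in>carrier G. \<forall>y\<in>carrier G. c (x, y) - c' (x, y) = bar_delta1 G b (x, y)"
      by (rule exI[of _ "\<lambda>x. - b x"]) (use b in \<open>force simp: bar_delta1_apply\<close>)
  qed
  show "trans (cohomologous2 G)" unfolding trans_def cohomologous2_def
  proof clarsimp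
    fix c c' c'' b b'
    assume b: "\<forall>x\<in>carrier G. \<forall>y\<in>carrier G. c' (x, y) - c (x, y) = bar_delta1 G b (x, y)"
      "\<forall>x\<in>carrier G. \<forall>y\<in>carrier G. c'' (x, y) - c' (x, y) = bar_delta1 G b' (x, y)"
    show "\<exists>b. \<forall>x\<in>carrier G. \<forall>y\<in>carrier G. c'' (x, y) - c (x, y) = bar_delta1 G b (x, y)"
      by (rule exI[of _ "\<lambda>x. b x + b' x"]) (use b in \<open>force simp: bar_delta1_apply\<close>)
  qed
qed

definition maslov_cochain :: "nat \<Rightarrow> int mat \<times> int mat \<Rightarrow> real" where
  "maslov_cochain h = (\<lambda>(g, k)\<in>carrier (Sp_Z h) \<times> carrier (Sp_Z h). of_int (sp_maslov h g k))"

lemma maslov_cochain_apply: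
  "g \<in> carrier (Sp_Z h) \<Longrightarrow> k \<in> carrier (Sp_Z h) \<Longrightarrow> maslov_cochain h (g, k) = of_int (sp_maslov h g k)"
  by (simp add: maslov_cochain_def)

lemma maslov_cochain_cocycle: "maslov_cochain h \<in> bar_cocycles2 (Sp_Z h)"
proof -
  interpret symplectic_rep "Sp_Z h" "sp_act h" "sp_V h" "sp_L h" "sp_form h" "sp_J h"
    by (rule symplectic_rep_Sp)
  show ?thesis unfolding bar_cocycles2_def
  proof (intro CollectI conjI ballI)
    fix g k l assume g: "g \<in> carrier (Sp_Z h)" "k \<in> carrier (Sp_Z h)" "l \<in> carrier (Sp_Z h)"
    have "sp_maslov h k l - sp_maslov h (g \<otimes>\<^bsub>Sp_Z h\<^esub> k) l + sp_maslov h g (k \<otimes>\<^bsub>Sp_Z h\<^esub> l) - sp_maslov h g k = 0"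
      unfolding sp_maslov_def by (rule maslov_cocycle[OF g])
    then have "real_of_int (sp_maslov h k l - sp_maslov h (g \<otimes>\<^bsub>Sp_Z h\<^esub> k) l
        + sp_maslov h g (k \<otimes>\<^bsub>Sp_Z h\<^esub> l) - sp_maslov h g k) = 0" by simp
    then show "maslov_cochain h (k, l) - maslov_cochain h (g \<otimes>\<^bsub>Sp_Z h\<^esub> k, l)
        + maslov_cochain h (g, k \<otimes>\<^bsub>Sp_Z h\<^esub> l) - maslov_cochain h (g, k) = 0"
      using g m_closed[OF g(1,2)] m_closed[OF g(2,3)] by (simp add: maslov_cochain_apply del: Sp_Z_ops)
  qed (auto simp: maslov_cochain_def)
qed

lemma bar_eval_maslov:
  assumes K: "closed_oriented_surface K" and f: "f \<in> bar_maps K (Sp_Z h)"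
  shows "bar_eval (maslov_cochain h) (push_fundamental K f) = of_int (local_signature h K f)"
proof -
  interpret sp_surface h K f by (rule sp_surface.intro[OF K f])
  show ?thesis unfolding bar_eval_push[OF surface_finite(1)[OF K]] local_signature_eq of_int_sum
    using f_face by (intro sum.cong refl) (simp add: maslov_cochain_apply)
qed

text \<open>The difference is a coboundary, which the fundamental cycle annihilates by
  \<open>sum_sides_signed\<close>.\<close>

lemma bar_eval_cohomologous:
  assumes K: "closed_oriented_surface K" and f: "f \<in> bar_maps K G" and cc: "(c, c') \<in> cohomologous2 G"
  shows "bar_eval c' (push_fundamental K f) = bar_eval c (push_fundamental K f)"
proof -
  obtain b where b: "\<And>p. p \<in> carrier G \<times> carrier G \<Longrightarrow> c' p - c p = bar_delta1 G b p"
    using cc unfolding cohomologous2_def by blast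
  have fc: "f (face K i t) \<in> carrier G" if "t \<in> triangles K" "i < 3" for i t
    using f surface_ends(2)[OF K that] by (auto simp: bar_maps_def PiE_def Pi_def)
  have fm: "f (face K 1 t) = f (face K 2 t) \<otimes>\<^bsub>G\<^esub> f (face K 0 t)" if "t \<in> triangles K" for t
    using f that by (auto simp: bar_maps_def)
  have "bar_eval c' (push_fundamental K f) - bar_eval c (push_fundamental K f)
    = (\<Sum>t\<in>triangles K. of_int (orient K t) * (c' (f (face K 2 t), f (face K 0 t)) - c (f (face K 2 t), f (face K 0 t))))"
    unfolding bar_eval_push[OF surface_finite(1)[OF K]] by (simp add: sum_subtractf algebra_simps)
  also have "\<dots> = (\<Sum>t\<in>triangles K. of_int (orient K t) * (b (f (face K 2 t)) - b (f (face K 1 t)) + b (f (face K 0 t))))"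
    using b fc by (intro sum.cong refl) (simp add: bar_delta1_apply fm)
  also have "\<dots> = 0" by (rule sum_sides_signed[OF K])
  finally show ?thesis by simp
qed

text \<open>The definite description in \<open>signature_class\<close> needs uniqueness: a
  representative of another class with the same values on surfaces differs from
  \<open>maslov_cochain h\<close> by a cochain that vanishes on surfaces, hence by a
  coboundary.\<close>

theorem signature_class_eq: "signature_class h = cohomologous2 (Sp_Z h) `` {maslov_cochain h}"
  unfolding signature_class_def
proof (rule the_equality)
  let ?G = "Sp_Z h" and ?m = "maslov_cochain h"
  note eq = cohomologous2_equiv[of ?G] and m = maslov_cochain_cocycle[of h]
  interpret group ?G by (rule Sp_Z_group)
  show "cohomologous2 ?G `` {?m} \<in> group_H2 ?G \<and> (\<forall>K f. closed_oriented_surface K \<longrightarrow> f \<in> bar_maps K ?G \<longrightarrow>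
      (\<forall>c\<in>cohomologous2 ?G `` {?m}. bar_eval c (push_fundamental K f) = of_int (local_signature h K f)))"
  proof (intro conjI allI impI ballI)
    show "cohomologous2 ?G `` {?m} \<in> group_H2 ?G" unfolding group_H2_def by (rule quotientI[OF m])
    fix K f c assume K: "closed_oriented_surface K" and f: "f \<in> bar_maps K ?G"
      and "c \<in> cohomologous2 ?G `` {?m}"
    then have "(?m, c) \<in> cohomologous2 ?G" by simp
    from bar_eval_cohomologous[OF K f this]
    show "bar_eval c (push_fundamental K f) = of_int (local_signature h K f)"
      unfolding bar_eval_maslov[OF K f] .
  qed
  fix \<alpha> assume \<alpha>: "\<alpha> \<in> group_H2 ?G \<and> (\<forall>K f. closed_oriented_surface K \<longrightarrow> f \<in> bar_maps K ?G \<longrightarrow>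
      (\<forall>c\<in>\<alpha>. bar_eval c (push_fundamental K f) = of_int (local_signature h K f)))"
  then obtain c where c: "c \<in> bar_cocycles2 ?G" "\<alpha> = cohomologous2 ?G `` {c}"
    unfolding group_H2_def by (blast elim: quotientE)
  then have "c \<in> \<alpha>" using equiv_class_self[OF eq] by blast
  have "vanishes_on_surfaces ?G (\<lambda>p. ?m p - c p)" unfolding vanishes_on_surfaces_def
  proof (intro allI impI)
    fix K f assume K: "closed_oriented_surface K" and f: "f \<in> bar_maps K ?G"
    have "bar_eval c (push_fundamental K f) = bar_eval ?m (push_fundamental K f)"
      using \<alpha> \<open>c \<in> \<alpha>\<close> K f bar_eval_maslov by metis
    then show "(\<Sum>t\<in>triangles K. of_int (orient K t) *
        (?m (f (face K 2 t), f (face K 0 t)) - c (f (face K 2 t), f (face K 0 t)))) = 0"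
      unfolding bar_eval_push[OF surface_finite(1)[OF K]] by (simp add: sum_subtractf algebra_simps)
  qed
  then obtain b where "\<forall>q\<in>carrier ?G \<times> carrier ?G. ?m q - c q = bar_delta1 ?G b q"
    using coboundary_if_vanishes_on_surfaces by blast
  then have "(c, ?m) \<in> cohomologous2 ?G" using c m unfolding cohomologous2_def by blast
  then show "\<alpha> = cohomologous2 ?G `` {?m}" using equiv_class_eq[OF eq] c(2) by blast
qed

lemma sp_maslov_abs_le:
  assumes "g \<in> carrier (Sp_Z h)" "k \<in> carrier (Sp_Z h)"
  shows "\<bar>sp_maslov h g k\<bar> \<le> int h"
  using symplectic_rep.maslov_abs_le[OF symplectic_rep_Sp assms] by (simp add: sp_maslov_def sp_L_dim)

theorem gromov_norm_le: "gromov_norm (Sp_Z h) (signature_class h) \<le> ennreal (real h)"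
proof -
  let ?G = "Sp_Z h" and ?m = "maslov_cochain h"
  have "?m \<in> signature_class h"
    unfolding signature_class_eq using equiv_class_self[OF cohomologous2_equiv maslov_cochain_cocycle] .
  then have "gromov_norm ?G (signature_class h) \<le> (SUP p\<in>carrier ?G \<times> carrier ?G. ennreal \<bar>?m p\<bar>)"
    unfolding gromov_norm_def by (rule INF_lower)
  also have "\<dots> \<le> ennreal (real h)"
  proof (rule SUP_least)
    fix p assume "p \<in> carrier ?G \<times> carrier ?G"
    then obtain g k where p: "p = (g, k)" "g \<in> carrier ?G" "k \<in> carrier ?G" by blast
    have "\<bar>?m p\<bar> = real_of_int \<bar>sp_maslov h g k\<bar>" using p by (simp add: maslov_cochain_apply)
    also have "\<dots> \<le> real_of_int (int h)" using sp_maslov_abs_le[OF p(2,3)] by (simp only: of_int_le_iff)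
    finally show "ennreal \<bar>?m p\<bar> \<le> ennreal (real h)" by (intro ennreal_leI) simp
  qed
  finally show ?thesis .
qed

section \<open>Elements of the integral symplectic group\<close>

lemma symp_form_append:
  assumes "x1 \<in> carrier_vec h" "x2 \<in> carrier_vec h" "y1 \<in> carrier_vec h" "y2 \<in> carrier_vec h"
  shows "symp_form h (x1 @\<^sub>v x2) (y1 @\<^sub>v y2) = x1 \<bullet> y2 - x2 \<bullet> y1"
  using assms unfolding symp_form_def scalar_prod_def sum_subtractf[symmetric]
  by (auto simp: sum_subtractf atLeast0LessThan)

lemma block_in_Sp_Z:
  assumes c: "P \<in> carrier_mat h h" "Q \<in> carrier_mat h h" "R \<in> carrier_mat h h" "S \<in> carrier_mat h h"
    and inv: "N \<in> carrier_mat (2 * h) (2 * h)" "four_block_mat P Q R S * N = 1\<^sub>m (2 * h)"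
      "N * four_block_mat P Q R S = 1\<^sub>m (2 * h)"
    and form: "\<And>x1 x2 y1 y2. x1 \<in> carrier_vec h \<Longrightarrow> x2 \<in> carrier_vec h \<Longrightarrow> y1 \<in> carrier_vec h \<Longrightarrow> y2 \<in> carrier_vec h \<Longrightarrow>
      (P *\<^sub>v x1 + Q *\<^sub>v x2) \<bullet> (R *\<^sub>v y1 + S *\<^sub>v y2) - (R *\<^sub>v x1 + S *\<^sub>v x2) \<bullet> (P *\<^sub>v y1 + Q *\<^sub>v y2)
      = x1 \<bullet> y2 - x2 \<bullet> y1"
  shows "four_block_mat P Q R S \<in> carrier (Sp_Z h)"
  unfolding Sp_Z_carrier
proof (intro conjI ballI)
  let ?M = "four_block_mat P Q R S"
  show "?M \<in> carrier_mat (2 * h) (2 * h)" using four_block_carrier_mat[OF c(1,4)] by (simp add: mult_2)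
  show "\<exists>B\<in>carrier_mat (2 * h) (2 * h). ?M * B = 1\<^sub>m (2 * h) \<and> B * ?M = 1\<^sub>m (2 * h)" using inv by blast
  fix x y :: "int vec" assume "x \<in> carrier_vec (2 * h)" "y \<in> carrier_vec (2 * h)"
  then have xy: "x \<in> carrier_vec (h + h)" "y \<in> carrier_vec (h + h)" by (simp_all add: mult_2)
  define x1 x2 y1 y2 where d: "x1 = vec_first x h" "x2 = vec_last x h" "y1 = vec_first y h" "y2 = vec_last y h"
  have dc: "x1 \<in> carrier_vec h" "x2 \<in> carrier_vec h" "y1 \<in> carrier_vec h" "y2 \<in> carrier_vec h" by (simp_all add: d)
  have x: "x = x1 @\<^sub>v x2" "y = y1 @\<^sub>v y2" using xy by (simp_all add: d)
  show "symp_form h (?M *\<^sub>v x) (?M *\<^sub>v y) = symp_form h x y"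
    unfolding x four_block_mat_mult_vec[OF c dc(1,2)] four_block_mat_mult_vec[OF c dc(3,4)]
    using c dc form[OF dc] by (simp add: symp_form_append)
qed

text \<open>The embedding of \<open>SL\<^sub>2(\<int>)\<close> by scalar blocks.\<close>

definition sb :: "nat \<Rightarrow> int \<Rightarrow> int \<Rightarrow> int \<Rightarrow> int \<Rightarrow> int mat" where
  "sb h a b c d = four_block_mat (a \<cdot>\<^sub>m 1\<^sub>m h) (b \<cdot>\<^sub>m 1\<^sub>m h) (c \<cdot>\<^sub>m 1\<^sub>m h) (d \<cdot>\<^sub>m 1\<^sub>m h)"

lemma sb_mult: "sb h a b c d * sb h a' b' c' d' =
    sb h (a * a' + b * c') (a * b' + b * d') (c * a' + d * c') (c * b' + d * d')"
proof -
  have "(a \<cdot>\<^sub>m 1\<^sub>m h) * (b \<cdot>\<^sub>m 1\<^sub>m h) + (c \<cdot>\<^sub>m 1\<^sub>m h) * (d \<cdot>\<^sub>m 1\<^sub>m h) = (a * b + c * d) \<cdot>\<^sub>m 1\<^sub>m h" for a b c d :: int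
  proof -
    have "(a \<cdot>\<^sub>m 1\<^sub>m h) * (b \<cdot>\<^sub>m 1\<^sub>m h) = a \<cdot>\<^sub>m (b \<cdot>\<^sub>m 1\<^sub>m h)" for a b :: int
      by (subst mult_smult_assoc_mat[of _ h h _ h]) auto
    then show ?thesis by (intro eq_matI) auto
  qed
  then show ?thesis unfolding sb_def by (subst mult_four_block_mat[of _ h h _ h _ h _ _ h _ h]) auto
qed

lemma sb_one: "sb h 1 0 0 1 = 1\<^sub>m (2 * h)"
  unfolding sb_def by (intro eq_matI) auto

lemma sb_in_Sp_Z:
  assumes "a * d - b * c = 1"
  shows "sb h a b c d \<in> carrier (Sp_Z h)"
proof -
  have sm: "(a \<cdot>\<^sub>m 1\<^sub>m h) *\<^sub>v x = a \<cdot>\<^sub>v x" if "x \<in> carrier_vec h" for a :: int and x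
    using that by (intro eq_vecI) auto
  have inv: "sb h d (- b) (- c) a \<in> carrier_mat (2 * h) (2 * h)"
    using four_block_carrier_mat[of "d \<cdot>\<^sub>m 1\<^sub>m h" h h "a \<cdot>\<^sub>m 1\<^sub>m h" h h] by (simp add: sb_def mult_2)
  have 1: "sb h a b c d * sb h d (- b) (- c) a = 1\<^sub>m (2 * h)" "sb h d (- b) (- c) a * sb h a b c d = 1\<^sub>m (2 * h)"
    unfolding sb_mult sb_one[symmetric] using assms by (simp_all add: mult.commute)
  show ?thesis unfolding sb_def
  proof (rule block_in_Sp_Z[OF _ _ _ _ inv 1[unfolded sb_def[of h a b c d]]])
    fix x1 x2 y1 y2 :: "int vec"
    assume x: "x1 \<in> carrier_vec h" "x2 \<in> carrier_vec h" "y1 \<in> carrier_vec h" "y2 \<in> carrier_vec h"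
    have "(a * d - b * c) * (x1 \<bullet> y2 - x2 \<bullet> y1) = x1 \<bullet> y2 - x2 \<bullet> y1" using assms by simp
    then show "((a \<cdot>\<^sub>m 1\<^sub>m h) *\<^sub>v x1 + (b \<cdot>\<^sub>m 1\<^sub>m h) *\<^sub>v x2) \<bullet> ((c \<cdot>\<^sub>m 1\<^sub>m h) *\<^sub>v y1 + (d \<cdot>\<^sub>m 1\<^sub>m h) *\<^sub>v y2) -
      ((c \<cdot>\<^sub>m 1\<^sub>m h) *\<^sub>v x1 + (d \<cdot>\<^sub>m 1\<^sub>m h) *\<^sub>v x2) \<bullet> ((a \<cdot>\<^sub>m 1\<^sub>m h) *\<^sub>v y1 + (b \<cdot>\<^sub>m 1\<^sub>m h) *\<^sub>v y2)
      = x1 \<bullet> y2 - x2 \<bullet> y1"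
      using x by (simp add: sm add_scalar_prod_distrib[of _ h] scalar_prod_add_distrib[of _ h] algebra_simps)
  qed auto
qed

text \<open>For symmetric \<open>S\<close>, the unipotent radical of the stabiliser of
  \<open>L\<close>, in which products become sums of matrices.\<close>

definition unip :: "nat \<Rightarrow> int mat \<Rightarrow> int mat" where
  "unip h S = four_block_mat (1\<^sub>m h) S (0\<^sub>m h h) (1\<^sub>m h)"

lemma unip_mult:
  assumes "S \<in> carrier_mat h h" "T \<in> carrier_mat h h"
  shows "unip h S * unip h T = unip h (T + S)"
  unfolding unip_def using assms
  by (subst mult_four_block_mat[of _ h h _ h _ h _ _ h _ h]) auto

lemma unip_zero: "unip h (0\<^sub>m h h) = 1\<^sub>m (2 * h)"
  unfolding unip_def by (intro eq_matI) auto

lemma unip_in_Sp_Z: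
  assumes S: "S \<in> carrier_mat h h" "transpose_mat S = S"
  shows "unip h S \<in> carrier (Sp_Z h)"
proof -
  have inv: "unip h (- S) \<in> carrier_mat (2 * h) (2 * h)"
    using four_block_carrier_mat[of "1\<^sub>m h" h h "1\<^sub>m h" h h] by (simp add: unip_def mult_2)
  have nS: "- S \<in> carrier_mat h h" using S by simp
  have 1: "unip h S * unip h (- S) = 1\<^sub>m (2 * h)" "unip h (- S) * unip h S = 1\<^sub>m (2 * h)"
    unfolding unip_mult[OF S(1) nS] unip_mult[OF nS S(1)] unip_zero[symmetric]
    by (intro arg_cong[of _ _ "unip h"] eq_matI; use S(1) in simp)+
  show ?thesis unfolding unip_def
  proof (rule block_in_Sp_Z[OF _ _ _ _ inv 1[unfolded unip_def[of h S]]])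
    fix x1 x2 y1 y2 :: "int vec"
    assume x: "x1 \<in> carrier_vec h" "x2 \<in> carrier_vec h" "y1 \<in> carrier_vec h" "y2 \<in> carrier_vec h"
    have z: "0\<^sub>m h h *\<^sub>v v = 0\<^sub>v h" if "v \<in> carrier_vec h" for v :: "int vec" using that by (intro eq_vecI) auto
    have "(S *\<^sub>v x2) \<bullet> y2 = x2 \<bullet> (S *\<^sub>v y2)"
      using transpose_vec_mult_scalar[OF S(1) x(4,2)] S by simp
    then show "(1\<^sub>m h *\<^sub>v x1 + S *\<^sub>v x2) \<bullet> (0\<^sub>m h h *\<^sub>v y1 + 1\<^sub>m h *\<^sub>v y2) -
      (0\<^sub>m h h *\<^sub>v x1 + 1\<^sub>m h *\<^sub>v x2) \<bullet> (1\<^sub>m h *\<^sub>v y1 + S *\<^sub>v y2) = x1 \<bullet> y2 - x2 \<bullet> y1"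
      using x S by (simp add: z add_scalar_prod_distrib[of _ h] scalar_prod_add_distrib[of _ h])
  qed (use S in auto)
qed

text \<open>The Levi factor of the stabiliser of \<open>L\<close>. The inverse of \<open>A\<close>
  is passed as the argument \<open>B\<close>, so that the lower block is written without inverting
  an integral matrix.\<close>

definition levi :: "nat \<Rightarrow> int mat \<Rightarrow> int mat \<Rightarrow> int mat" where
  "levi h A B = four_block_mat A (0\<^sub>m h h) (0\<^sub>m h h) (transpose_mat B)"

lemma levi_mult:
  assumes "A \<in> carrier_mat h h" "A' \<in> carrier_mat h h" "B \<in> carrier_mat h h" "B' \<in> carrier_mat h h"
  shows "levi h A B * levi h A' B' = levi h (A * A') (B' * B)"
  unfolding levi_def using assms
  by (subst mult_four_block_mat[of _ h h _ h _ h _ _ h _ h]) (auto simp: transpose_mult[of B' h h B h])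

lemma levi_one: "levi h (1\<^sub>m h) (1\<^sub>m h) = 1\<^sub>m (2 * h)"
  unfolding levi_def by (intro eq_matI) auto

lemma levi_in_Sp_Z:
  assumes A: "A \<in> carrier_mat h h" "B \<in> carrier_mat h h" and AB: "A * B = 1\<^sub>m h" "B * A = 1\<^sub>m h"
  shows "levi h A B \<in> carrier (Sp_Z h)"
proof -
  have inv: "levi h B A \<in> carrier_mat (2 * h) (2 * h)"
    using four_block_carrier_mat[of B h h "transpose_mat A" h h] A by (simp add: levi_def mult_2)
  have 1: "levi h A B * levi h B A = 1\<^sub>m (2 * h)" "levi h B A * levi h A B = 1\<^sub>m (2 * h)"
    using A AB by (simp_all add: levi_mult levi_one)
  have t: "(A *\<^sub>v x) \<bullet> (transpose_mat B *\<^sub>v y) = x \<bullet> y" "(transpose_mat B *\<^sub>v y) \<bullet> (A *\<^sub>v x) = y \<bullet> x"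
    if "x \<in> carrier_vec h" "y \<in> carrier_vec h" for x y
  proof -
    have "B *\<^sub>v (A *\<^sub>v x) = x" using assoc_mult_mat_vec[OF A(2,1) that(1)] AB that by simp
    then show 2: "(transpose_mat B *\<^sub>v y) \<bullet> (A *\<^sub>v x) = y \<bullet> x"
      using transpose_vec_mult_scalar[OF A(2), of "A *\<^sub>v x" y] A that by simp
    show "(A *\<^sub>v x) \<bullet> (transpose_mat B *\<^sub>v y) = x \<bullet> y"
      using 2 comm_scalar_prod[of "A *\<^sub>v x" h "transpose_mat B *\<^sub>v y"] comm_scalar_prod[of x h y] A that by simp
  qed
  show ?thesis unfolding levi_def
  proof (rule block_in_Sp_Z[OF _ _ _ _ inv 1[unfolded levi_def[of h A B]]])
    fix x1 x2 y1 y2 :: "int vec"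
    assume x: "x1 \<in> carrier_vec h" "x2 \<in> carrier_vec h" "y1 \<in> carrier_vec h" "y2 \<in> carrier_vec h"
    have z: "0\<^sub>m h h *\<^sub>v v = 0\<^sub>v h" if "v \<in> carrier_vec h" for v :: "int vec" using that by (intro eq_vecI) auto
    show "(A *\<^sub>v x1 + 0\<^sub>m h h *\<^sub>v x2) \<bullet> (0\<^sub>m h h *\<^sub>v y1 + transpose_mat B *\<^sub>v y2) -
      (0\<^sub>m h h *\<^sub>v x1 + transpose_mat B *\<^sub>v x2) \<bullet> (A *\<^sub>v y1 + 0\<^sub>m h h *\<^sub>v y2) = x1 \<bullet> y2 - x2 \<bullet> y1"
      using x A by (simp add: z t)
  qed (use A in auto)
qed

text \<open>When \<open>B\<close> is inverse to \<open>A\<close>, the hypothesis says that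
  \<open>T\<close> is \<open>A * S * transpose_mat A\<close>: conjugation by the Levi factor acts on
  symmetric matrices by congruence.\<close>

lemma levi_unip:
  assumes "A \<in> carrier_mat h h" "B \<in> carrier_mat h h" "S \<in> carrier_mat h h" "T \<in> carrier_mat h h"
    and "A * S = T * transpose_mat B"
  shows "levi h A B * unip h S = unip h T * levi h A B"
  unfolding levi_def unip_def using assms
  by (simp add: mult_four_block_mat[of _ h h _ h _ h _ _ h _ h])

definition elem :: "nat \<Rightarrow> nat \<Rightarrow> nat \<Rightarrow> int \<Rightarrow> int mat" where
  "elem h i j s = mat h h (\<lambda>(a, b). of_bool (a = b) + s * of_bool (a = i \<and> b = j))"

lemma elem_carrier [simp]: "elem h i j s \<in> carrier_mat h h"
  by (simp add: elem_def)

lemma elem_transpose: "transpose_mat (elem h i j s) = elem h j i s"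
  unfolding elem_def by (intro eq_matI) (auto simp: of_bool_def)

lemma elem_mult:
  assumes M: "M \<in> carrier_mat h h" and ij: "i < h" "j < h"
  shows "elem h i j s * M = mat h h (\<lambda>(a, b). M $$ (a, b) + s * of_bool (a = i) * M $$ (j, b))"
proof (rule eq_matI)
  fix a b assume "a < dim_row (mat h h (\<lambda>(a, b). M $$ (a, b) + s * of_bool (a = i) * M $$ (j, b)))"
    "b < dim_col (mat h h (\<lambda>(a, b). M $$ (a, b) + s * of_bool (a = i) * M $$ (j, b)))"
  then have ab: "a < h" "b < h" by simp_all
  have "(elem h i j s * M) $$ (a, b) = (\<Sum>k<h. (of_bool (a = k) + s * of_bool (a = i \<and> k = j)) * M $$ (k, b))"
    using ab M by (simp add: elem_def scalar_prod_def atLeast0LessThan)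
  also have "\<dots> = (\<Sum>k<h. (if k = a then M $$ (k, b) else 0) + (if k = j then s * of_bool (a = i) * M $$ (k, b) else 0))"
    by (intro sum.cong refl) (auto simp: of_bool_def algebra_simps)
  also have "\<dots> = M $$ (a, b) + s * of_bool (a = i) * M $$ (j, b)"
    using ab ij by (simp add: sum.distrib)
  finally show "(elem h i j s * M) $$ (a, b) = mat h h (\<lambda>(a, b). M $$ (a, b) + s * of_bool (a = i) * M $$ (j, b)) $$ (a, b)"
    using ab by simp
qed (use M in \<open>simp_all add: elem_def\<close>)

text \<open>The indices are swapped because congruence multiplies on the right by the transpose of
  an elementary matrix.\<close>

lemma mult_elem:
  assumes M: "M \<in> carrier_mat h h" and ij: "i < h" "j < h"
  shows "M * elem h j i s = mat h h (\<lambda>(a, b). M $$ (a, b) + s * of_bool (b = i) * M $$ (a, j))"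
proof (rule eq_matI)
  fix a b assume "a < dim_row (mat h h (\<lambda>(a, b). M $$ (a, b) + s * of_bool (b = i) * M $$ (a, j)))"
    "b < dim_col (mat h h (\<lambda>(a, b). M $$ (a, b) + s * of_bool (b = i) * M $$ (a, j)))"
  then have ab: "a < h" "b < h" by simp_all
  have "(M * elem h j i s) $$ (a, b) = (\<Sum>k<h. M $$ (a, k) * (of_bool (k = b) + s * of_bool (k = j \<and> b = i)))"
    using ab M by (simp add: elem_def scalar_prod_def atLeast0LessThan)
  also have "\<dots> = (\<Sum>k<h. (if k = b then M $$ (a, k) else 0) + (if k = j then s * of_bool (b = i) * M $$ (a, k) else 0))"
    by (intro sum.cong refl) (auto simp: of_bool_def algebra_simps)
  also have "\<dots> = M $$ (a, b) + s * of_bool (b = i) * M $$ (a, j)"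
    using ab ij by (simp add: sum.distrib)
  finally show "(M * elem h j i s) $$ (a, b) = mat h h (\<lambda>(a, b). M $$ (a, b) + s * of_bool (b = i) * M $$ (a, j)) $$ (a, b)"
    using ab by simp
qed (use M in \<open>simp_all add: elem_def\<close>)

lemma elem_inverse:
  assumes "i < h" "j < h" "i \<noteq> j"
  shows "elem h i j s * elem h i j (- s) = 1\<^sub>m h"
  unfolding elem_mult[OF elem_carrier assms(1,2)]
  by (intro eq_matI) (use assms in \<open>auto simp: elem_def of_bool_def\<close>)

lemma sp_act_block:
  assumes "P \<in> carrier_mat h h" "Q \<in> carrier_mat h h" "R \<in> carrier_mat h h" "S \<in> carrier_mat h h" "x \<in> sp_L h"
  shows "sp_act h (four_block_mat P Q R S) x i = (if i < h then \<Sum>j<h. of_int (P $$ (i, j)) * x j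
    else if i < 2 * h then \<Sum>j<h. of_int (R $$ (i - h, j)) * x j else 0)"
proof -
  have "(\<Sum>j<2 * h. of_int (four_block_mat P Q R S $$ (i, j)) * x j) =
      (\<Sum>j<h. of_int (four_block_mat P Q R S $$ (i, j)) * x j)"
    by (rule sum.mono_neutral_right) (use assms(5) in \<open>auto simp: sp_L_def\<close>)
  also have "\<dots> = (\<Sum>j<h. of_int (if i < h then P $$ (i, j) else R $$ (i - h, j)) * x j)" if "i < 2 * h"
    using assms(1-4) that by (intro sum.cong refl) auto
  finally show ?thesis unfolding sp_act_def by auto
qed

lemma sp_act_sb:
  assumes "x \<in> sp_L h"
  shows "sp_act h (sb h a b c d) x i = (if i < h then of_int a * x i else if i < 2 * h then of_int c * x (i - h) else 0)"
proof -
  have "(\<Sum>j<h. of_int ((a \<cdot>\<^sub>m 1\<^sub>m h) $$ (k, j)) * x j) = of_int a * x k" if "k < h" for a k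
  proof -
    have "(\<Sum>j<h. of_int ((a \<cdot>\<^sub>m 1\<^sub>m h) $$ (k, j)) * x j) = (\<Sum>j<h. if j = k then of_int a * x j else 0)"
      using that by (intro sum.cong refl) auto
    then show ?thesis using that by simp
  qed
  then show ?thesis unfolding sb_def by (subst sp_act_block) (use assms in auto)
qed

lemma unip_sb: "unip h (a \<cdot>\<^sub>m 1\<^sub>m h) = sb h 1 a 0 1"
  unfolding unip_def sb_def by (intro eq_matI) auto

lemma stabilises_L:
  "S \<in> carrier_mat h h \<Longrightarrow> sp_act h (unip h S) ` sp_L h \<subseteq> sp_L h"
  "A \<in> carrier_mat h h \<Longrightarrow> B \<in> carrier_mat h h \<Longrightarrow> sp_act h (levi h A B) ` sp_L h \<subseteq> sp_L h"
  "sp_act h (sb h a b 0 d) ` sp_L h \<subseteq> sp_L h"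
  by (auto simp: sp_L_def unip_def levi_def sp_act_block sp_act_sb)

lemma sp_maslov_eq_zero:
  assumes "g \<in> carrier (Sp_Z h)" "k \<in> carrier (Sp_Z h)"
    and "sp_act h g ` sp_L h \<subseteq> sp_L h \<or> sp_act h k ` sp_L h \<subseteq> sp_L h \<or> sp_act h (g * k) ` sp_L h \<subseteq> sp_L h"
  shows "sp_maslov h g k = 0"
  using symplectic_rep.maslov_eq_zero[OF symplectic_rep_Sp assms(1,2)] assms(3) by (simp add: sp_maslov_def)

text \<open>Here \<open>W\<close> has order three and the Lagrangians \<open>L, W L, W\<^sup>2 L\<close> are in general position.\<close>

lemma sp_maslov_order_three: "sp_maslov h (sb h 0 (-1) 1 (-1)) (sb h 0 (-1) 1 (-1)) = int h"
proof -
  interpret symplectic_rep "Sp_Z h" "sp_act h" "sp_V h" "sp_L h" "sp_form h" "sp_J h"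
    by (rule symplectic_rep_Sp)
  let ?W = "sb h 0 (-1) 1 (-1)"
  \<comment> \<open>The closing relation forces \<open>a 1 = - a 0\<close> and
    \<open>a 2 = a 0\<close>, so \<open>F\<close> parametrises the triples by
    \<open>L\<close>.\<close>
  define F where "F = (\<lambda>(u::nat \<Rightarrow> real) i. if i = 0 then u else if i = 1 then - u else if i = (2::nat) then u else 0)"
  have F_lin: "linear F" by (rule linearI) (auto simp: F_def fun_eq_iff)
  have W2: "?W \<otimes>\<^bsub>Sp_Z h\<^esub> ?W = sb h (-1) 1 (-1) 0" by (simp add: sb_mult)
  have cond: "sp_act h ?W (a 1) = a 0 + sp_act h (sb h (-1) 1 (-1) 0) (a 2) \<longleftrightarrow> a = F (a 0)"
    if a: "\<forall>i<3. a i \<in> sp_L h" "\<forall>i\<ge>3. a i = 0" for a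
  proof
    have L: "a 0 \<in> sp_L h" "a 1 \<in> sp_L h" "a 2 \<in> sp_L h" using a by auto
    {
      assume e: "sp_act h ?W (a 1) = a 0 + sp_act h (sb h (-1) 1 (-1) 0) (a 2)"
      have 2: "a 2 = a 0"
      proof
        fix i show "a 2 i = a 0 i"
          using fun_cong[OF e, of i] L by (cases "i < h") (auto simp: sp_act_sb, auto simp: sp_L_def)
      qed
      have 1: "a 1 = - a 0"
      proof
        fix i show "a 1 i = (- a 0) i"
          using fun_cong[OF e, of "h + i"] L 2 by (cases "i < h") (auto simp: sp_act_sb, auto simp: sp_L_def)
      qed
      show "a = F (a 0)"
      proof
        fix i show "a i = F (a 0) i" using 1 2 a(2) by (auto simp: F_def not_less elim!: less_3_cases)
      qed
    }
    assume aF: "a = F (a 0)"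
    have "F (a 0) 1 = - a 0" "F (a 0) 2 = a 0" by (simp_all add: F_def)
    then have 1: "a 1 = - a 0" "a 2 = a 0" using fun_cong[OF aF, of 1] fun_cong[OF aF, of 2] by metis+
    show "sp_act h ?W (a 1) = a 0 + sp_act h (sb h (-1) 1 (-1) 0) (a 2)"
    proof
      fix i show "sp_act h ?W (a 1) i = (a 0 + sp_act h (sb h (-1) 1 (-1) 0) (a 2)) i"
        using L by (simp add: 1 sp_act_sb L_closed) (auto simp: sp_L_def)
    qed
  qed
  have space: "maslov_space ?W ?W = F ` sp_L h"
  proof (intro subset_antisym subsetI)
    fix a assume "a \<in> maslov_space ?W ?W"
    then have a: "\<forall>i<3. a i \<in> sp_L h" "\<forall>i\<ge>3. a i = 0" "a = F (a 0)"
      using cond[of a] unfolding maslov_space_def W2 by auto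
    then show "a \<in> F ` sp_L h" by (metis image_eqI zero_less_numeral)
  next
    fix a assume "a \<in> F ` sp_L h"
    then obtain u where u: "u \<in> sp_L h" "a = F u" by blast
    then have "\<forall>i<3. a i \<in> sp_L h" "\<forall>i\<ge>3. a i = 0" "a = F (a 0)"
      using L_closed by (auto simp: F_def)
    then show "a \<in> maslov_space ?W ?W" using cond[of a] unfolding maslov_space_def W2 by auto
  qed
  \<comment> \<open>The square of \<open>W\<close> sends \<open>u\<close> to the vector with both
    halves equal to \<open>- u\<close>; its pairing with \<open>u\<close> is minus the sum of
    squares, and the sign in \<open>maslov_form\<close> makes this positive.\<close>
  have form: "maslov_form ?W ?W (F u) (F u) = (\<Sum>i<h. u i * u i)" if "u \<in> sp_L h" for u
    unfolding maslov_form_def W2 sp_form_def F_def using that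
    by (simp add: sp_act_sb sum_negf[symmetric]) (simp add: sp_L_def)
  have "pos_on (maslov_form ?W ?W) (F ` sp_L h)" unfolding pos_on_def
  proof (intro ballI impI)
    fix x assume "x \<in> F ` sp_L h" "x \<noteq> 0"
    then obtain u where u: "u \<in> sp_L h" "x = F u" "u \<noteq> 0" using linear_0[OF F_lin] by auto
    then obtain i where i: "u i \<noteq> 0" by (auto simp: fun_eq_iff)
    then have "i < h" using u(1) by (auto simp: sp_L_def) (meson not_less)
    have "0 < u i * u i" using i by (simp add: zero_less_mult_iff linorder_neq_iff) argo
    also have "\<dots> \<le> (\<Sum>i<h. u i * u i)" by (rule member_le_sum[of i]) (use \<open>i < h\<close> in auto)
    finally show "0 < maslov_form ?W ?W x x" unfolding u(2) form[OF u(1)] .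
  qed
  then have "maslov ?W ?W = int (ldim (F ` sp_L h))"
    unfolding maslov_def space
    by (intro bilinear_form.signature_pos[OF maslov_form_bilinear] finite_dim_linear_image[OF F_lin L_finite]
        linear_image_subspace[OF F_lin L(1)])
  moreover have "ldim (F ` sp_L h) = ldim (sp_L h)"
    by (rule ldim_linear_image[OF F_lin L_finite L(1)]) (metis F_def zero_fun_apply)
  ultimately show ?thesis by (simp add: sp_maslov_def sp_L_dim)
qed

section \<open>The lower bound\<close>

context
  fixes h :: nat and b :: "int mat \<Rightarrow> real" and C :: real
  assumes h: "2 \<le> h"
    and bound: "\<And>g k. g \<in> carrier (Sp_Z h) \<Longrightarrow> k \<in> carrier (Sp_Z h) \<Longrightarrow>
      \<bar>of_int (sp_maslov h g k) + (b k - b (g * k) + b g)\<bar> \<le> C"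
begin

text \<open>Where the Maslov cocycle vanishes, \<open>b\<close> is additive up to \<open>C\<close>.
  All estimates but the one for \<open>W * W\<close> come from this.\<close>

lemma bound0:
  assumes "g \<in> carrier (Sp_Z h)" "k \<in> carrier (Sp_Z h)"
    and "sp_act h g ` sp_L h \<subseteq> sp_L h \<or> sp_act h k ` sp_L h \<subseteq> sp_L h \<or> sp_act h (g * k) ` sp_L h \<subseteq> sp_L h"
  shows "\<bar>b k - b (g * k) + b g\<bar> \<le> C"
  using bound[OF assms(1,2)] sp_maslov_eq_zero[OF assms] by simp

definition sym_mat :: "int mat \<Rightarrow> bool" where
  "sym_mat S \<longleftrightarrow> S \<in> carrier_mat h h \<and> transpose_mat S = S"

lemma unip_add:
  assumes "sym_mat S" "sym_mat T"
  shows "\<bar>b (unip h (S + T)) - b (unip h S) - b (unip h T)\<bar> \<le> C"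
proof -
  have c: "S \<in> carrier_mat h h" "T \<in> carrier_mat h h" using assms by (auto simp: sym_mat_def)
  have "unip h T * unip h S = unip h (S + T)" by (rule unip_mult[OF c(2,1)])
  then show ?thesis
    using bound0[of "unip h T" "unip h S"] unip_in_Sp_Z stabilises_L(1)[OF c(1)] assms
    by (auto simp: sym_mat_def)
qed

text \<open>Compare \<open>b\<close> on the two sides of \<open>levi_unip\<close>: each product
  splits up to \<open>C\<close>, and the terms of the Levi factor cancel.\<close>

lemma levi_conj:
  assumes S: "sym_mat S" "sym_mat T" and A: "A \<in> carrier_mat h h" "B \<in> carrier_mat h h" "A * B = 1\<^sub>m h" "B * A = 1\<^sub>m h"
    and eq: "A * S = T * transpose_mat B"
  shows "\<bar>b (unip h T) - b (unip h S)\<bar> \<le> 2 * C"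
proof -
  have c: "S \<in> carrier_mat h h" "T \<in> carrier_mat h h" using S by (auto simp: sym_mat_def)
  have u: "unip h S \<in> carrier (Sp_Z h)" "unip h T \<in> carrier (Sp_Z h)" "levi h A B \<in> carrier (Sp_Z h)"
    using S A unip_in_Sp_Z levi_in_Sp_Z by (auto simp: sym_mat_def)
  have "\<bar>b (unip h S) - b (levi h A B * unip h S) + b (levi h A B)\<bar> \<le> C"
    using bound0[OF u(3,1)] stabilises_L(1)[OF c(1)] by blast
  moreover have "\<bar>b (levi h A B) - b (unip h T * levi h A B) + b (unip h T)\<bar> \<le> C"
    using bound0[OF u(2,3)] stabilises_L(1)[OF c(2)] by blast
  ultimately show ?thesis unfolding levi_unip[OF A(1,2) c eq] by linarith
qed

definition diag :: "nat \<Rightarrow> int \<Rightarrow> int mat" where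
  "diag k t = mat h h (\<lambda>(a, c). if a = c \<and> a < k then 2 * t else 0)"

text \<open>Congruence by \<open>elem h i j 1\<close> takes the off-diagonal matrix \<open>S\<close>
  to \<open>S + E\<close>, its two cross terms adding up to \<open>2 * t\<close> at the place
  \<open>(i, i)\<close>. So \<open>b\<close> is at most \<open>3 * C\<close> in absolute value on
  \<open>unip h E\<close>, and adding \<open>E\<close> to the diagonal matrix costs another
  \<open>C\<close>.\<close>

lemma diag_step:
  assumes "i < h"
  shows "\<bar>b (unip h (diag (Suc i) t)) - b (unip h (diag i t))\<bar> \<le> 4 * C"
proof -
  \<comment> \<open>The second coordinate for which \<open>2 \<le> h\<close> is assumed.\<close>
  obtain j where j: "j < h" "i \<noteq> j" using h by (metis One_nat_def Suc_1 Suc_le_lessD less_2_cases_iff linorder_not_le not_less_eq_eq zero_neq_one gr_zeroI)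
  define S where "S = mat h h (\<lambda>(a, c). if a = i \<and> c = j \<or> a = j \<and> c = i then t else 0)"
  define E where "E = mat h h (\<lambda>(a, c). if a = i \<and> c = i then 2 * t else 0)"
  have S: "sym_mat S" unfolding sym_mat_def S_def by (auto intro!: eq_matI)
  have E: "sym_mat E" unfolding sym_mat_def E_def by (auto intro!: eq_matI)
  have SE: "sym_mat (S + E)" unfolding sym_mat_def S_def E_def by (auto intro!: eq_matI)
  have D: "sym_mat (diag k t)" for k unfolding sym_mat_def diag_def by (auto intro!: eq_matI)
  have c: "S \<in> carrier_mat h h" "S + E \<in> carrier_mat h h" using S SE by (auto simp: sym_mat_def)
  have "elem h i j 1 * S = (S + E) * transpose_mat (elem h i j (-1))"
    unfolding elem_transpose elem_mult[OF c(1) assms j(1)] mult_elem[OF c(2) assms j(1)]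
    by (intro eq_matI) (use assms j in \<open>auto simp: S_def E_def\<close>)
  then have "\<bar>b (unip h (S + E)) - b (unip h S)\<bar> \<le> 2 * C"
    using elem_inverse[OF assms j, of 1] elem_inverse[OF assms j, of "-1"] by (intro levi_conj[OF S SE]) auto
  moreover have "\<bar>b (unip h (S + E)) - b (unip h S) - b (unip h E)\<bar> \<le> C" by (rule unip_add[OF S E])
  moreover have "\<bar>b (unip h (diag i t + E)) - b (unip h (diag i t)) - b (unip h E)\<bar> \<le> C" by (rule unip_add[OF D E])
  moreover have "diag i t + E = diag (Suc i) t"
    by (intro eq_matI) (auto simp: diag_def E_def)
  ultimately show ?thesis by (simp only:)
qed

text \<open>The diagonal is filled entry by entry, starting from the zero matrix, where
  \<open>unip\<close> is the identity. The point is that the bound does not involve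
  \<open>t\<close>.\<close>

lemma unip_even_bounded: "\<bar>b (unip h ((2 * t) \<cdot>\<^sub>m 1\<^sub>m h))\<bar> \<le> 4 * C * h + \<bar>b (1\<^sub>m (2 * h))\<bar>"
proof -
  have "\<bar>b (unip h (diag k t))\<bar> \<le> 4 * C * k + \<bar>b (1\<^sub>m (2 * h))\<bar>" if "k \<le> h" for k
    using that
  proof (induction k)
    case 0
    have "diag 0 t = 0\<^sub>m h h" by (intro eq_matI) (auto simp: diag_def)
    then show ?case by (simp add: unip_zero)
  next
    case (Suc k)
    then show ?case using diag_step[of k t] by (simp add: algebra_simps)
  qed
  moreover have "diag h t = (2 * t) \<cdot>\<^sub>m 1\<^sub>m h" by (intro eq_matI) (auto simp: diag_def)
  ultimately show ?thesis by (metis order_refl)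
qed

text \<open>Homogeneity. By \<open>unip_add\<close>, \<open>b\<close> on the \<open>n\<close>-th
  power is within \<open>(n - 1) * C\<close> of \<open>n\<close> times its value here. Even powers
  have values bounded independently of \<open>n\<close>, so a value beyond \<open>C\<close> is
  impossible.\<close>

lemma unip_bounded: "\<bar>b (unip h ((-1) \<cdot>\<^sub>m 1\<^sub>m h))\<bar> \<le> C"
proof (rule ccontr)
  let ?u = "\<lambda>n::nat. unip h ((- int n) \<cdot>\<^sub>m 1\<^sub>m h)"
  assume "\<not> \<bar>b (unip h ((-1) \<cdot>\<^sub>m 1\<^sub>m h))\<bar> \<le> C"
  then have d: "0 < \<bar>b (?u 1)\<bar> - C" by simp
  have sc: "sym_mat (a \<cdot>\<^sub>m 1\<^sub>m h)" for a :: int unfolding sym_mat_def by (auto intro!: eq_matI)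
  \<comment> \<open>The power is \<open>n + 1\<close>; building it up takes \<open>n\<close>
    additions, each with error \<open>C\<close>.\<close>
  have lin: "\<bar>b (?u (Suc n)) - (n + 1) * b (?u 1)\<bar> \<le> n * C" for n :: nat
  proof (induction n)
    case (Suc n)
    have "(- int (Suc n)) \<cdot>\<^sub>m 1\<^sub>m h + (- int 1) \<cdot>\<^sub>m 1\<^sub>m h = (- int (Suc (Suc n))) \<cdot>\<^sub>m 1\<^sub>m h"
      by (intro eq_matI) auto
    then have "\<bar>b (?u (Suc (Suc n))) - b (?u (Suc n)) - b (?u 1)\<bar> \<le> C" using unip_add[OF sc sc] by metis
    then show ?case using Suc by (simp add: algebra_simps)
  qed simp
  define M where "M = 4 * C * h + \<bar>b (1\<^sub>m (2 * h))\<bar>"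
  obtain m :: nat where m: "M < m * (\<bar>b (?u 1)\<bar> - C)" using reals_Archimedean3[OF d] by blast
  have "0 \<le> C" using unip_add[OF sc sc] abs_ge_zero order_trans by blast
  then have "0 \<le> M" by (simp add: M_def)
  then have "m > 0" using m by (cases m) auto
  then have e: "2 * m = Suc (2 * m - 1)" by simp
  have "\<bar>b (?u (2 * m)) - (2 * m) * b (?u 1)\<bar> \<le> (2 * m - 1) * C"
    using lin[of "2 * m - 1"] e \<open>m > 0\<close> by (simp add: of_nat_diff)
  moreover have "\<bar>b (?u (2 * m))\<bar> \<le> M"
    using unip_even_bounded[of "- int m"] by (simp add: M_def)
  moreover have "\<bar>(2 * m) * b (?u 1)\<bar> = 2 * m * \<bar>b (?u 1)\<bar>" by (simp add: abs_mult)
  ultimately have "2 * m * \<bar>b (?u 1)\<bar> \<le> M + (2 * m - 1) * C" by linarith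
  also have "\<dots> \<le> M + 2 * m * C"
    using mult_right_mono[OF _ \<open>0 \<le> C\<close>, of "real (2 * m - 1)" "real (2 * m)"] by simp
  finally have "m * (\<bar>b (?u 1)\<bar> - C) * 2 \<le> M" by (simp add: algebra_simps)
  moreover have "0 \<le> m * (\<bar>b (?u 1)\<bar> - C)" using d by simp
  ultimately show False using m by linarith
qed

theorem defect_bound: "real h \<le> 12 * C"
proof -
  let ?J = "sb h 0 (-1) 1 0" and ?W = "sb h 0 (-1) 1 (-1)" and ?U = "sb h 1 (-1) 0 1"
  let ?J2 = "sb h (-1) 0 0 (-1)" and ?J3 = "sb h 0 1 (-1) 0" and ?W2 = "sb h (-1) 1 (-1) 0" and ?I = "sb h 1 0 0 1"
  have c: "?J \<in> carrier (Sp_Z h)" "?W \<in> carrier (Sp_Z h)" "?U \<in> carrier (Sp_Z h)" "?J2 \<in> carrier (Sp_Z h)"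
    "?J3 \<in> carrier (Sp_Z h)" "?W2 \<in> carrier (Sp_Z h)" "?I \<in> carrier (Sp_Z h)"
    by (simp_all add: sb_in_Sp_Z)
  have 1: "\<bar>b ?I\<bar> \<le> C" using bound0[OF c(7,7)] stabilises_L(3) by (simp add: sb_mult)
  have 2: "\<bar>2 * b ?J - b ?J2\<bar> \<le> C" using bound0[OF c(1,1)] stabilises_L(3) by (simp add: sb_mult)
  have 3: "\<bar>b ?J2 - b ?J3 + b ?J\<bar> \<le> C" using bound0[OF c(1,4)] stabilises_L(3) by (simp add: sb_mult)
  have 4: "\<bar>b ?J3 - b ?I + b ?J\<bar> \<le> C" using bound0[OF c(1,5)] stabilises_L(3) by (simp add: sb_mult)
  have 5: "\<bar>b ?U - b ?W + b ?J\<bar> \<le> C" using bound0[OF c(1,3)] stabilises_L(3) by (simp add: sb_mult)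
  have 6: "\<bar>real h + (2 * b ?W - b ?W2)\<bar> \<le> C"
    using bound[OF c(2,2)] sp_maslov_order_three[of h] by (simp add: sb_mult)
  have 7: "\<bar>b ?W2 - b ?I + b ?W\<bar> \<le> C" using bound0[OF c(2,6)] stabilises_L(3) by (simp add: sb_mult)
  have 8: "\<bar>b ?U\<bar> \<le> C" using unip_bounded by (simp add: unip_sb)
  \<comment> \<open>Adding 6, 7 and three times 5 and 8 gives
    \<open>h \<le> 8 * C + b ?I - 3 * b ?J\<close>. From 2, 3 and 4,
    \<open>4 * b ?J \<ge> b ?I - 3 * C\<close>. With 1 the total is \<open>21 / 2 * C\<close>, and
    \<open>C\<close> is nonnegative by 1.\<close>
  show ?thesis using 1 2 3 4 5 6 7 8 unfolding abs_le_iff by linarith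
qed

end

text \<open>The bound holds for every representative: an infinite supremum exceeds any real number,
  and a finite one serves as the constant \<open>C\<close> of \<open>defect_bound\<close>.\<close>

theorem gromov_norm_ge:
  assumes h: "2 \<le> h"
  shows "ennreal (real h / 12) \<le> gromov_norm (Sp_Z h) (signature_class h)"
  unfolding gromov_norm_def
proof (rule INF_greatest)
  let ?G = "Sp_Z h"
  let ?P = "carrier ?G \<times> carrier ?G"
  fix c assume "c \<in> signature_class h"
  then obtain b where b: "\<And>p. p \<in> ?P \<Longrightarrow> c p - maslov_cochain h p = bar_delta1 ?G b p"
    unfolding signature_class_eq cohomologous2_def by blast
  show "ennreal (real h / 12) \<le> (SUP p\<in>?P. ennreal \<bar>c p\<bar>)"
  proof (cases "(SUP p\<in>?P. ennreal \<bar>c p\<bar>)")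
    case (real C)
    have "\<bar>of_int (sp_maslov h g k) + (b k - b (g * k) + b g)\<bar> \<le> C" if gk: "g \<in> carrier ?G" "k \<in> carrier ?G" for g k
    proof -
      have "ennreal \<bar>c (g, k)\<bar> \<le> ennreal C" unfolding real(2)[symmetric] using gk by (intro SUP_upper) auto
      then have "\<bar>c (g, k)\<bar> \<le> C" using real(1) by simp
      moreover have "c (g, k) = of_int (sp_maslov h g k) + (b k - b (g * k) + b g)"
        using b[of "(g, k)"] gk by (simp add: maslov_cochain_apply bar_delta1_apply)
      ultimately show ?thesis by simp
    qed
    then have "real h \<le> 12 * C" using defect_bound[OF h] by blast
    then show ?thesis unfolding real(2) by (intro ennreal_leI) simp
  next
    case top
    show ?thesis unfolding top by simp
  qed
qed

theorem mainTheorem6: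
  fixes h :: nat
  assumes "h \<ge> 3"
  shows "ennreal ((real h - 2) / 24) \<le> gromov_norm (Sp_Z h) (signature_class h) \<and>
    gromov_norm (Sp_Z h) (signature_class h) \<le> ennreal (real h)"
proof
  have "ennreal ((real h - 2) / 24) \<le> ennreal (real h / 12)" by (intro ennreal_leI) simp
  also have "\<dots> \<le> gromov_norm (Sp_Z h) (signature_class h)" using assms by (intro gromov_norm_ge) simp
  finally show "ennreal ((real h - 2) / 24) \<le> gromov_norm (Sp_Z h) (signature_class h)" .
qed (rule gromov_norm_le)

end
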